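(* Let $K$ be an algebraically closed field of characteristic zero, let $H$ be a connected quasireductive supergroup over $K$, $\mathfrak H=\mathsf{Lie}(H)$, and let $\mathfrak Z=Z(\mathfrak H)$ be the center of $\mathfrak H$. Then $\mathfrak Z$ is algebraic in $\mathfrak H$, i.e. there is a supersubgroup of $H$ whose Lie superalgebra is $\mathfrak Z$.
   Context: An algebraic supergroup $G$ is a group-valued functor on supercommutative $K$-superalgebras represented by a finitely generated supercommutative Hopf superalgebra $K[G]$; connected means $K[G]_0$ has no nontrivial idempotents. Supersubgroups are closed. $G_{ev}$ is the largest even supersubgroup, defined by the ideal $K[G]K[G]_1$. $\mathsf{Lie}(G)=(\mathfrak m/\mathfrak m^2)^*$ with $\mathfrak m=\ker\epsilon_G$. A connected algebraic supergroup $H$ is quasireductive if $H_{ev}$ is linearly reductive, equivalently the unipotent radical of $H_{ev}$ is trivial. *)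

theory Defs
  imports
    "HOL-Computational_Algebra.Polynomial"
    "HOL-Library.Z2"
    "HOL-Algebra.Subrings"
    "HOL-Algebra.QuotRing"
    "HOL-Algebra.Ideal_Product"
begin

text \<open>The ground field is a type \<open>'k\<close> of class \<open>field\<close>; vector spaces are the modules of HOL-Algebra
  over the following ring.  (As always in HOL-Algebra, the fields \<open>mult\<close> and \<open>one\<close> of the record of
  a mere module are irrelevant.)\<close>

definition scalars :: "'k::field ring" where
  "scalars = \<lparr>carrier = UNIV, mult = (*), one = 1, zero = 0, add = (+)\<rparr>"

definition linear_form :: "('k::field, 'v, 'm) module_scheme \<Rightarrow> ('v \<Rightarrow> 'k) \<Rightarrow> bool" where
  "linear_form V f \<longleftrightarrow>
     (\<forall>u\<in>carrier V. \<forall>v\<in>carrier V. f (u \<oplus>\<^bsub>V\<^esub> v) = f u + f v) \<and>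
     (\<forall>k. \<forall>v\<in>carrier V. f (k \<odot>\<^bsub>V\<^esub> v) = k * f v)"

definition bilinear_form ::
  "('k::field, 'v, 'm) module_scheme \<Rightarrow> ('k, 'w, 'n) module_scheme \<Rightarrow> ('v \<Rightarrow> 'w \<Rightarrow> 'k) \<Rightarrow> bool" where
  "bilinear_form V W \<beta> \<longleftrightarrow>
     (\<forall>w\<in>carrier W. linear_form V (\<lambda>v. \<beta> v w)) \<and> (\<forall>v\<in>carrier V. linear_form W (\<beta> v))"

definition trilinear_form ::
  "('k::field, 'u, 'l) module_scheme \<Rightarrow> ('k, 'v, 'm) module_scheme \<Rightarrow> ('k, 'w, 'n) module_scheme
   \<Rightarrow> ('u \<Rightarrow> 'v \<Rightarrow> 'w \<Rightarrow> 'k) \<Rightarrow> bool" where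
  "trilinear_form U V W \<tau> \<longleftrightarrow>
     (\<forall>w\<in>carrier W. bilinear_form U V (\<lambda>u v. \<tau> u v w)) \<and>
     (\<forall>u\<in>carrier U. bilinear_form V W (\<tau> u))"


section \<open>Tensor products\<close>

text \<open>\<open>V \<otimes> W\<close> is realised as the space of functionals on the bilinear forms on \<open>V \<times> W\<close> spanned
  by the evaluations \<open>v \<otimes> w = (\<lambda>\<beta>. \<beta> v w)\<close>; over a field this is a tensor product, because
  bilinear forms separate its elements.  Arguments that are not bilinear forms are sent to 0.
  Consequently, for a tensor \<open>t = (\<Sum>i. v\<^sub>i \<otimes> w\<^sub>i)\<close> and a bilinear form \<open>\<beta>\<close>, the application
  \<open>t (\<lambda>v w. \<beta> v w)\<close> is the sum of the \<open>\<beta> v\<^sub>i w\<^sub>i\<close>.  Triple tensor products are likewise treated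
  as functionals on trilinear forms.\<close>

type_synonym ('k, 'v, 'w) tensor = "('v \<Rightarrow> 'w \<Rightarrow> 'k) \<Rightarrow> 'k"

definition tensor_sum ::
  "('k::field, 'v, 'm) module_scheme \<Rightarrow> ('k, 'w, 'n) module_scheme
   \<Rightarrow> ('v \<times> 'w) list \<Rightarrow> ('k, 'v, 'w) tensor" where
  "tensor_sum V W ps = (\<lambda>\<beta>. if bilinear_form V W \<beta> then (\<Sum>(v, w)\<leftarrow>ps. \<beta> v w) else 0)"

text \<open>All sums of \<open>v \<otimes> w\<close> with \<open>(v, w) \<in> S\<close>.  This is the linear span, as \<open>S\<close> will always be
  closed under scaling one of the components.\<close>

definition tensor_span ::
  "('k::field, 'v, 'm) module_scheme \<Rightarrow> ('k, 'w, 'n) module_scheme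
   \<Rightarrow> ('v \<times> 'w) set \<Rightarrow> ('k, 'v, 'w) tensor set" where
  "tensor_span V W S = {tensor_sum V W ps | ps. set ps \<subseteq> S}"

definition tensor_space ::
  "('k::field, 'v, 'm) module_scheme \<Rightarrow> ('k, 'w, 'n) module_scheme
   \<Rightarrow> ('k, 'v, 'w) tensor set" where
  "tensor_space V W = tensor_span V W (carrier V \<times> carrier W)"

text \<open>\<open>p \<otimes> q\<close>, into the tensor product of \<open>V'\<close> and \<open>W'\<close>\<close>

definition tensor_map ::
  "('k::field, 'v2, 'm) module_scheme \<Rightarrow> ('k, 'w2, 'n) module_scheme
   \<Rightarrow> ('v \<Rightarrow> 'v2) \<Rightarrow> ('w \<Rightarrow> 'w2) \<Rightarrow> ('k, 'v, 'w) tensor \<Rightarrow> ('k, 'v2, 'w2) tensor" where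
  "tensor_map V' W' p q t =
     (\<lambda>\<beta>. if bilinear_form V' W' \<beta> then t (\<lambda>v w. \<beta> (p v) (q w)) else 0)"

definition list_sum :: "('a, 'm) ring_scheme \<Rightarrow> 'a list \<Rightarrow> 'a" where
  "list_sum A xs = foldr (add A) xs \<zero>\<^bsub>A\<^esub>"


section \<open>Superalgebras\<close>

record ('k, 'a) superalgebra = "('k, 'a) module" +
  part :: "bit \<Rightarrow> 'a set"

definition koszul :: "bit \<Rightarrow> bit \<Rightarrow> 'k::field" where
  "koszul i j = (if i = 1 \<and> j = 1 then -1 else 1)"

text \<open>The homogeneous component of degree \<open>i\<close>\<close>

definition component :: "('k, 'a, 'm) superalgebra_scheme \<Rightarrow> bit \<Rightarrow> 'a \<Rightarrow> 'a" where
  "component A i a = (THE x. x \<in> part A i \<and> (\<exists>y\<in>part A (i + 1). a = x \<oplus>\<^bsub>A\<^esub> y))"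

text \<open>In characteristic 2 one would have to require moreover that odd elements square to 0.\<close>

locale supercommutative_superalgebra = ring A + module "scalars :: 'k::field ring" A
  for A :: "('k::field, 'a, 'm) superalgebra_scheme" (structure) +
  assumes smult_mult_left:
      "\<lbrakk>a \<in> carrier A; b \<in> carrier A\<rbrakk> \<Longrightarrow> (k \<odot> a) \<otimes> b = k \<odot> (a \<otimes> b)"
    and smult_mult_right:
      "\<lbrakk>a \<in> carrier A; b \<in> carrier A\<rbrakk> \<Longrightarrow> a \<otimes> (k \<odot> b) = k \<odot> (a \<otimes> b)"
    and part_submodule: "submodule (part A i) (scalars :: 'k ring) A"
    and parts_span: "a \<in> carrier A \<Longrightarrow> \<exists>x\<in>part A 0. \<exists>y\<in>part A 1. a = x \<oplus> y"
    and parts_disjoint: "part A 0 \<inter> part A 1 = {\<zero>}"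
    and one_even: "\<one> \<in> part A 0"
    and part_mult: "\<lbrakk>a \<in> part A i; b \<in> part A j\<rbrakk> \<Longrightarrow> a \<otimes> b \<in> part A (i + j)"
    and supercommutative:
      "\<lbrakk>a \<in> part A i; b \<in> part A j\<rbrakk> \<Longrightarrow> a \<otimes> b = koszul i j \<odot> (b \<otimes> a)"

definition finitely_generated :: "('k::field, 'a, 'm) superalgebra_scheme \<Rightarrow> bool" where
  "finitely_generated A \<longleftrightarrow>
     (\<exists>S. finite S \<and> S \<subseteq> carrier A \<and>
        (\<forall>B. subring B A \<and> submodule B (scalars :: 'k ring) A \<and> S \<subseteq> B \<longrightarrow> B = carrier A))"

text \<open>The product of \<open>A \<otimes> A\<close>, i.e. the bilinear extension of
  \<open>(a \<otimes> b) (c \<otimes> d) = (-1)^(|b| |c|) (a c) \<otimes> (b d)\<close>\<close>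

definition tensor_mult ::
  "('k::field, 'a, 'm) superalgebra_scheme
   \<Rightarrow> ('k, 'a, 'a) tensor \<Rightarrow> ('k, 'a, 'a) tensor \<Rightarrow> ('k, 'a, 'a) tensor" where
  "tensor_mult A s t =
     (\<lambda>\<beta>. if bilinear_form A A \<beta> then
            s (\<lambda>a b. t (\<lambda>c d. \<Sum>i\<in>{0, 1}. \<Sum>j\<in>{0, 1}.
              koszul i j * \<beta> (a \<otimes>\<^bsub>A\<^esub> component A j c) (component A i b \<otimes>\<^bsub>A\<^esub> d)))
          else 0)"


section \<open>Hopf superalgebras and algebraic supergroups\<close>

record ('k, 'a) hopf_superalgebra = "('k, 'a) superalgebra" +
  comult :: "'a \<Rightarrow> ('k, 'a, 'a) tensor"
  counit :: "'a \<Rightarrow> 'k"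
  antipode :: "'a \<Rightarrow> 'a"

locale hopf_superalgebra = supercommutative_superalgebra A
  for A :: "('k::field, 'a, 'm) hopf_superalgebra_scheme" (structure) +
  assumes comult_even:
      "a \<in> part A i \<Longrightarrow> comult A a \<in> tensor_span A A (\<Union>j\<in>{0, 1}. part A j \<times> part A (i + j))"
    and comult_add:
      "\<lbrakk>a \<in> carrier A; b \<in> carrier A\<rbrakk> \<Longrightarrow> comult A (a \<oplus> b) = (\<lambda>\<beta>. comult A a \<beta> + comult A b \<beta>)"
    and comult_smult: "a \<in> carrier A \<Longrightarrow> comult A (k \<odot> a) = (\<lambda>\<beta>. k * comult A a \<beta>)"
    and comult_mult:
      "\<lbrakk>a \<in> carrier A; b \<in> carrier A\<rbrakk>
       \<Longrightarrow> comult A (a \<otimes> b) = tensor_mult A (comult A a) (comult A b)"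
    and comult_one: "comult A \<one> = tensor_sum A A [(\<one>, \<one>)]"
    and counit_linear: "linear_form A (counit A)"
    and counit_mult:
      "\<lbrakk>a \<in> carrier A; b \<in> carrier A\<rbrakk> \<Longrightarrow> counit A (a \<otimes> b) = counit A a * counit A b"
    and counit_one: "counit A \<one> = 1"
    and counit_odd: "a \<in> part A 1 \<Longrightarrow> counit A a = 0"
    and antipode_even: "a \<in> part A i \<Longrightarrow> antipode A a \<in> part A i"
    and antipode_add:
      "\<lbrakk>a \<in> carrier A; b \<in> carrier A\<rbrakk> \<Longrightarrow> antipode A (a \<oplus> b) = antipode A a \<oplus> antipode A b"
    and antipode_smult: "a \<in> carrier A \<Longrightarrow> antipode A (k \<odot> a) = k \<odot> antipode A a"
    and coassoc:
      "\<lbrakk>a \<in> carrier A; trilinear_form A A A \<tau>\<rbrakk> \<Longrightarrow>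
         comult A a (\<lambda>x y. comult A x (\<lambda>u v. \<tau> u v y)) =
         comult A a (\<lambda>x y. comult A y (\<lambda>u v. \<tau> x u v))"
    and counit_left:
      "\<lbrakk>a \<in> carrier A; set ps \<subseteq> carrier A \<times> carrier A; comult A a = tensor_sum A A ps\<rbrakk> \<Longrightarrow>
         list_sum A (map (\<lambda>(x, y). counit A x \<odot> y) ps) = a"
    and counit_right:
      "\<lbrakk>a \<in> carrier A; set ps \<subseteq> carrier A \<times> carrier A; comult A a = tensor_sum A A ps\<rbrakk> \<Longrightarrow>
         list_sum A (map (\<lambda>(x, y). counit A y \<odot> x) ps) = a"
    and antipode_left:
      "\<lbrakk>a \<in> carrier A; set ps \<subseteq> carrier A \<times> carrier A; comult A a = tensor_sum A A ps\<rbrakk> \<Longrightarrow>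
         list_sum A (map (\<lambda>(x, y). antipode A x \<otimes> y) ps) = counit A a \<odot> \<one>"
    and antipode_right:
      "\<lbrakk>a \<in> carrier A; set ps \<subseteq> carrier A \<times> carrier A; comult A a = tensor_sum A A ps\<rbrakk> \<Longrightarrow>
         list_sum A (map (\<lambda>(x, y). x \<otimes> antipode A y) ps) = counit A a \<odot> \<one>"

text \<open>An algebraic supergroup \<open>G\<close> is given by the Hopf superalgebra \<open>K[G]\<close> representing it.\<close>

definition algebraic_supergroup :: "('k::field, 'a, 'm) hopf_superalgebra_scheme \<Rightarrow> bool" where
  "algebraic_supergroup G \<longleftrightarrow> hopf_superalgebra G \<and> finitely_generated G"

definition connected_supergroup :: "('k::field, 'a, 'm) hopf_superalgebra_scheme \<Rightarrow> bool" where
  "connected_supergroup G \<longleftrightarrow>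
     (\<forall>e\<in>part G 0. e \<otimes>\<^bsub>G\<^esub> e = e \<longrightarrow> e = \<zero>\<^bsub>G\<^esub> \<or> e = \<one>\<^bsub>G\<^esub>)"


section \<open>Supersubgroups\<close>

text \<open>Closed supersubgroups of \<open>G\<close> correspond to the Hopf superideals of \<open>K[G]\<close>.\<close>

definition hopf_superideal :: "('k::field, 'a, 'm) hopf_superalgebra_scheme \<Rightarrow> 'a set \<Rightarrow> bool" where
  "hopf_superideal A I \<longleftrightarrow>
     ideal I A \<and>
     (\<forall>a\<in>I. \<forall>i. component A i a \<in> I) \<and>
     (\<forall>a\<in>I. comult A a \<in> tensor_span A A (I \<times> carrier A \<union> carrier A \<times> I)) \<and>
     (\<forall>a\<in>I. counit A a = 0) \<and>
     (\<forall>a\<in>I. antipode A a \<in> I)"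

definition quotient_superalgebra ::
  "('k::field, 'a, 'm) superalgebra_scheme \<Rightarrow> 'a set \<Rightarrow> ('k, 'a set) superalgebra" where
  "quotient_superalgebra A I =
     \<lparr>carrier = carrier (A Quot I), mult = mult (A Quot I), one = one (A Quot I),
      zero = zero (A Quot I), add = add (A Quot I),
      smult = (\<lambda>k X. \<Union>x\<in>X. I +>\<^bsub>A\<^esub> (k \<odot>\<^bsub>A\<^esub> x)),
      part = (\<lambda>i. (\<lambda>a. I +>\<^bsub>A\<^esub> a) ` part A i)\<rparr>"

text \<open>The choices of representatives are immaterial when \<open>I\<close> is a Hopf superideal.\<close>

definition quotient_hopf ::
  "('k::field, 'a, 'm) hopf_superalgebra_scheme \<Rightarrow> 'a set \<Rightarrow> ('k, 'a set) hopf_superalgebra" where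
  "quotient_hopf A I =
     (let Q = quotient_superalgebra A I; \<pi> = (\<lambda>a. I +>\<^bsub>A\<^esub> a) in
      \<lparr>carrier = carrier Q, mult = mult Q, one = one Q, zero = zero Q, add = add Q,
       smult = smult Q, part = part Q,
       comult = (\<lambda>X. tensor_map Q Q \<pi> \<pi> (comult A (SOME a. a \<in> X))),
       counit = (\<lambda>X. counit A (SOME a. a \<in> X)),
       antipode = (\<lambda>X. \<pi> (antipode A (SOME a. a \<in> X)))\<rparr>)"

text \<open>\<open>G\<^sub>e\<^sub>v\<close>, defined by the ideal \<open>K[G] K[G]\<^sub>1\<close>\<close>

definition even_subgroup ::
  "('k::field, 'a, 'm) hopf_superalgebra_scheme \<Rightarrow> ('k, 'a set) hopf_superalgebra" where
  "even_subgroup G = quotient_hopf G (carrier G \<cdot>\<^bsub>G\<^esub> part G 1)"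


section \<open>Linear reductivity\<close>

definition comodule ::
  "('k::field, 'a, 'm) hopf_superalgebra_scheme \<Rightarrow> ('k, 'v, 'n) module_scheme
   \<Rightarrow> ('v \<Rightarrow> ('k, 'v, 'a) tensor) \<Rightarrow> bool" where
  "comodule C V \<rho> \<longleftrightarrow>
     module (scalars :: 'k ring) V \<and>
     (\<forall>v\<in>carrier V. \<rho> v \<in> tensor_space V C) \<and>
     (\<forall>u\<in>carrier V. \<forall>v\<in>carrier V. \<rho> (u \<oplus>\<^bsub>V\<^esub> v) = (\<lambda>\<beta>. \<rho> u \<beta> + \<rho> v \<beta>)) \<and>
     (\<forall>k. \<forall>v\<in>carrier V. \<rho> (k \<odot>\<^bsub>V\<^esub> v) = (\<lambda>\<beta>. k * \<rho> v \<beta>)) \<and>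
     (\<forall>v\<in>carrier V. \<forall>\<tau>. trilinear_form V C C \<tau> \<longrightarrow>
        \<rho> v (\<lambda>x c. \<rho> x (\<lambda>y d. \<tau> y d c)) = \<rho> v (\<lambda>x c. comult C c (\<lambda>d e. \<tau> x d e))) \<and>
     (\<forall>v\<in>carrier V. \<forall>ps. set ps \<subseteq> carrier V \<times> carrier C \<and> \<rho> v = tensor_sum V C ps \<longrightarrow>
        list_sum V (map (\<lambda>(x, c). counit C c \<odot>\<^bsub>V\<^esub> x) ps) = v)"

definition subcomodule ::
  "('k::field, 'a, 'm) hopf_superalgebra_scheme \<Rightarrow> ('k, 'v, 'n) module_scheme
   \<Rightarrow> ('v \<Rightarrow> ('k, 'v, 'a) tensor) \<Rightarrow> 'v set \<Rightarrow> bool" where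
  "subcomodule C V \<rho> W \<longleftrightarrow>
     submodule W (scalars :: 'k ring) V \<and> (\<forall>w\<in>W. \<rho> w \<in> tensor_span V C (W \<times> carrier C))"

definition completely_reducible ::
  "('k::field, 'a, 'm) hopf_superalgebra_scheme \<Rightarrow> ('k, 'v, 'n) module_scheme
   \<Rightarrow> ('v \<Rightarrow> ('k, 'v, 'a) tensor) \<Rightarrow> bool" where
  "completely_reducible C V \<rho> \<longleftrightarrow>
     (\<forall>W. subcomodule C V \<rho> W \<longrightarrow>
        (\<exists>W'. subcomodule C V \<rho> W' \<and> W \<inter> W' = {\<zero>\<^bsub>V\<^esub>} \<and> W <+>\<^bsub>V\<^esub> W' = carrier V))"

text \<open>The vector space \<open>K^n\<close> (with an irrelevant multiplication)\<close>

definition coordinate_space :: "nat \<Rightarrow> ('k::field, nat \<Rightarrow> 'k) module" where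
  "coordinate_space n =
     \<lparr>carrier = {v. \<forall>i\<ge>n. v i = 0},
      mult = (\<lambda>u v i. u i * v i), one = (\<lambda>i. if i < n then 1 else 0),
      zero = (\<lambda>i. 0), add = (\<lambda>u v i. u i + v i), smult = (\<lambda>k v i. k * v i)\<rparr>"

text \<open>All finite-dimensional representations are completely reducible; up to isomorphism, their
  underlying spaces are the \<open>K^n\<close>.  Only applied to purely even groups.\<close>

definition linearly_reductive :: "('k::field, 'a, 'm) hopf_superalgebra_scheme \<Rightarrow> bool" where
  "linearly_reductive G \<longleftrightarrow>
     (\<forall>n \<rho>. comodule G (coordinate_space n) \<rho> \<longrightarrow> completely_reducible G (coordinate_space n) \<rho>)"

definition quasireductive :: "('k::field, 'a, 'm) hopf_superalgebra_scheme \<Rightarrow> bool" where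
  "quasireductive G \<longleftrightarrow> linearly_reductive (even_subgroup G)"


section \<open>The Lie superalgebra of a supergroup\<close>

definition augmentation_ideal :: "('k::field, 'a, 'm) hopf_superalgebra_scheme \<Rightarrow> 'a set" where
  "augmentation_ideal G = {a \<in> carrier G. counit G a = 0}"

text \<open>The dual of \<open>\<mm> / \<mm>\<^sup>2\<close>: linear forms on \<open>\<mm>\<close> that vanish on \<open>\<mm>\<^sup>2\<close>, taken to be 0 outside
  of \<open>\<mm>\<close> so that equality of functions is equality of linear forms\<close>

definition Lie :: "('k::field, 'a, 'm) hopf_superalgebra_scheme \<Rightarrow> ('a \<Rightarrow> 'k) set" where
  "Lie G = {f. linear_form (G\<lparr>carrier := augmentation_ideal G\<rparr>) f \<and>
               (\<forall>a. a \<notin> augmentation_ideal G \<longrightarrow> f a = 0) \<and>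
               (\<forall>a \<in> augmentation_ideal G \<cdot>\<^bsub>G\<^esub> augmentation_ideal G. f a = 0)}"

text \<open>The degree \<open>i\<close> component of \<open>f\<close> is the one that vanishes on elements of degree \<open>i + 1\<close>.\<close>

definition Lie_component ::
  "('k::field, 'a, 'm) hopf_superalgebra_scheme \<Rightarrow> bit \<Rightarrow> ('a \<Rightarrow> 'k) \<Rightarrow> ('a \<Rightarrow> 'k)" where
  "Lie_component G i f = (\<lambda>a. if a \<in> augmentation_ideal G then f (component G i a) else 0)"

text \<open>An element of \<open>Lie G\<close> becomes a distribution, i.e. a linear form on \<open>K[G] = K 1 \<oplus> \<mm>\<close>, upon
  extending it by 0 on constants.  The bracket is the supercommutator of distributions for the
  convolution product \<open>\<phi> \<psi> = (\<phi> \<otimes> \<psi>) \<circ> \<Delta>\<close>, where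
  \<open>(\<phi> \<otimes> \<psi>) (x \<otimes> y) = (-1)^(|\<psi>| |x|) \<phi>(x) \<psi>(y)\<close>.  In the latter only the component of \<open>\<psi>\<close> of
  degree \<open>|y|\<close> contributes.\<close>

definition distribution ::
  "('k::field, 'a, 'm) hopf_superalgebra_scheme \<Rightarrow> ('a \<Rightarrow> 'k) \<Rightarrow> ('a \<Rightarrow> 'k)" where
  "distribution G f = (\<lambda>a. f (a \<ominus>\<^bsub>G\<^esub> (counit G a \<odot>\<^bsub>G\<^esub> \<one>\<^bsub>G\<^esub>)))"

definition convolution ::
  "('k::field, 'a, 'm) hopf_superalgebra_scheme \<Rightarrow> ('a \<Rightarrow> 'k) \<Rightarrow> ('a \<Rightarrow> 'k) \<Rightarrow> ('a \<Rightarrow> 'k)" where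
  "convolution G \<phi> \<psi> = (\<lambda>a. comult G a (\<lambda>x y. \<Sum>i\<in>{0, 1}. \<Sum>j\<in>{0, 1}.
     koszul i j * (\<phi> (component G i x) * \<psi> (component G j y))))"

definition Lie_bracket ::
  "('k::field, 'a, 'm) hopf_superalgebra_scheme \<Rightarrow> ('a \<Rightarrow> 'k) \<Rightarrow> ('a \<Rightarrow> 'k) \<Rightarrow> ('a \<Rightarrow> 'k)" where
  "Lie_bracket G f g = (\<lambda>a. if a \<in> augmentation_ideal G then
     (\<Sum>i\<in>{0, 1}. \<Sum>j\<in>{0, 1}.
        let \<phi> = distribution G (Lie_component G i f); \<psi> = distribution G (Lie_component G j g)
        in convolution G \<phi> \<psi> a - koszul i j * convolution G \<psi> \<phi> a)
     else 0)"

definition Lie_center :: "('k::field, 'a, 'm) hopf_superalgebra_scheme \<Rightarrow> ('a \<Rightarrow> 'k) set" where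
  "Lie_center G = {z \<in> Lie G. \<forall>f \<in> Lie G. Lie_bracket G z f = (\<lambda>_. 0)}"

text \<open>The Lie superalgebra of the supersubgroup defined by the Hopf superideal \<open>I\<close>, embedded in
  \<open>Lie G\<close> by the differential of the inclusion, i.e. by composition with \<open>K[G] \<rightarrow> K[G] / I\<close>\<close>

definition Lie_of_subgroup ::
  "('k::field, 'a, 'm) hopf_superalgebra_scheme \<Rightarrow> 'a set \<Rightarrow> ('a \<Rightarrow> 'k) set" where
  "Lie_of_subgroup G I =
     (\<lambda>f a. if a \<in> augmentation_ideal G then f (I +>\<^bsub>G\<^esub> a) else 0) ` Lie (quotient_hopf G I)"

end

theory Submission
  imports Defs
begin

text \<open>The center of the Lie superalgebra is the kernel of its adjoint representation, hence the
  Lie superalgebra of the centralizer of \<open>Lie H\<close> in \<open>H\<close>.  The latter consists of the points \<open>h\<close> at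
  which the distributions \<open>h \<gamma>\<close> and \<open>\<gamma> h\<close> agree for all \<open>\<gamma> \<in> Lie H\<close>, so it is defined by the ideal \<open>I\<close>
  generated by the elements \<open>d\<^sub>\<gamma>(a) = \<Sum> \<plusminus> a\<^sub>1 \<gamma>(a\<^sub>2) - \<gamma>(a\<^sub>1) a\<^sub>2\<close>.  From
  \<open>\<Delta>(d\<^sub>\<gamma>(a)) = \<Sum> d\<^sub>\<gamma>(a\<^sub>1) \<otimes> a\<^sub>2 \<plusminus> a\<^sub>1 \<otimes> d\<^sub>\<gamma>(a\<^sub>2)\<close> one sees that \<open>I\<close> is a Hopf superideal, and
  \<open>z(d\<^sub>\<gamma>(a)) = [z, \<gamma>](a)\<close> shows that \<open>z \<in> Lie H\<close> vanishes on \<open>I\<close> if and only if it is central.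

  Elements given by tensors, and identities between them, are handled by applying all linear forms,
  since linear forms separate the elements of a vector space.\<close>

section \<open>Linear forms\<close>

text \<open>The signs depend on degrees, while neither the central element \<open>z\<close> nor
  \<gamma> has to be homogeneous. So the generators use only the homogeneous components of \<gamma>,
  and the sign is carried by a power of the parity automorphism, which makes \<open>d\<close> linear
  in every \<open>a\<close>. The bracket of \<open>z\<close> with \<gamma> is then a sum of two
  displacements, one for each degree; they are separated by testing with the components of \<gamma>,
  which again lie in the Lie superalgebra. That vanishing on the ideal can be tested on generators
  holds because \<open>z\<close> kills the square of the augmentation ideal, so that the elements of
  the augmentation ideal killed by \<open>z\<close> form an ideal. The delicate closure property is
  the one under the antipode: the axioms do not relate the antipode to products, so its value on a
  multiple of a generator is not determined by its value on the generator. Finally, a tensor is a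
  functional that sends arguments that are not bilinear to 0; hence the recurring proofs that
  intermediate sums are bilinear in their remaining variables.\<close>

lemma (in submodule) closed:
  assumes "module R M"
  shows "H \<subseteq> carrier M" "\<zero> \<in> H"
    "\<And>x y. \<lbrakk>x \<in> H; y \<in> H\<rbrakk> \<Longrightarrow> x \<oplus> y \<in> H" "\<And>x y. \<lbrakk>x \<in> H; y \<in> H\<rbrakk> \<Longrightarrow> x \<ominus> y \<in> H"
  using subset one_closed m_closed module.submoduleE[OF assms submodule_axioms]
  by (auto simp: a_minus_def)

lemma scalars_simps [simp]:
  "carrier scalars = UNIV" "mult scalars = (*)" "one scalars = 1" "zero scalars = 0" "add scalars = (+)"
  by (simp_all add: scalars_def)

lemma Union_chain_submodule:
  assumes M: "module R M" and "\<C> \<noteq> {}" and chain: "\<And>X Y. \<lbrakk>X \<in> \<C>; Y \<in> \<C>\<rbrakk> \<Longrightarrow> X \<subseteq> Y \<or> Y \<subseteq> X"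
    and sub: "\<And>X. X \<in> \<C> \<Longrightarrow> submodule X R M"
  shows "submodule (\<Union>\<C>) R M"
proof (rule module.submoduleI[OF M])
  fix a b assume "a \<in> \<Union>\<C>" "b \<in> \<Union>\<C>"
  then obtain X where "X \<in> \<C>" "a \<in> X" "b \<in> X"
    by (metis UnionE chain subsetD)
  then show "a \<oplus>\<^bsub>M\<^esub> b \<in> \<Union>\<C>"
    using module.submoduleE(5)[OF M sub] by blast
next
  obtain X where "X \<in> \<C>"
    using \<open>\<C> \<noteq> {}\<close> by blast
  then show "\<zero>\<^bsub>M\<^esub> \<in> \<Union>\<C>"
    using submodule.closed(2)[OF sub M] by blast
qed (use module.submoduleE[OF M sub] in blast)+

text \<open>No basis is chosen: Zorn's lemma gives a submodule \<open>M\<close> that is maximal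
  among those containing \<open>W\<close> and avoiding \<open>a\<close>. Then \<open>V\<close> is
  the direct sum of \<open>M\<close> and the line through \<open>a\<close>, and the form is the
  coordinate along \<open>a\<close>.\<close>

lemma linear_form_separating:
  fixes V :: "('k::field, 'v, 'm) module_scheme"
  assumes V: "module scalars V" and W: "submodule W scalars V"
    and a: "a \<in> carrier V" "a \<notin> W"
  obtains f where "linear_form V f" "\<And>w. w \<in> W \<Longrightarrow> f w = 0" "f a \<noteq> 0"
proof -
  interpret V: module "scalars :: 'k ring" V by (rule V)
  define \<A> where "\<A> = {M. submodule M scalars V \<and> W \<subseteq> M \<and> a \<notin> M}"
  have "\<exists>M\<in>\<A>. \<forall>X\<in>\<A>. M \<subseteq> X \<longrightarrow> X = M"
  proof (rule subset_Zorn_nonempty)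
    show "\<A> \<noteq> {}" using W a unfolding \<A>_def by blast
  next
    fix \<C> assume C: "\<C> \<noteq> {}" "subset.chain \<A> \<C>"
    then have "submodule (\<Union>\<C>) scalars V"
      by (intro Union_chain_submodule[OF V]) (auto simp: subset_chain_def \<A>_def)
    then show "\<Union>\<C> \<in> \<A>"
      using C by (auto simp: subset_chain_def \<A>_def)
  qed
  then obtain M where "M \<in> \<A>" and M_max: "\<forall>X\<in>\<A>. M \<subseteq> X \<longrightarrow> X = M" ..
  then have M: "submodule M scalars V" "W \<subseteq> M" "a \<notin> M"
    by (auto simp: \<A>_def)
  have max: "X = M" if "submodule X scalars V" "M \<subseteq> X" "a \<notin> X" for X
    using M_max that M(2) by (auto simp: \<A>_def)
  interpret M: submodule M "scalars :: 'k ring" V by (rule M)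
  note Mc = M.closed[OF V] and Ms = M.smult_closed[simplified]
  have Mcarr: "\<And>x. x \<in> M \<Longrightarrow> x \<in> carrier V" using Mc(1) by blast
  note Vs = V.smult_closed[simplified] V.smult_l_distr[simplified] V.smult_r_distr[simplified]
    V.smult_assoc1[simplified, symmetric] V.smult_one[simplified]
  have minus: "\<ominus>\<^bsub>V\<^esub> x = (-1) \<odot>\<^bsub>V\<^esub> x" if "x \<in> carrier V" for x
  proof -
    have "(-1) \<odot>\<^bsub>V\<^esub> x \<oplus>\<^bsub>V\<^esub> x = ((-1) + 1) \<odot>\<^bsub>V\<^esub> x"
      using that by (simp only: Vs)
    also have "\<dots> = \<zero>\<^bsub>V\<^esub>" using V.smult_l_null that by simp
    finally show ?thesis using that Vs(1) V.minus_equality by auto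
  qed
  have minus_null: "v \<ominus>\<^bsub>V\<^esub> 0 \<odot>\<^bsub>V\<^esub> a = v" if "v \<in> carrier V" for v
    using that a V.smult_l_null by (simp add: V.minus_eq minus Vs)
  \<comment> \<open>By maximality, \<open>M\<close> is a complement of the line spanned by \<open>a\<close>.\<close>
  have ex: "\<exists>k. v \<ominus>\<^bsub>V\<^esub> k \<odot>\<^bsub>V\<^esub> a \<in> M" if v: "v \<in> carrier V" for v
  proof (cases "v \<in> M")
    case True
    then have "v \<ominus>\<^bsub>V\<^esub> 0 \<odot>\<^bsub>V\<^esub> a \<in> M" using v by (simp add: minus_null)
    then show ?thesis by blast
  next
    case False
    \<comment> \<open>This is \<open>M\<close> plus the line through \<open>v\<close>. It is
      strictly larger than \<open>M\<close>, so it contains \<open>a\<close>; the coefficient of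
      \<open>v\<close> in \<open>a\<close> is nonzero because \<open>a\<close> is not in
      \<open>M\<close>, and one can solve for \<open>v\<close>.\<close>
    define X where "X = {m \<oplus>\<^bsub>V\<^esub> k \<odot>\<^bsub>V\<^esub> v | m k. m \<in> M}"
    have "submodule X scalars V"
    proof (rule V.submoduleI)
      show "X \<subseteq> carrier V" using v Mcarr Vs(1) by (auto simp: X_def)
      show "\<zero>\<^bsub>V\<^esub> \<in> X" unfolding X_def using Mc(2) V.smult_l_null v
        by (intro CollectI exI[of _ "\<zero>\<^bsub>V\<^esub>"] exI[of _ 0]) auto
    next
      fix x y assume "x \<in> X" "y \<in> X"
      then obtain m k m' k' where *: "m \<in> M" "m' \<in> M" "x = m \<oplus>\<^bsub>V\<^esub> k \<odot>\<^bsub>V\<^esub> v" "y = m' \<oplus>\<^bsub>V\<^esub> k' \<odot>\<^bsub>V\<^esub> v"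
        unfolding X_def by blast
      have "x \<oplus>\<^bsub>V\<^esub> y = (m \<oplus>\<^bsub>V\<^esub> m') \<oplus>\<^bsub>V\<^esub> (k + k') \<odot>\<^bsub>V\<^esub> v"
        using * v Mcarr by (simp add: Vs V.add.m_ac)
      then show "x \<oplus>\<^bsub>V\<^esub> y \<in> X" unfolding X_def using Mc(3) * by blast
    next
      fix c x assume "x \<in> X"
      then obtain m k where *: "m \<in> M" "x = m \<oplus>\<^bsub>V\<^esub> k \<odot>\<^bsub>V\<^esub> v"
        unfolding X_def by blast
      then have "c \<odot>\<^bsub>V\<^esub> x = c \<odot>\<^bsub>V\<^esub> m \<oplus>\<^bsub>V\<^esub> (c * k) \<odot>\<^bsub>V\<^esub> v"
        using v Mcarr by (simp add: Vs)
      then show 1: "c \<odot>\<^bsub>V\<^esub> x \<in> X" unfolding X_def using Ms * by blast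
    next
      fix x assume "x \<in> X"
      then obtain m k where *: "m \<in> M" "x = m \<oplus>\<^bsub>V\<^esub> k \<odot>\<^bsub>V\<^esub> v"
        unfolding X_def by blast
      then have "\<ominus>\<^bsub>V\<^esub> x = (-1) \<odot>\<^bsub>V\<^esub> m \<oplus>\<^bsub>V\<^esub> ((-1) * k) \<odot>\<^bsub>V\<^esub> v"
        using v Mcarr by (subst minus) (simp_all only: Vs V.add.m_closed)
      then show "\<ominus>\<^bsub>V\<^esub> x \<in> X" unfolding X_def using Ms * by blast
    qed
    moreover have "M \<subseteq> X"
    proof
      fix m assume "m \<in> M"
      moreover have "m = m \<oplus>\<^bsub>V\<^esub> 0 \<odot>\<^bsub>V\<^esub> v" using \<open>m \<in> M\<close> Mcarr v V.smult_l_null by simp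
      ultimately show "m \<in> X" unfolding X_def by blast
    qed
    moreover have "v \<in> X"
    proof -
      have "v = \<zero>\<^bsub>V\<^esub> \<oplus>\<^bsub>V\<^esub> 1 \<odot>\<^bsub>V\<^esub> v" using v by (simp add: Vs)
      then show ?thesis unfolding X_def using Mc(2) by blast
    qed
    ultimately have "a \<in> X" using max False by blast
    then obtain m k where mk: "m \<in> M" "a = m \<oplus>\<^bsub>V\<^esub> k \<odot>\<^bsub>V\<^esub> v" unfolding X_def by blast
    have "k \<noteq> 0"
    proof
      assume "k = 0"
      then have "a = m" using mk Mcarr v V.smult_l_null by simp
      then show False using mk M by blast
    qed
    have "v \<ominus>\<^bsub>V\<^esub> (1 / k) \<odot>\<^bsub>V\<^esub> a = v \<oplus>\<^bsub>V\<^esub> ((- (1 / k)) \<odot>\<^bsub>V\<^esub> m \<oplus>\<^bsub>V\<^esub> (-1) \<odot>\<^bsub>V\<^esub> v)"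
      using mk v Mcarr \<open>k \<noteq> 0\<close> by (simp add: V.minus_eq minus Vs)
    also have "\<dots> = (- (1 / k)) \<odot>\<^bsub>V\<^esub> m \<oplus>\<^bsub>V\<^esub> (v \<oplus>\<^bsub>V\<^esub> \<ominus>\<^bsub>V\<^esub> v)"
      using mk v Mcarr Vs(1) by (subst minus) (simp_all add: V.add.m_ac)
    also have "\<dots> = (- (1 / k)) \<odot>\<^bsub>V\<^esub> m"
      using mk v Mcarr Vs(1) by (simp add: V.r_neg)
    finally show ?thesis using mk Ms by metis
  qed
  have unique: "k = k'" if v: "v \<in> carrier V" and k: "v \<ominus>\<^bsub>V\<^esub> k \<odot>\<^bsub>V\<^esub> a \<in> M" and k': "v \<ominus>\<^bsub>V\<^esub> k' \<odot>\<^bsub>V\<^esub> a \<in> M"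
    for v k k'
  proof (rule ccontr)
    assume ne: "k \<noteq> k'"
    have "(v \<ominus>\<^bsub>V\<^esub> k \<odot>\<^bsub>V\<^esub> a) \<ominus>\<^bsub>V\<^esub> (v \<ominus>\<^bsub>V\<^esub> k' \<odot>\<^bsub>V\<^esub> a)
      = (v \<oplus>\<^bsub>V\<^esub> (-1) \<odot>\<^bsub>V\<^esub> v) \<oplus>\<^bsub>V\<^esub> ((- k) \<odot>\<^bsub>V\<^esub> a \<oplus>\<^bsub>V\<^esub> k' \<odot>\<^bsub>V\<^esub> a)"
      using v a by (simp add: V.minus_eq minus Vs(1,3-5) V.add.m_ac)
    also have "\<dots> = (k' - k) \<odot>\<^bsub>V\<^esub> a"
      using v a by (simp add: minus[symmetric] Vs(2)[symmetric] V.r_neg Vs(1))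
    finally have "(k' - k) \<odot>\<^bsub>V\<^esub> a \<in> M" using Mc(4) k k' by metis
    then have "(1 / (k' - k)) \<odot>\<^bsub>V\<^esub> ((k' - k) \<odot>\<^bsub>V\<^esub> a) \<in> M" by (rule Ms)
    then show False using ne a M(3) by (simp add: Vs)
  qed
  define f where "f v = (THE k. v \<ominus>\<^bsub>V\<^esub> k \<odot>\<^bsub>V\<^esub> a \<in> M)" for v
  have fI: "f v = k" if "v \<in> carrier V" "v \<ominus>\<^bsub>V\<^esub> k \<odot>\<^bsub>V\<^esub> a \<in> M" for v k
    unfolding f_def using that unique by blast
  have fM: "v \<ominus>\<^bsub>V\<^esub> f v \<odot>\<^bsub>V\<^esub> a \<in> M" if "v \<in> carrier V" for v
    using fI ex that by metis
  show ?thesis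
  proof (rule that)
    show "linear_form V f"
      unfolding linear_form_def
    proof (intro conjI ballI allI)
      fix u v assume uv: "u \<in> carrier V" "v \<in> carrier V"
      have "u \<oplus>\<^bsub>V\<^esub> v \<ominus>\<^bsub>V\<^esub> (f u + f v) \<odot>\<^bsub>V\<^esub> a = (u \<ominus>\<^bsub>V\<^esub> f u \<odot>\<^bsub>V\<^esub> a) \<oplus>\<^bsub>V\<^esub> (v \<ominus>\<^bsub>V\<^esub> f v \<odot>\<^bsub>V\<^esub> a)"
        using uv a by (simp add: V.minus_eq minus Vs V.add.m_ac)
      then show "f (u \<oplus>\<^bsub>V\<^esub> v) = f u + f v"
        using uv fM Mc(3) by (intro fI) auto
    next
      fix k v assume v: "v \<in> carrier V"
      have "k \<odot>\<^bsub>V\<^esub> v \<ominus>\<^bsub>V\<^esub> (k * f v) \<odot>\<^bsub>V\<^esub> a = k \<odot>\<^bsub>V\<^esub> (v \<ominus>\<^bsub>V\<^esub> f v \<odot>\<^bsub>V\<^esub> a)"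
        using v a by (simp add: V.minus_eq minus Vs)
      then show "f (k \<odot>\<^bsub>V\<^esub> v) = k * f v"
        using v fM Ms Vs(1) by (intro fI) auto
    qed
    show "f w = 0" if "w \<in> W" for w
      using that M(2) Mcarr by (intro fI) (auto simp: minus_null)
    have "f a = 1"
      using a Mc(2) by (intro fI) (auto simp: Vs V.minus_eq V.r_neg)
    then show "f a \<noteq> 0" by simp
  qed
qed

section \<open>Tensors\<close>

lemma tensor_sum_apply:
  "bilinear_form V W \<beta> \<Longrightarrow> tensor_sum V W ps \<beta> = (\<Sum>(v, w)\<leftarrow>ps. \<beta> v w)"
  by (simp add: tensor_sum_def)

text \<open>Bilinearity is tested only on the carriers, and these are closed under the operations.
  This guards the default value 0: forms that agree on the carriers take the same branch in
  \<open>tensor_sum\<close>.\<close>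

lemma bilinear_form_cong:
  assumes "module scalars V" "module scalars W"
    and eq: "\<And>v w. \<lbrakk>v \<in> carrier V; w \<in> carrier W\<rbrakk> \<Longrightarrow> \<beta> v w = \<beta>' v w"
  shows "bilinear_form V W \<beta> \<longleftrightarrow> bilinear_form V W \<beta>'"
proof -
  interpret V: module scalars V by fact
  interpret W: module scalars W by fact
  note [simp] = V.smult_closed[simplified] W.smult_closed[simplified]
  show ?thesis
    unfolding bilinear_form_def linear_form_def by (simp add: eq)
qed

context
  fixes V :: "('k::field, 'v, 'm) module_scheme" and W :: "('k, 'w, 'n) module_scheme"
    and t :: "('k, 'v, 'w) tensor"
  assumes V: "module scalars V" and W: "module scalars W"
    and t: "t \<in> tensor_space V W"
begin

lemma tensor_cong:
  assumes "\<And>v w. \<lbrakk>v \<in> carrier V; w \<in> carrier W\<rbrakk> \<Longrightarrow> \<beta> v w = \<beta>' v w"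
  shows "t \<beta> = t \<beta>'"
proof -
  obtain ps where ps: "t = tensor_sum V W ps" "set ps \<subseteq> carrier V \<times> carrier W"
    using t by (auto simp: tensor_space_def tensor_span_def)
  have "map (\<lambda>(v, w). \<beta> v w) ps = map (\<lambda>(v, w). \<beta>' v w) ps"
    using ps(2) assms by auto
  moreover note bilinear_form_cong[OF V W, of \<beta> \<beta>'] assms
  ultimately show ?thesis
    unfolding ps(1) tensor_sum_def by metis
qed

lemma tensor_zero: "t (\<lambda>v w. 0) = 0"
proof -
  have "(\<Sum>(v, w)\<leftarrow>ps. 0) = (0 :: 'k)" for ps :: "('v \<times> 'w) list"
    by (induction ps) auto
  then show ?thesis
    using t by (auto simp: tensor_space_def tensor_span_def tensor_sum_def)
qed

lemma tensor_eq_0: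
  assumes "\<And>v w. \<lbrakk>v \<in> carrier V; w \<in> carrier W\<rbrakk> \<Longrightarrow> \<beta> v w = 0"
  shows "t \<beta> = 0"
  using tensor_cong[of \<beta> "\<lambda>v w. 0"] assms tensor_zero by simp

text \<open>This makes an iterated Sweedler sum linear in the variable that the inner tensor does
  not touch. Every \<open>\<beta> u\<close> has to be bilinear, since the default value 0 would
  destroy additivity.\<close>

lemma linear_form_tensor:
  assumes "\<And>u. u \<in> carrier U \<Longrightarrow> bilinear_form V W (\<beta> u)"
    and "\<And>v w. \<lbrakk>v \<in> carrier V; w \<in> carrier W\<rbrakk> \<Longrightarrow> linear_form U (\<lambda>u. \<beta> u v w)"
    and U: "module scalars U"
  shows "linear_form U (\<lambda>u. t (\<beta> u))"
proof -
  interpret U: module "scalars :: 'k ring" U by (rule U)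
  obtain ps where ps: "t = tensor_sum V W ps" "set ps \<subseteq> carrier V \<times> carrier W"
    using t by (auto simp: tensor_space_def tensor_span_def)
  have eq: "t (\<beta> u) = (\<Sum>(v, w)\<leftarrow>ps. \<beta> u v w)" if "u \<in> carrier U" for u
    using that assms(1) by (simp add: ps(1) tensor_sum_apply)
  have lin: "linear_form U (\<lambda>u. \<Sum>(v, w)\<leftarrow>ps. \<beta> u v w)"
    using ps(2)
  proof (induction ps)
    case (Cons p ps)
    then show ?case
      using assms(2)[of "fst p" "snd p"]
      by (auto simp: linear_form_def split_beta algebra_simps)
  qed (simp add: linear_form_def)
  then show ?thesis
    using U.smult_closed[simplified] by (simp add: linear_form_def eq)
qed

end

text \<open>Exchange of two finite sums. The two bilinearity conditions ensure that both the inner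
  and the outer evaluations are genuine sums rather than the default 0.\<close>

lemma tensor_swap:
  fixes V :: "('k::field, 'v, 'm) module_scheme" and W :: "('k, 'w, 'n) module_scheme"
    and V' :: "('k, 'v2, 'm2) module_scheme" and W' :: "('k, 'w2, 'n2) module_scheme"
  assumes t: "t \<in> tensor_space V W" and V: "module scalars V" "module scalars W"
    and s: "s \<in> tensor_space V' W'" and V': "module scalars V'" "module scalars W'"
    and \<gamma>: "\<And>x y. \<lbrakk>x \<in> carrier V; y \<in> carrier W\<rbrakk> \<Longrightarrow> bilinear_form V' W' (\<gamma> x y)"
      "\<And>p q. \<lbrakk>p \<in> carrier V'; q \<in> carrier W'\<rbrakk> \<Longrightarrow> bilinear_form V W (\<lambda>x y. \<gamma> x y p q)"
  shows "t (\<lambda>x y. s (\<gamma> x y)) = s (\<lambda>p q. t (\<lambda>x y. \<gamma> x y p q))"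
proof -
  obtain ps where ps: "t = tensor_sum V W ps" "set ps \<subseteq> carrier V \<times> carrier W"
    using t by (auto simp: tensor_space_def tensor_span_def)
  obtain qs where qs: "s = tensor_sum V' W' qs" "set qs \<subseteq> carrier V' \<times> carrier W'"
    using s by (auto simp: tensor_space_def tensor_span_def)
  define \<gamma>' where "\<gamma>' x y = (\<Sum>(p, q)\<leftarrow>qs. \<gamma> x y p q)" for x y
  define \<gamma>'' where "\<gamma>'' p q = (\<Sum>(x, y)\<leftarrow>ps. \<gamma> x y p q)" for p q
  have lin: "linear_form U (\<lambda>u. \<Sum>p\<leftarrow>xs. f u p)"
    if "\<And>p. p \<in> set xs \<Longrightarrow> linear_form U (\<lambda>u. f u p)"
    for U :: "('k, 'u, 'l) module_scheme" and xs :: "'p list" and f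
    using that by (induction xs) (auto simp: linear_form_def algebra_simps)
  have lin': "linear_form U (\<lambda>u. \<Sum>(p, q)\<leftarrow>xs. f u p q)"
    if "\<And>p q. (p, q) \<in> set xs \<Longrightarrow> linear_form U (\<lambda>u. f u p q)"
    for U :: "('k, 'u, 'l) module_scheme" and xs :: "('p \<times> 'q) list" and f
    using that lin[of xs U "\<lambda>u (p, q). f u p q"] by (auto simp: split_def)
  have b': "bilinear_form V W \<gamma>'"
    using qs(2) \<gamma>(2) unfolding bilinear_form_def \<gamma>'_def by (auto intro!: lin')
  have b'': "bilinear_form V' W' \<gamma>''"
    using ps(2) \<gamma>(1) unfolding bilinear_form_def \<gamma>''_def by (auto intro!: lin')
  have "t (\<lambda>x y. s (\<gamma> x y)) = t \<gamma>'"
    by (rule tensor_cong[OF V t]) (simp add: \<gamma>'_def qs(1) tensor_sum_apply \<gamma>)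
  also have "\<dots> = (\<Sum>(x, y)\<leftarrow>ps. \<Sum>(p, q)\<leftarrow>qs. \<gamma> x y p q)"
    by (simp add: b' ps(1) tensor_sum_apply \<gamma>'_def)
  also have "\<dots> = (\<Sum>(p, q)\<leftarrow>qs. \<Sum>(x, y)\<leftarrow>ps. \<gamma> x y p q)"
    by (induction ps) (auto simp: split_def sum_list_addf)
  also have "\<dots> = s \<gamma>''"
    by (simp add: b'' qs(1) tensor_sum_apply \<gamma>''_def)
  also have "\<dots> = s (\<lambda>p q. t (\<lambda>x y. \<gamma> x y p q))"
    by (rule tensor_cong[OF V' s]) (simp add: \<gamma>''_def ps(1) tensor_sum_apply \<gamma>)
  finally show ?thesis .
qed

lemma tensor_span_mono: "S \<subseteq> T \<Longrightarrow> tensor_span V W S \<subseteq> tensor_span V W T"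
  by (fastforce simp: tensor_span_def)

lemma tensor_span_add:
  assumes "s \<in> tensor_span V W S" "t \<in> tensor_span V W S"
  shows "(\<lambda>\<beta>. s \<beta> + t \<beta>) \<in> tensor_span V W S"
proof -
  obtain ps qs where "s = tensor_sum V W ps" "set ps \<subseteq> S" "t = tensor_sum V W qs" "set qs \<subseteq> S"
    using assms by (auto simp: tensor_span_def)
  then have "(\<lambda>\<beta>. s \<beta> + t \<beta>) = tensor_sum V W (ps @ qs)" "set (ps @ qs) \<subseteq> S"
    by (auto simp: tensor_sum_def fun_eq_iff)
  then show ?thesis unfolding tensor_span_def by blast
qed

lemma tensor_span_rep:
  assumes "t \<in> tensor_span V W S"
  obtains ps where "t = tensor_sum V W ps" "set ps \<subseteq> S"
  using assms by (auto simp: tensor_span_def)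

section \<open>Superalgebras\<close>

lemma bit_add_cancel [simp]: "i + (i + j) = (j :: bit)" "(i + j) + j = i" "i + i = 0"
  by (cases i; cases j; simp)+

lemma bit_neq_iff: "i \<noteq> j \<longleftrightarrow> i = j + 1" for i j :: bit
  by (cases i; cases j) auto

lemma koszul_commute: "koszul i j = koszul j i"
  by (auto simp: koszul_def)

lemma koszul_square [simp]: "koszul i j * koszul i j = (1 :: 'k :: field)"
  by (auto simp: koszul_def)

lemma koszul_zero [simp]: "koszul 0 i = 1" "koszul i 0 = 1"
  by (auto simp: koszul_def)

text \<open>Together with \<open>koszul_add_right\<close>: the Koszul sign is a bicharacter of the
  integers modulo 2, so signs of composite degrees factor.\<close>

lemma koszul_add_left: "koszul (i + j) l = (koszul i l * koszul j l :: 'k :: field)"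
  by (cases i; cases j; cases l) (auto simp: koszul_def)

lemma koszul_add_right: "koszul l (i + j) = (koszul l i * koszul l j :: 'k :: field)"
  by (cases i; cases j; cases l) (auto simp: koszul_def)

context supercommutative_superalgebra
begin

section \<open>Linear forms and linear maps on a superalgebra\<close>

abbreviation lin :: "('a \<Rightarrow> 'k) \<Rightarrow> bool" where "lin \<equiv> linear_form A"

definition linear_map :: "('a \<Rightarrow> 'a) \<Rightarrow> bool" where
  "linear_map F \<longleftrightarrow> (\<forall>a\<in>carrier A. F a \<in> carrier A) \<and>
     (\<forall>a\<in>carrier A. \<forall>b\<in>carrier A. F (a \<oplus> b) = F a \<oplus> F b) \<and>
     (\<forall>k. \<forall>a\<in>carrier A. F (k \<odot> a) = k \<odot> F a)"

lemma linear_mapD: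
  assumes "linear_map F"
  shows "a \<in> carrier A \<Longrightarrow> F a \<in> carrier A"
    "\<lbrakk>a \<in> carrier A; b \<in> carrier A\<rbrakk> \<Longrightarrow> F (a \<oplus> b) = F a \<oplus> F b"
    "a \<in> carrier A \<Longrightarrow> F (k \<odot> a) = k \<odot> F a"
  using assms by (auto simp: linear_map_def)

lemma ring_A: "ring A"
  by intro_locales

text \<open>Unqualified, \<open>l_distr\<close> and the like refer to the ring of scalars in this locale.\<close>

lemmas A_l_distr = ring.ring_simprules(13)[OF ring_A]
  and A_r_distr = ring.ring_simprules(23)[OF ring_A]
  and A_m_assoc = ring.ring_simprules(11)[OF ring_A]
  and A_minus_eq = ring.ring_simprules(14)[OF ring_A]
  and A_a_comm = ring.ring_simprules(10)[OF ring_A]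
  and A_a_ac = ring.ring_simprules(7,10,22)[OF ring_A]
  and A_minus_equality = abelian_group.minus_equality[OF ring.is_abelian_group[OF ring_A]]
  and A_right_minus_eq = ring.r_right_minus_eq[OF ring_A]

lemma module_A: "module (scalars :: 'k ring) A"
  by (rule module_axioms)

lemmas sc_closed [simp, intro] = smult_closed[simplified]
  and sc_add_left = smult_l_distr[simplified]
  and sc_add_right = smult_r_distr[simplified]
  and sc_sc = smult_assoc1[simplified, symmetric]
  and sc_zero [simp] = smult_l_null[simplified]
  and sc_one [simp] = smult_one[simplified]

lemma minus_eq_sc: "a \<in> carrier A \<Longrightarrow> \<ominus> a = (-1) \<odot> a"
proof -
  assume a: "a \<in> carrier A"
  have "(-1) \<odot> a \<oplus> 1 \<odot> a = (-1 + 1) \<odot> a" using a by (simp only: sc_add_left)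
  also have "\<dots> = \<zero>" using a by simp
  finally show ?thesis using a A_minus_equality by simp
qed

lemma linD:
  assumes "lin l"
  shows "\<lbrakk>a \<in> carrier A; b \<in> carrier A\<rbrakk> \<Longrightarrow> l (a \<oplus> b) = l a + l b"
    "a \<in> carrier A \<Longrightarrow> l (k \<odot> a) = k * l a"
    "a \<in> carrier A \<Longrightarrow> l (\<ominus> a) = - l a"
    "\<lbrakk>a \<in> carrier A; b \<in> carrier A\<rbrakk> \<Longrightarrow> l (a \<ominus> b) = l a - l b"
    "l \<zero> = 0"
proof -
  have *: "l (a \<oplus> b) = l a + l b" "l (k \<odot> a) = k * l a" if "a \<in> carrier A" "b \<in> carrier A" for a b k
    using assms that by (auto simp: linear_form_def)
  show "\<lbrakk>a \<in> carrier A; b \<in> carrier A\<rbrakk> \<Longrightarrow> l (a \<oplus> b) = l a + l b"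
    "a \<in> carrier A \<Longrightarrow> l (k \<odot> a) = k * l a"
    "a \<in> carrier A \<Longrightarrow> l (\<ominus> a) = - l a"
    "\<lbrakk>a \<in> carrier A; b \<in> carrier A\<rbrakk> \<Longrightarrow> l (a \<ominus> b) = l a - l b"
    by (simp_all add: * minus_eq_sc A_minus_eq)
  show "l \<zero> = 0" using *(2)[of \<zero> \<zero> 0] by simp
qed

lemma linI:
  assumes "\<And>a b. \<lbrakk>a \<in> carrier A; b \<in> carrier A\<rbrakk> \<Longrightarrow> l (a \<oplus> b) = l a + l b"
    and "\<And>k a. a \<in> carrier A \<Longrightarrow> l (k \<odot> a) = k * l a"
  shows "lin l"
  using assms by (simp add: linear_form_def)

lemma lin_comp: "\<lbrakk>lin l; linear_map F\<rbrakk> \<Longrightarrow> lin (\<lambda>a. l (F a))"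
  by (rule linI) (simp_all add: linear_mapD linD)

lemma lin_arith:
  shows lin_zero: "lin (\<lambda>a. 0)"
    and lin_add: "\<lbrakk>lin l; lin m\<rbrakk> \<Longrightarrow> lin (\<lambda>a. l a + m a)"
    and lin_diff: "\<lbrakk>lin l; lin m\<rbrakk> \<Longrightarrow> lin (\<lambda>a. l a - m a)"
    and lin_cmult: "lin l \<Longrightarrow> lin (\<lambda>a. c * l a)"
    and lin_multc: "lin l \<Longrightarrow> lin (\<lambda>a. l a * c)"
  by (auto intro!: linI simp: linD algebra_simps)

lemma lin_sum: "(\<And>i. i \<in> I \<Longrightarrow> lin (l i)) \<Longrightarrow> lin (\<lambda>a. \<Sum>i\<in>I. l i a)"
  by (induction I rule: infinite_finite_induct) (auto intro!: lin_zero lin_add)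

lemma linear_map_id: "linear_map (\<lambda>a. a)"
  by (simp add: linear_map_def)

lemma linear_map_comp: "\<lbrakk>linear_map F; linear_map G\<rbrakk> \<Longrightarrow> linear_map (\<lambda>a. F (G a))"
  by (simp add: linear_map_def)

lemma linear_map_mult_left: "\<lbrakk>b \<in> carrier A; linear_map F\<rbrakk> \<Longrightarrow> linear_map (\<lambda>a. b \<otimes> F a)"
  by (simp add: linear_map_def A_r_distr smult_mult_right)

lemma linear_map_mult_right: "\<lbrakk>b \<in> carrier A; linear_map F\<rbrakk> \<Longrightarrow> linear_map (\<lambda>a. F a \<otimes> b)"
  by (simp add: linear_map_def A_l_distr smult_mult_left)

lemma linear_map_add: "\<lbrakk>linear_map F; linear_map G\<rbrakk> \<Longrightarrow> linear_map (\<lambda>a. F a \<oplus> G a)"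
  by (simp add: linear_map_def sc_add_right A_a_ac)

lemma linear_map_sc: "linear_map F \<Longrightarrow> linear_map (\<lambda>a. k \<odot> F a)"
  by (simp add: linear_map_def sc_add_right sc_sc mult.commute)

lemmas linear_intros = lin_arith lin_sum linear_map_id linear_map_mult_left linear_map_mult_right
  linear_map_add linear_map_sc

lemma bilinearI:
  assumes "\<And>w. w \<in> carrier A \<Longrightarrow> lin (\<lambda>v. \<beta> v w)" "\<And>v. v \<in> carrier A \<Longrightarrow> lin (\<lambda>w. \<beta> v w)"
  shows "bilinear_form A A \<beta>"
  using assms by (simp add: bilinear_form_def)

lemma bilinearD:
  assumes "bilinear_form A A \<beta>"
  shows "w \<in> carrier A \<Longrightarrow> lin (\<lambda>v. \<beta> v w)" "v \<in> carrier A \<Longrightarrow> lin (\<lambda>w. \<beta> v w)"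
  using assms by (auto simp: bilinear_form_def)

lemma trilinearI:
  assumes "\<And>v w. \<lbrakk>v \<in> carrier A; w \<in> carrier A\<rbrakk> \<Longrightarrow> lin (\<lambda>u. \<tau> u v w)"
    "\<And>u w. \<lbrakk>u \<in> carrier A; w \<in> carrier A\<rbrakk> \<Longrightarrow> lin (\<lambda>v. \<tau> u v w)"
    "\<And>u v. \<lbrakk>u \<in> carrier A; v \<in> carrier A\<rbrakk> \<Longrightarrow> lin (\<lambda>w. \<tau> u v w)"
  shows "trilinear_form A A A \<tau>"
  using assms by (simp add: trilinear_form_def bilinear_form_def)

text \<open>The way in which identities modulo an ideal are proved: it suffices to test with the
  linear forms that vanish on the ideal.\<close>

lemma mem_submodule_by_lin:
  assumes I: "submodule I (scalars :: 'k ring) A" and a: "a \<in> carrier A"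
    and *: "\<And>l. \<lbrakk>lin l; \<And>x. x \<in> I \<Longrightarrow> l x = 0\<rbrakk> \<Longrightarrow> l a = 0"
  shows "a \<in> I"
  using linear_form_separating[OF module_A I a] * by metis

lemma zero_submodule: "submodule {\<zero>} (scalars :: 'k ring) A"
  by (rule submoduleI) (simp_all add: ring.ring_simprules(21)[OF ring_A])

lemma eq_by_lin:
  assumes "a \<in> carrier A" "b \<in> carrier A" and *: "\<And>l. lin l \<Longrightarrow> l a = l b"
  shows "a = b"
proof -
  have "a \<ominus> b \<in> {\<zero>}"
  proof (rule mem_submodule_by_lin[OF zero_submodule])
    fix l assume l: "lin l"
    show "l (a \<ominus> b) = 0"
      using linD(4)[OF l assms(1,2)] *[OF l] by simp
  qed (use assms in auto)
  then show ?thesis using assms by (simp add: A_right_minus_eq)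
qed

text \<open>Scaling by \<open>k\<close> is multiplication by the element
  \<open>k \<odot> \<one>\<close>.\<close>

lemma ideal_submodule:
  assumes "ideal I A"
  shows "submodule I (scalars :: 'k ring) A"
proof -
  interpret I: ideal I A by fact
  have "k \<odot> x \<in> I" if "x \<in> I" for k x
    using I.I_l_closed[OF that, of "k \<odot> \<one>"] I.Icarr[OF that] by (simp add: smult_mult_left)
  then show ?thesis
    by (intro submoduleI I.a_subset I.zero_closed I.a_inv_closed I.a_closed)
qed

subsection \<open>Homogeneous components\<close>

lemma part_carrier: "a \<in> part A i \<Longrightarrow> a \<in> carrier A"
  using submodule.closed(1)[OF part_submodule module_A] by blast

lemma
  shows part_zero: "\<zero> \<in> part A i"
    and part_add: "\<lbrakk>a \<in> part A i; b \<in> part A i\<rbrakk> \<Longrightarrow> a \<oplus> b \<in> part A i"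
    and part_diff: "\<lbrakk>a \<in> part A i; b \<in> part A i\<rbrakk> \<Longrightarrow> a \<ominus> b \<in> part A i"
    and part_sc: "a \<in> part A i \<Longrightarrow> k \<odot> a \<in> part A i"
  subgoal by (rule submodule.closed[OF part_submodule module_A])
  subgoal by (rule submodule.closed[OF part_submodule module_A])
  subgoal by (rule submodule.closed[OF part_submodule module_A])
  subgoal by (rule submodule.smult_closed[OF part_submodule]) simp
  done

lemma parts_disjoint': "\<lbrakk>x \<in> part A i; x \<in> part A (i + 1)\<rbrakk> \<Longrightarrow> x = \<zero>"
  using parts_disjoint by (cases i) auto

lemma component_eqI:
  assumes "x \<in> part A i" "y \<in> part A (i + 1)"
  shows "component A i (x \<oplus> y) = x"
  unfolding component_def
proof (rule the_equality)
  show "x \<in> part A i \<and> (\<exists>z\<in>part A (i + 1). x \<oplus> y = x \<oplus> z)" using assms by blast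
  fix x' assume "x' \<in> part A i \<and> (\<exists>z\<in>part A (i + 1). x \<oplus> y = x' \<oplus> z)"
  then obtain z where z: "x' \<in> part A i" "z \<in> part A (i + 1)" "x \<oplus> y = x' \<oplus> z" by blast
  note c = z(1,2)[THEN part_carrier] assms[THEN part_carrier]
  \<comment> \<open>The left side has degree \<open>i\<close>, the right side degree
    \<open>i + 1\<close>, so both are zero.\<close>
  have "x \<ominus> x' = z \<ominus> y"
  proof (rule eq_by_lin)
    fix l assume l: "lin l"
    then have "l x + l y = l x' + l z" using z(3) c by (metis linD(1))
    then show "l (x \<ominus> x') = l (z \<ominus> y)" using l c by (simp add: linD algebra_simps)
  qed (use c in auto)
  then have "x \<ominus> x' = \<zero>"
    using part_diff[OF assms(1) z(1)] part_diff[OF z(2) assms(2)] parts_disjoint' by metis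
  then show "x' = x" using c by (simp add: A_right_minus_eq)
qed

lemma component_cases:
  assumes "a \<in> carrier A"
  obtains x y where "x \<in> part A i" "y \<in> part A (i + 1)" "a = x \<oplus> y"
proof (cases "i = 0")
  case True
  then show ?thesis using parts_span[OF assms] that by auto
next
  case False
  obtain x y where "x \<in> part A 0" "y \<in> part A 1" "a = x \<oplus> y" using parts_span[OF assms] by blast
  then have "a = y \<oplus> x" by (simp add: A_a_comm part_carrier)
  then show ?thesis using that \<open>x \<in> part A 0\<close> \<open>y \<in> part A 1\<close> False by simp
qed

lemma component_part: "a \<in> carrier A \<Longrightarrow> component A i a \<in> part A i"
proof -
  assume "a \<in> carrier A"
  then obtain x y where *: "x \<in> part A i" "y \<in> part A (i + 1)" "a = x \<oplus> y"
    by (rule component_cases)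
  then show ?thesis by (metis component_eqI)
qed

lemma component_closed [simp, intro]: "a \<in> carrier A \<Longrightarrow> component A i a \<in> carrier A"
  using component_part part_carrier by blast

lemma component_homogeneous: "a \<in> part A i \<Longrightarrow> component A j a = (if j = i then a else \<zero>)"
proof -
  assume a: "a \<in> part A i"
  have "component A i (a \<oplus> \<zero>) = a" "component A (i + 1) (\<zero> \<oplus> a) = \<zero>"
    using a by (auto intro!: component_eqI simp only: bit_add_cancel part_zero)
  then have "component A i a = a" "component A (i + 1) a = \<zero>"
    using part_carrier[OF a] by simp_all
  moreover have "j = i \<or> j = i + 1" by (cases i; cases j) simp_all
  ultimately show ?thesis using a by (metis zero_neq_one add_left_imp_eq add_0_right)
qed

lemma component_decomp: "a \<in> carrier A \<Longrightarrow> component A 0 a \<oplus> component A 1 a = a"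
proof -
  assume "a \<in> carrier A"
  then obtain x y where *: "x \<in> part A 0" "y \<in> part A 1" "a = x \<oplus> y"
    using parts_span by blast
  then have "a = y \<oplus> x" by (simp add: A_a_comm part_carrier)
  then show ?thesis
    using * component_eqI[of x 0 y] component_eqI[of y 1 x] by simp
qed

lemma linear_map_component: "linear_map (component A i)"
  unfolding linear_map_def
proof (intro conjI ballI allI)
  fix a b assume ab: "a \<in> carrier A" "b \<in> carrier A"
  obtain x y where a: "x \<in> part A i" "y \<in> part A (i + 1)" "a = x \<oplus> y" using component_cases[OF ab(1)] .
  obtain u v where b: "u \<in> part A i" "v \<in> part A (i + 1)" "b = u \<oplus> v" using component_cases[OF ab(2)] .
  have "a \<oplus> b = (x \<oplus> u) \<oplus> (y \<oplus> v)"
    using a b by (simp add: part_carrier A_a_ac)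
  then have "component A i (a \<oplus> b) = x \<oplus> u"
    using a(1,2) b(1,2) by (simp add: component_eqI part_add)
  then show "component A i (a \<oplus> b) = component A i a \<oplus> component A i b"
    using a b by (simp add: component_eqI)
next
  fix k a assume "a \<in> carrier A"
  then obtain x y where a: "x \<in> part A i" "y \<in> part A (i + 1)" "a = x \<oplus> y" by (rule component_cases)
  have "k \<odot> a = k \<odot> x \<oplus> k \<odot> y" unfolding a(3) using a(1,2) by (simp add: sc_add_right part_carrier)
  moreover have "component A i (k \<odot> x \<oplus> k \<odot> y) = k \<odot> x" "component A i a = x"
    unfolding a(3) by (intro component_eqI part_sc a(1,2))+
  ultimately show "component A i (k \<odot> a) = k \<odot> component A i a"
    by simp
qed (rule component_closed)

lemma lin_decomp: "\<lbrakk>lin l; a \<in> carrier A\<rbrakk> \<Longrightarrow> l (component A 0 a) + l (component A 1 a) = l a"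
  using linD(1)[of l "component A 0 a" "component A 1 a"] by (simp add: component_decomp)

text \<open>Reduces a linear identity to homogeneous arguments, on which twists and exchanges of
  factors become multiplications by a sign.\<close>

lemma lin_eq_0_if_homogeneous:
  "\<lbrakk>lin l; \<And>i x. x \<in> part A i \<Longrightarrow> l x = 0; a \<in> carrier A\<rbrakk> \<Longrightarrow> l a = 0"
  using lin_decomp[of l a] component_part[of a 0] component_part[of a 1] by simp

lemma component_mult:
  assumes "a \<in> carrier A" "b \<in> carrier A"
  shows "component A i (a \<otimes> b) =
    component A 0 a \<otimes> component A i b \<oplus> component A 1 a \<otimes> component A (i + 1) b"
proof -
  let ?a = "\<lambda>i. component A i a" and ?b = "\<lambda>i. component A i b"
  note p = component_part[OF assms(1)] component_part[OF assms(2)]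
  have "a \<otimes> b = (?a 0 \<oplus> ?a 1) \<otimes> (?b i \<oplus> ?b (i + 1))"
    using component_decomp[OF assms(1)] component_decomp[OF assms(2)]
      A_a_comm[OF assms(2)[THEN component_closed, of 1] assms(2)[THEN component_closed, of 0]]
    by (cases i) simp_all
  also have "\<dots> = (?a 0 \<otimes> ?b i \<oplus> ?a 1 \<otimes> ?b (i + 1)) \<oplus> (?a 0 \<otimes> ?b (i + 1) \<oplus> ?a 1 \<otimes> ?b i)"
    using assms by (simp add: A_l_distr A_r_distr A_a_ac)
  finally have eq: "a \<otimes> b = (?a 0 \<otimes> ?b i \<oplus> ?a 1 \<otimes> ?b (i + 1)) \<oplus> (?a 0 \<otimes> ?b (i + 1) \<oplus> ?a 1 \<otimes> ?b i)" .
  have "?a 0 \<otimes> ?b i \<oplus> ?a 1 \<otimes> ?b (i + 1) \<in> part A i"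
    using part_mult[OF p(1)[of 0] p(2)[of i]] part_mult[OF p(1)[of 1] p(2)[of "i + 1"]]
    by (cases i) (auto intro: part_add)
  moreover have "?a 0 \<otimes> ?b (i + 1) \<oplus> ?a 1 \<otimes> ?b i \<in> part A (i + 1)"
    using part_mult[OF p(1)[of 0] p(2)[of "i + 1"]] part_mult[OF p(1)[of 1] p(2)[of i]]
    by (cases i) (auto intro: part_add)
  ultimately show ?thesis
    unfolding eq by (rule component_eqI)
qed

text \<open>The parity automorphism raised to the power \<open>j\<close>; it absorbs the signs of the Koszul rule.\<close>

definition twist :: "bit \<Rightarrow> 'a \<Rightarrow> 'a" where
  "twist j a = component A 0 a \<oplus> koszul 1 j \<odot> component A 1 a"

lemma linear_map_twist: "linear_map (twist j)"
  unfolding twist_def by (intro linear_intros linear_map_component)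

lemma twist_closed [simp, intro]: "a \<in> carrier A \<Longrightarrow> twist j a \<in> carrier A"
  by (simp add: twist_def)

lemma twist_homogeneous: "a \<in> part A i \<Longrightarrow> twist j a = koszul i j \<odot> a"
  by (cases i) (simp_all add: twist_def component_homogeneous part_carrier)

lemma twist_twist:
  assumes "a \<in> carrier A"
  shows "twist i (twist j a) = twist (i + j) a"
proof (rule eq_by_lin)
  fix l assume l: "lin l"
  have "lin (\<lambda>a. l (twist i (twist j a)) - l (twist (i + j) a))"
    by (intro lin_diff lin_comp[OF l] linear_map_comp[OF linear_map_twist linear_map_twist] linear_map_twist)
  then have "l (twist i (twist j a)) - l (twist (i + j) a) = 0"
  proof (rule lin_eq_0_if_homogeneous)
    fix k x assume x: "x \<in> part A k"
    have "twist i (twist j x) = koszul k j \<odot> (koszul k i \<odot> x)"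
      unfolding twist_homogeneous[OF x] linear_mapD(3)[OF linear_map_twist part_carrier[OF x]] ..
    also have "\<dots> = twist (i + j) x"
      using part_carrier[OF x]
      by (simp only: twist_homogeneous[OF x] sc_sc koszul_add_right mult.commute)
    finally show "l (twist i (twist j x)) - l (twist (i + j) x) = 0" by simp
  qed (rule assms)
  then show "l (twist i (twist j a)) = l (twist (i + j) a)" by simp
qed (use assms in auto)

lemma twist_twist_same [simp]: "a \<in> carrier A \<Longrightarrow> twist i (twist i a) = a"
  by (simp add: twist_twist) (simp add: twist_def component_decomp)

subsection \<open>Elements defined by tensors\<close>

lemma list_sum_closed: "set xs \<subseteq> carrier A \<Longrightarrow> list_sum A xs \<in> carrier A"
  by (induction xs) (auto simp: list_sum_def)

lemma lin_list_sum: "\<lbrakk>lin l; set xs \<subseteq> carrier A\<rbrakk> \<Longrightarrow> l (list_sum A xs) = (\<Sum>x\<leftarrow>xs. l x)"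
proof (induction xs)
  case (Cons x xs)
  then show ?case using list_sum_closed[of xs] linD(1)[of l x "list_sum A xs"] by (simp add: list_sum_def)
qed (simp add: list_sum_def linD)

text \<open>Tensors accept only scalar-valued forms, so the value of an \<open>A\<close>-valued
  bilinear map \<open>B\<close> at a tensor has to be described through all linear forms. The
  witness is the sum of \<open>B\<close> over a representing list, and separation by linear forms
  makes it independent of that list.\<close>

lemma tensor_element:
  assumes t: "t \<in> tensor_space A A"
    and B: "\<And>x y. \<lbrakk>x \<in> carrier A; y \<in> carrier A\<rbrakk> \<Longrightarrow> B x y \<in> carrier A"
    and bil: "\<And>l. lin l \<Longrightarrow> bilinear_form A A (\<lambda>x y. l (B x y))"
  obtains c where "c \<in> carrier A" "\<And>l. lin l \<Longrightarrow> l c = t (\<lambda>x y. l (B x y))"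
proof -
  obtain ps where ps: "t = tensor_sum A A ps" "set ps \<subseteq> carrier A \<times> carrier A"
    using t by (auto simp: tensor_space_def tensor_span_def)
  have c: "set (map (\<lambda>(x, y). B x y) ps) \<subseteq> carrier A" using ps(2) B by auto
  show ?thesis
  proof (rule that)
    show "list_sum A (map (\<lambda>(x, y). B x y) ps) \<in> carrier A" using c by (rule list_sum_closed)
    show "l (list_sum A (map (\<lambda>(x, y). B x y) ps)) = t (\<lambda>x y. l (B x y))" if "lin l" for l
      using that c by (simp add: lin_list_sum ps(1) tensor_sum_apply bil o_def split_def)
  qed
qed

lemma tensor_add:
  assumes "t \<in> tensor_space A A" "bilinear_form A A \<beta>" "bilinear_form A A \<beta>'"
  shows "t (\<lambda>x y. \<beta> x y + \<beta>' x y) = t \<beta> + t \<beta>'"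
proof -
  have "bilinear_form A A (\<lambda>x y. \<beta> x y + \<beta>' x y)"
    using assms(2,3) by (intro bilinearI lin_add) (auto dest: bilinearD)
  then show ?thesis
    using assms by (auto simp: tensor_space_def tensor_span_def tensor_sum_apply split_def sum_list_addf)
qed

lemma tensor_diff:
  assumes "t \<in> tensor_space A A" "bilinear_form A A \<beta>" "bilinear_form A A \<beta>'"
  shows "t (\<lambda>x y. \<beta> x y - \<beta>' x y) = t \<beta> - t \<beta>'"
proof -
  have "bilinear_form A A (\<lambda>x y. \<beta> x y - \<beta>' x y)"
    using assms(2,3) by (intro bilinearI lin_diff) (auto dest: bilinearD)
  then show ?thesis
    using assms by (auto simp: tensor_space_def tensor_span_def tensor_sum_apply split_def sum_list_subtractf)
qed

lemma tensor_cmult: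
  assumes "t \<in> tensor_space A A" "bilinear_form A A \<beta>"
  shows "t (\<lambda>x y. c * \<beta> x y) = c * t \<beta>"
proof -
  have "bilinear_form A A (\<lambda>x y. c * \<beta> x y)"
    using assms(2) by (intro bilinearI lin_cmult) (auto dest: bilinearD)
  then show ?thesis
    using assms by (auto simp: tensor_space_def tensor_span_def tensor_sum_apply split_def sum_list_const_mult)
qed

lemma bilinear_mult:
  assumes "lin l" "linear_map F" "linear_map G"
  shows "bilinear_form A A (\<lambda>x y. l (F x \<otimes> G y))"
  by (intro bilinearI lin_comp[OF assms(1)] linear_map_mult_left linear_map_mult_right assms
      linear_mapD(1)[OF assms(2)] linear_mapD(1)[OF assms(3)])

lemma bilinear_lin_lin:
  assumes "lin l" "lin m"
  shows "bilinear_form A A (\<lambda>x y. l x * m y)"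
  by (intro bilinearI lin_cmult lin_multc assms)

lemma bilinear_map:
  assumes "bilinear_form A A \<beta>" "linear_map F" "linear_map G"
  shows "bilinear_form A A (\<lambda>x y. \<beta> (F x) (G y))"
proof (rule bilinearI)
  show "lin (\<lambda>v. \<beta> (F v) (G w))" if "w \<in> carrier A" for w
    using lin_comp[OF bilinearD(1)[OF assms(1) linear_mapD(1)[OF assms(3) that]] assms(2)] .
  show "lin (\<lambda>w. \<beta> (F v) (G w))" if "v \<in> carrier A" for v
    using lin_comp[OF bilinearD(2)[OF assms(1) linear_mapD(1)[OF assms(2) that]] assms(3)] .
qed

lemma
  shows bilinear_add: "\<lbrakk>bilinear_form A A \<beta>; bilinear_form A A \<beta>'\<rbrakk> \<Longrightarrow> bilinear_form A A (\<lambda>x y. \<beta> x y + \<beta>' x y)"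
    and bilinear_diff: "\<lbrakk>bilinear_form A A \<beta>; bilinear_form A A \<beta>'\<rbrakk> \<Longrightarrow> bilinear_form A A (\<lambda>x y. \<beta> x y - \<beta>' x y)"
    and bilinear_cmult: "bilinear_form A A \<beta> \<Longrightarrow> bilinear_form A A (\<lambda>x y. c * \<beta> x y)"
  by (intro bilinearI lin_add lin_diff lin_cmult; erule (1) bilinearD)+

lemma trilinearD:
  assumes "trilinear_form A A A \<tau>"
  shows "\<lbrakk>v \<in> carrier A; w \<in> carrier A\<rbrakk> \<Longrightarrow> lin (\<lambda>u. \<tau> u v w)"
    "u \<in> carrier A \<Longrightarrow> bilinear_form A A (\<tau> u)"
    "w \<in> carrier A \<Longrightarrow> bilinear_form A A (\<lambda>u v. \<tau> u v w)"
    "\<lbrakk>u \<in> carrier A; v \<in> carrier A\<rbrakk> \<Longrightarrow> lin (\<lambda>w. \<tau> u v w)"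
  using assms unfolding trilinear_form_def bilinear_form_def by blast+

text \<open>Negatives need no separate check, being products with
  \<open>(-1) \<odot> \<one>\<close>.\<close>

lemma idealI_closed:
  assumes "P \<subseteq> carrier A" "\<zero> \<in> P" "\<And>x y. \<lbrakk>x \<in> P; y \<in> P\<rbrakk> \<Longrightarrow> x \<oplus> y \<in> P"
    and l: "\<And>u x. \<lbrakk>u \<in> carrier A; x \<in> P\<rbrakk> \<Longrightarrow> u \<otimes> x \<in> P"
    and r: "\<And>u x. \<lbrakk>u \<in> carrier A; x \<in> P\<rbrakk> \<Longrightarrow> x \<otimes> u \<in> P"
  shows "ideal P A"
proof (rule idealI[OF ring_A])
  have "\<ominus> x \<in> P" if "x \<in> P" for x
  proof -
    have x: "x \<in> carrier A" using that assms(1) by blast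
    have "((-1) \<odot> \<one>) \<otimes> x = \<ominus> x"
      using x part_carrier[OF one_even] ring.ring_simprules(12)[OF ring_A x]
      by (simp add: smult_mult_left minus_eq_sc)
    then show ?thesis
      using l[OF _ that, of "(-1) \<odot> \<one>"] part_carrier[OF one_even] by simp
  qed
  then have "subgroup P (add_monoid A)"
    using assms(1-3) by (intro subgroup.intro) (auto simp: a_inv_def)
  then show "subgroup P (add_monoid A)" .
qed (use l r in blast)+

text \<open>Values can be chosen pointwise: linear forms separate elements, so linearity of \<Phi>
  in \<open>y\<close> makes any choice linear.\<close>

lemma linear_map_by_forms:
  assumes ex: "\<And>y. y \<in> carrier A \<Longrightarrow> \<exists>c\<in>carrier A. \<forall>l. lin l \<longrightarrow> l c = \<Phi> l y"
    and \<Phi>: "\<And>l. lin l \<Longrightarrow> lin (\<Phi> l)"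
  shows "\<exists>F. linear_map F \<and> (\<forall>l y. lin l \<longrightarrow> y \<in> carrier A \<longrightarrow> l (F y) = \<Phi> l y)"
proof -
  obtain F where F: "\<And>y. y \<in> carrier A \<Longrightarrow> F y \<in> carrier A"
    and lF: "\<And>l y. \<lbrakk>lin l; y \<in> carrier A\<rbrakk> \<Longrightarrow> l (F y) = \<Phi> l y"
    using ex by metis
  have "linear_map F"
    unfolding linear_map_def
  proof (intro conjI ballI allI)
    fix a b assume ab: "a \<in> carrier A" "b \<in> carrier A"
    show "F (a \<oplus> b) = F a \<oplus> F b"
    proof (rule eq_by_lin)
      fix l assume l: "lin l"
      show "l (F (a \<oplus> b)) = l (F a \<oplus> F b)"
        using ab F by (simp add: linD(1)[OF l] lF[OF l] linD(1)[OF \<Phi>[OF l]])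
    qed (use ab F in auto)
  next
    fix k a assume a: "a \<in> carrier A"
    show "F (k \<odot> a) = k \<odot> F a"
    proof (rule eq_by_lin)
      fix l assume l: "lin l"
      show "l (F (k \<odot> a)) = l (k \<odot> F a)"
        using a F by (simp add: linD(2)[OF l] lF[OF l] linD(2)[OF \<Phi>[OF l]])
    qed (use a F in auto)
  qed (rule F)
  then show ?thesis using lF by blast
qed

lemma koszul_commute_mult:
  assumes "x \<in> part A m" "r \<in> carrier A"
  shows "x \<otimes> component A k r = koszul m k \<odot> (component A k r \<otimes> x)"
  using supercommutative[OF assms(1) component_part[OF assms(2)]] .

text \<open>The abstract product of two tensors is rewritten as an explicit list of pure tensors,
  with the Koszul sign absorbed into the first factor. This is what lets the span attached to an
  ideal absorb products.\<close>

lemma tensor_mult_span: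
  assumes ps: "set ps \<subseteq> carrier A \<times> carrier A" and qs: "set qs \<subseteq> carrier A \<times> carrier A"
    and S: "\<And>a b c d i j k. \<lbrakk>(a, b) \<in> set ps; (c, d) \<in> set qs\<rbrakk>
      \<Longrightarrow> (k \<odot> (a \<otimes> component A j c), component A i b \<otimes> d) \<in> S"
  shows "tensor_mult A (tensor_sum A A ps) (tensor_sum A A qs) \<in> tensor_span A A S"
proof -
  \<comment> \<open>The four terms of the product of \<open>a \<otimes> b\<close> and
    \<open>c \<otimes> d\<close> that arise from the two degrees of \<open>b\<close> and the two of
    \<open>c\<close>.\<close>
  define E where "E a b c d = concat (map (\<lambda>i. map (\<lambda>j.
    (koszul i j \<odot> (a \<otimes> component A j c), component A i b \<otimes> d)) [0, 1]) [0, 1])" for a b c d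
  define rs where "rs = concat (map (\<lambda>(a, b). concat (map (\<lambda>(c, d). E a b c d) qs)) ps)"
  have "set rs \<subseteq> S" using S unfolding rs_def E_def by auto
  moreover have "tensor_mult A (tensor_sum A A ps) (tensor_sum A A qs) = tensor_sum A A rs"
  proof
    fix \<beta>
    show "tensor_mult A (tensor_sum A A ps) (tensor_sum A A qs) \<beta> = tensor_sum A A rs \<beta>"
    proof (cases "bilinear_form A A \<beta>")
      case False
      then show ?thesis by (simp add: tensor_mult_def tensor_sum_def)
    next
      case True
      define \<gamma> where "\<gamma> a b c d = (\<Sum>i\<in>{0, 1}. \<Sum>j\<in>{0, 1}.
        koszul i j * \<beta> (a \<otimes> component A j c) (component A i b \<otimes> d))" for a b c d
      have t: "tensor_sum A A qs \<in> tensor_space A A"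
        using qs by (auto simp: tensor_space_def tensor_span_def)
      have closed: "component A i b \<otimes> d \<in> carrier A" "b \<otimes> component A i d \<in> carrier A"
        if "b \<in> carrier A" "d \<in> carrier A" for b d i
        using that by auto
      note cl = linear_map_mult_left linear_map_mult_right linear_map_id linear_map_component
      have lin1: "lin (\<lambda>a. \<gamma> a b c d)" if "b \<in> carrier A" "c \<in> carrier A" "d \<in> carrier A" for b c d
        unfolding \<gamma>_def using that
        by (intro lin_sum lin_cmult lin_comp[OF bilinearD(1)[OF True]] cl closed component_closed)
      have lin2: "lin (\<lambda>b. \<gamma> a b c d)" if "a \<in> carrier A" "c \<in> carrier A" "d \<in> carrier A" for a c d
        unfolding \<gamma>_def using that
        by (intro lin_sum lin_cmult lin_comp[OF bilinearD(2)[OF True]] cl closed component_closed)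
      have lin3: "lin (\<lambda>c. \<gamma> a b c d)" if "a \<in> carrier A" "b \<in> carrier A" "d \<in> carrier A" for a b d
        unfolding \<gamma>_def using that
        by (intro lin_sum lin_cmult lin_comp[OF bilinearD(1)[OF True]] cl closed component_closed)
      have lin4: "lin (\<lambda>d. \<gamma> a b c d)" if "a \<in> carrier A" "b \<in> carrier A" "c \<in> carrier A" for a b c
        unfolding \<gamma>_def using that
        by (intro lin_sum lin_cmult lin_comp[OF bilinearD(2)[OF True]] cl closed component_closed)
      have inner: "bilinear_form A A (\<gamma> a b)" if "a \<in> carrier A" "b \<in> carrier A" for a b
        using that by (intro bilinearI lin3 lin4)
      \<comment> \<open>Without this the outer tensor could take its default value 0 instead of the
        sum over \<open>ps\<close>.\<close>
      have outer: "bilinear_form A A (\<lambda>a b. tensor_sum A A qs (\<gamma> a b))"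
      proof (rule bilinearI)
        show "lin (\<lambda>v. tensor_sum A A qs (\<gamma> v w))" if "w \<in> carrier A" for w
          by (rule linear_form_tensor[OF module_A module_A t inner lin1 module_A]; (assumption | rule that))
        show "lin (\<lambda>w. tensor_sum A A qs (\<gamma> v w))" if "v \<in> carrier A" for v
          by (rule linear_form_tensor[OF module_A module_A t inner lin2 module_A]; (assumption | rule that))
      qed
      have E: "(\<Sum>(x, y)\<leftarrow>E a b c d. \<beta> x y) = \<gamma> a b c d"
        if "a \<in> carrier A" "b \<in> carrier A" "c \<in> carrier A" "d \<in> carrier A" for a b c d
      proof -
        have "\<beta> (k \<odot> (a \<otimes> component A j c)) (component A i b \<otimes> d)
          = k * \<beta> (a \<otimes> component A j c) (component A i b \<otimes> d)" for i j k
          by (rule linD(2)[OF bilinearD(1)[OF True]]) (use that in auto)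
        then show ?thesis unfolding \<gamma>_def E_def by (simp add: add.assoc)
      qed
      have E_qs: "(\<Sum>(x, y)\<leftarrow>concat (map (\<lambda>(c, d). E a b c d) qs). \<beta> x y) = (\<Sum>(c, d)\<leftarrow>qs. \<gamma> a b c d)"
        if "a \<in> carrier A" "b \<in> carrier A" for a b
        using qs by (induction qs) (auto simp: E that)
      have rs: "(\<Sum>(x, y)\<leftarrow>rs. \<beta> x y) = (\<Sum>(a, b)\<leftarrow>ps. \<Sum>(c, d)\<leftarrow>qs. \<gamma> a b c d)"
        unfolding rs_def using ps by (induction ps) (auto simp: E_qs)
      have "tensor_mult A (tensor_sum A A ps) (tensor_sum A A qs) \<beta>
        = tensor_sum A A ps (\<lambda>a b. tensor_sum A A qs (\<gamma> a b))"
        unfolding tensor_mult_def \<gamma>_def[abs_def] using True by (rule if_P)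
      also have "\<dots> = (\<Sum>(a, b)\<leftarrow>ps. tensor_sum A A qs (\<gamma> a b))"
        by (rule tensor_sum_apply[OF outer])
      also have "\<dots> = (\<Sum>(a, b)\<leftarrow>ps. \<Sum>(c, d)\<leftarrow>qs. \<gamma> a b c d)"
        using ps by (intro arg_cong[where f = sum_list] map_cong) (auto simp: tensor_sum_apply inner)
      also have "\<dots> = (\<Sum>(x, y)\<leftarrow>rs. \<beta> x y)"
        by (rule rs[symmetric])
      finally show ?thesis using True by (simp add: tensor_sum_apply)
    qed
  qed
  ultimately show ?thesis unfolding tensor_span_def by blast
qed

end

section \<open>Hopf superalgebras\<close>

context hopf_superalgebra
begin

section \<open>The Hopf axioms evaluated on bilinear forms\<close>

lemma comult_tensor: "a \<in> carrier A \<Longrightarrow> comult A a \<in> tensor_space A A"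
proof -
  assume a: "a \<in> carrier A"
  have *: "comult A x \<in> tensor_space A A" if "x \<in> part A i" for x i
  proof -
    have "(\<Union>j\<in>{0, 1}. part A j \<times> part A (i + j)) \<subseteq> carrier A \<times> carrier A"
      using part_carrier by blast
    from tensor_span_mono[OF this] show ?thesis
      using comult_even[OF that] unfolding tensor_space_def by (rule subsetD)
  qed
  obtain x y where xy: "x \<in> part A 0" "y \<in> part A 1" "a = x \<oplus> y" using parts_span[OF a] by blast
  have "comult A a = (\<lambda>\<beta>. comult A x \<beta> + comult A y \<beta>)"
    unfolding xy(3) by (rule comult_add) (rule part_carrier[OF xy(1)], rule part_carrier[OF xy(2)])
  then show ?thesis
    using tensor_span_add[OF *[OF xy(1), unfolded tensor_space_def] *[OF xy(2), unfolded tensor_space_def]]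
    by (simp only: tensor_space_def)
qed

lemmas comult_cong = tensor_cong[OF module_A module_A comult_tensor]
  and comult_eq_0 = tensor_eq_0[OF module_A module_A comult_tensor]
  and comult_plus = tensor_add[OF comult_tensor]
  and comult_minus = tensor_diff[OF comult_tensor]
  and comult_cmult = tensor_cmult[OF comult_tensor]
  and lin_comult_form = linear_form_tensor[OF module_A module_A comult_tensor _ _ module_A]
  and comult_swap = tensor_swap[OF comult_tensor module_A module_A comult_tensor module_A module_A]

lemma comult_rep:
  assumes "a \<in> carrier A"
  obtains ps where "comult A a = tensor_sum A A ps" "set ps \<subseteq> carrier A \<times> carrier A"
  using comult_tensor[OF assms] by (auto simp: tensor_space_def tensor_span_def)

lemma lin_comult: "lin (\<lambda>a. comult A a \<beta>)"
  by (rule linI) (simp_all add: comult_add comult_smult)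

text \<open>Together with \<open>bilinear_comult_right\<close>, this makes the two sides of
  coassociativity genuine double sums, to which the additivity rules for tensors apply.\<close>

lemma bilinear_comult_left:
  assumes \<tau>: "trilinear_form A A A \<tau>"
  shows "bilinear_form A A (\<lambda>x y. comult A x (\<lambda>u v. \<tau> u v y))"
proof (rule bilinearI)
  show "lin (\<lambda>v. comult A v (\<lambda>u va. \<tau> u va w))" for w by (rule lin_comult)
  show "lin (\<lambda>w. comult A v (\<lambda>u va. \<tau> u va w))" if "v \<in> carrier A" for v
    by (rule lin_comult_form[OF that], erule trilinearD(3)[OF \<tau>], erule (1) trilinearD(4)[OF \<tau>])
qed

lemma bilinear_comult_right:
  assumes \<tau>: "trilinear_form A A A \<tau>"
  shows "bilinear_form A A (\<lambda>x y. comult A y (\<lambda>u v. \<tau> x u v))"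
proof (rule bilinearI)
  show "lin (\<lambda>w. comult A w (\<lambda>u va. \<tau> v u va))" for v by (rule lin_comult)
  show "lin (\<lambda>v. comult A w (\<lambda>u va. \<tau> v u va))" if "w \<in> carrier A" for w
    by (rule lin_comult_form[OF that], erule trilinearD(2)[OF \<tau>], erule (1) trilinearD(1)[OF \<tau>])
qed

text \<open>Comultiplication is even, so only pairs whose degrees add up to \<open>i\<close>
  contribute. All sign computations for homogeneous elements pass through this lemma.\<close>

lemma comult_homogeneous_cong:
  assumes a: "a \<in> part A i" and bil: "bilinear_form A A \<beta>" "bilinear_form A A \<beta>'"
    and eq: "\<And>k x y. \<lbrakk>x \<in> part A k; y \<in> part A (i + k)\<rbrakk> \<Longrightarrow> \<beta> x y = \<beta>' x y"
  shows "comult A a \<beta> = comult A a \<beta>'"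
proof -
  obtain ps where ps: "comult A a = tensor_sum A A ps" "set ps \<subseteq> (\<Union>j\<in>{0, 1}. part A j \<times> part A (i + j))"
    using comult_even[OF a] by (auto simp: tensor_span_def)
  have "map (\<lambda>(v, w). \<beta> v w) ps = map (\<lambda>(v, w). \<beta>' v w) ps"
  proof (rule map_cong[OF refl])
    fix p assume "p \<in> set ps"
    then obtain k x y where "p = (x, y)" "x \<in> part A k" "y \<in> part A (i + k)" using ps(2) by blast
    then show "(case p of (v, w) \<Rightarrow> \<beta> v w) = (case p of (v, w) \<Rightarrow> \<beta>' v w)" by (simp only: prod.case eq)
  qed
  then show ?thesis
    unfolding ps(1) tensor_sum_apply[OF bil(1)] tensor_sum_apply[OF bil(2)] by (rule arg_cong)
qed

lemma linear_map_antipode: "linear_map (antipode A)"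
  unfolding linear_map_def
proof (intro conjI ballI allI)
  fix a assume a: "a \<in> carrier A"
  obtain x y where xy: "x \<in> part A 0" "y \<in> part A 1" "a = x \<oplus> y" using parts_span[OF a] by blast
  have "antipode A a = antipode A x \<oplus> antipode A y"
    unfolding xy(3) using xy(1,2) by (intro antipode_add part_carrier)
  then show "antipode A a \<in> carrier A"
    using antipode_even[OF xy(1), THEN part_carrier] antipode_even[OF xy(2), THEN part_carrier] by simp
qed (simp_all add: antipode_add antipode_smult)

lemmas antipode_closed [simp, intro] = linear_mapD(1)[OF linear_map_antipode]

text \<open>Translates the counit and antipode axioms, which speak of lists representing
  \<open>comult A a\<close>, into statements about linear forms.\<close>

lemma comult_list_sum:
  assumes a: "a \<in> carrier A" and ps: "comult A a = tensor_sum A A ps" "set ps \<subseteq> carrier A \<times> carrier A"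
    and l: "lin l" and bil: "bilinear_form A A (\<lambda>x y. l (B x y))"
    and B: "\<And>x y. \<lbrakk>x \<in> carrier A; y \<in> carrier A\<rbrakk> \<Longrightarrow> B x y \<in> carrier A"
  shows "comult A a (\<lambda>x y. l (B x y)) = l (list_sum A (map (\<lambda>(x, y). B x y) ps))"
proof -
  have "set (map (\<lambda>(x, y). B x y) ps) \<subseteq> carrier A" using ps(2) B by auto
  from lin_list_sum[OF l this] show ?thesis
    by (simp add: ps(1) tensor_sum_apply[OF bil] o_def split_def)
qed

lemma comult_counit_left:
  assumes a: "a \<in> carrier A" and l: "lin l"
  shows "comult A a (\<lambda>x y. counit A x * l y) = l a"
proof -
  obtain ps where ps: "comult A a = tensor_sum A A ps" "set ps \<subseteq> carrier A \<times> carrier A"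
    using comult_rep[OF a] .
  have eq: "comult A a (\<lambda>x y. counit A x * l y) = comult A a (\<lambda>x y. l (counit A x \<odot> y))"
    by (rule comult_cong[OF a]) (simp add: linD(2)[OF l])
  have "bilinear_form A A (\<lambda>x y. l (counit A x \<odot> y))"
    by (rule iffD2[OF bilinear_form_cong[OF module_A module_A] bilinear_lin_lin[OF counit_linear l]])
      (rule linD(2)[OF l])
  from comult_list_sum[OF a ps l this] show ?thesis
    unfolding eq counit_left[OF a ps(2,1)] by simp
qed

lemma comult_counit_right:
  assumes a: "a \<in> carrier A" and l: "lin l"
  shows "comult A a (\<lambda>x y. l x * counit A y) = l a"
proof -
  obtain ps where ps: "comult A a = tensor_sum A A ps" "set ps \<subseteq> carrier A \<times> carrier A"
    using comult_rep[OF a] .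
  have eq: "comult A a (\<lambda>x y. l x * counit A y) = comult A a (\<lambda>x y. l (counit A y \<odot> x))"
    by (rule comult_cong[OF a]) (simp add: linD(2)[OF l] mult.commute)
  have "bilinear_form A A (\<lambda>x y. l (counit A y \<odot> x))"
    by (rule iffD2[OF bilinear_form_cong[OF module_A module_A] bilinear_lin_lin[OF l counit_linear]])
      (subst mult.commute, rule linD(2)[OF l])
  from comult_list_sum[OF a ps l this] show ?thesis
    unfolding eq counit_right[OF a ps(2,1)] by simp
qed

lemma A_one_closed [simp]: "\<one> \<in> carrier A"
  using part_carrier[OF one_even] .

lemma comult_antipode_left:
  assumes a: "a \<in> carrier A" and l: "lin l"
  shows "comult A a (\<lambda>x y. l (antipode A x \<otimes> y)) = counit A a * l \<one>"
proof -
  obtain ps where ps: "comult A a = tensor_sum A A ps" "set ps \<subseteq> carrier A \<times> carrier A"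
    using comult_rep[OF a] .
  from comult_list_sum[OF a ps l bilinear_mult[OF l linear_map_antipode linear_map_id]] show ?thesis
    unfolding antipode_left[OF a ps(2,1)] by (simp add: linD(2)[OF l])
qed

lemma comult_antipode_right:
  assumes a: "a \<in> carrier A" and l: "lin l"
  shows "comult A a (\<lambda>x y. l (x \<otimes> antipode A y)) = counit A a * l \<one>"
proof -
  obtain ps where ps: "comult A a = tensor_sum A A ps" "set ps \<subseteq> carrier A \<times> carrier A"
    using comult_rep[OF a] .
  from comult_list_sum[OF a ps l bilinear_mult[OF l linear_map_id linear_map_antipode]] show ?thesis
    unfolding antipode_right[OF a ps(2,1)] by (simp add: linD(2)[OF l])
qed

text \<open>The parity automorphism respects comultiplication: for degrees \<open>k\<close> and
  \<open>i + k\<close> of the two tensor factors, the product of the two signs is the sign attached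
  to \<open>i\<close>.\<close>

lemma comult_twist:
  assumes a: "a \<in> carrier A" and \<beta>: "bilinear_form A A \<beta>"
  shows "comult A (twist j a) \<beta> = comult A a (\<lambda>x y. \<beta> (twist j x) (twist j y))"
proof -
  let ?\<beta>' = "\<lambda>x y. \<beta> (twist j x) (twist j y)"
  have \<beta>': "bilinear_form A A ?\<beta>'"
    by (rule bilinear_map[OF \<beta> linear_map_twist linear_map_twist])
  have "lin (\<lambda>a. comult A (twist j a) \<beta> - comult A a ?\<beta>')"
    by (rule lin_diff[OF lin_comp[OF lin_comult linear_map_twist] lin_comult])
  then have "comult A (twist j a) \<beta> - comult A a ?\<beta>' = 0"
  proof (rule lin_eq_0_if_homogeneous)
    fix i x assume x: "x \<in> part A i"
    have "comult A x ?\<beta>' = comult A x (\<lambda>u v. koszul i j * \<beta> u v)"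
    proof (rule comult_homogeneous_cong[OF x \<beta>' bilinear_cmult[OF \<beta>]])
      fix k u v assume uv: "u \<in> part A k" "v \<in> part A (i + k)"
      have "\<beta> (koszul k j \<odot> u) (koszul (i + k) j \<odot> v) = koszul k j * (koszul (i + k) j * \<beta> u v)"
        using linD(2)[OF bilinearD(1)[OF \<beta> sc_closed[OF part_carrier[OF uv(2)]]] part_carrier[OF uv(1)]]
          linD(2)[OF bilinearD(2)[OF \<beta> part_carrier[OF uv(1)]] part_carrier[OF uv(2)]]
        by simp
      also have "\<dots> = koszul i j * (koszul k j * koszul k j) * \<beta> u v"
        by (simp only: koszul_add_left mult.assoc mult.left_commute)
      finally show "\<beta> (twist j u) (twist j v) = koszul i j * \<beta> u v"
        by (simp add: twist_homogeneous[OF uv(1)] twist_homogeneous[OF uv(2)])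
    qed
    also have "\<dots> = koszul i j * comult A x \<beta>"
      by (rule comult_cmult[OF part_carrier[OF x] \<beta>])
    finally show "comult A (twist j x) \<beta> - comult A x ?\<beta>' = 0"
      by (simp add: twist_homogeneous[OF x] comult_smult part_carrier[OF x])
  qed (rule a)
  then show ?thesis by simp
qed

text \<open>\<open>F\<close> is recovered from \<open>\<Sum> a\<^sub>1 F(a\<^sub>2)\<close> as \<open>F(a) = \<Sum> S(a\<^sub>1) a\<^sub>2 F(a\<^sub>3)\<close>.\<close>

lemma convolution_cancel:
  assumes I: "ideal I A" and F: "linear_map F" and a: "a \<in> carrier A"
    and 0: "\<And>l a. \<lbrakk>lin l; \<And>x. x \<in> I \<Longrightarrow> l x = 0; a \<in> carrier A\<rbrakk> \<Longrightarrow> comult A a (\<lambda>x y. l (x \<otimes> F y)) = 0"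
  shows "F a \<in> I"
proof (rule mem_submodule_by_lin[OF ideal_submodule[OF I] linear_mapD(1)[OF F a]])
  fix l assume l: "lin l" and lI: "\<And>x. x \<in> I \<Longrightarrow> l x = 0"
  interpret I: ideal I A by (rule I)
  \<comment> \<open>This is \<open>l\<close> applied to \<open>S(x) u F(v)\<close>. Grouping the
    last two factors gives the hypothesis, grouping the first two gives the antipode axiom.\<close>
  define \<tau> where "\<tau> x u v = l (antipode A x \<otimes> (u \<otimes> F v))" for x u v
  have \<tau>: "trilinear_form A A A \<tau>"
    unfolding \<tau>_def
    by (intro trilinearI lin_comp[OF l] linear_map_mult_left linear_map_mult_right linear_map_id
        linear_map_antipode F linear_mapD(1)[OF F] linear_mapD(1)[OF linear_map_antipode]
        ring.ring_simprules(5)[OF ring_A])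
  have "comult A a (\<lambda>x y. comult A x (\<lambda>u v. \<tau> u v y)) = comult A a (\<lambda>x y. comult A y (\<lambda>u v. \<tau> x u v))"
    by (rule coassoc[OF a \<tau>])
  \<comment> \<open>For fixed \<open>x\<close>, the form
    \<open>c \<mapsto> l (antipode A x \<otimes> c)\<close> again vanishes on \<open>I\<close>,
    because \<open>I\<close> is an ideal; so the hypothesis applies to it.\<close>
  also have "\<dots> = 0"
  proof (rule comult_eq_0[OF a])
    fix x y assume xy: "x \<in> carrier A" "y \<in> carrier A"
    show "comult A y (\<tau> x) = 0"
      unfolding \<tau>_def
    proof (rule 0[OF _ _ xy(2), of "\<lambda>c. l (antipode A x \<otimes> c)"])
      show "lin (\<lambda>c. l (antipode A x \<otimes> c))"
        using xy by (intro lin_comp[OF l] linear_map_mult_left linear_map_id) auto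
      show "l (antipode A x \<otimes> c) = 0" if "c \<in> I" for c
        using xy I.I_l_closed[OF that] by (intro lI) auto
    qed
  qed
  also have "comult A a (\<lambda>x y. comult A x (\<lambda>u v. \<tau> u v y)) = comult A a (\<lambda>x y. counit A x * l (F y))"
  proof (rule comult_cong[OF a])
    fix x y assume xy: "x \<in> carrier A" "y \<in> carrier A"
    have Fy: "F y \<in> carrier A" by (rule linear_mapD(1)[OF F xy(2)])
    have "comult A x (\<lambda>u v. \<tau> u v y) = comult A x (\<lambda>u v. l ((antipode A u \<otimes> v) \<otimes> F y))"
      unfolding \<tau>_def using Fy by (intro comult_cong[OF xy(1)]) (simp add: A_m_assoc)
    also have "\<dots> = counit A x * l (\<one> \<otimes> F y)"
      using Fy by (intro comult_antipode_left[OF xy(1), of "\<lambda>c. l (c \<otimes> F y)"] lin_comp[OF l]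
          linear_map_mult_right linear_map_id)
    finally show "comult A x (\<lambda>u v. \<tau> u v y) = counit A x * l (F y)"
      using Fy by (simp add: ring.ring_simprules(12)[OF ring_A])
  qed
  also have "\<dots> = l (F a)"
    by (rule comult_counit_left[OF a lin_comp[OF l F]])
  finally show "l (F a) = 0" .
qed

text \<open>Apply \<open>convolution_cancel\<close> to \<open>F\<close> composed with the twist, at
  the point \<open>twist j a\<close>. The twist respects comultiplication and is an involution, so
  it can be moved from the second factor to the first.\<close>

lemma convolution_cancel_twist:
  assumes I: "ideal I A" and F: "linear_map F" and a: "a \<in> carrier A"
    and 0: "\<And>l a. \<lbrakk>lin l; \<And>x. x \<in> I \<Longrightarrow> l x = 0; a \<in> carrier A\<rbrakk>
      \<Longrightarrow> comult A a (\<lambda>x y. l (twist j x \<otimes> F y)) = 0"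
  shows "F a \<in> I"
proof -
  have "F (twist j (twist j a)) \<in> I"
  proof (rule convolution_cancel[OF I, where F = "\<lambda>a. F (twist j a)"])
    show FF: "linear_map (\<lambda>a. F (twist j a))" by (rule linear_map_comp[OF F linear_map_twist])
    show "twist j a \<in> carrier A" using a by simp
    fix l b assume l: "lin l" "\<And>x. x \<in> I \<Longrightarrow> l x = 0" and b: "b \<in> carrier A"
    have bil: "bilinear_form A A (\<lambda>x y. l (x \<otimes> F (twist j y)))"
      by (rule bilinear_mult[OF l(1) linear_map_id FF])
    have "comult A (twist j (twist j b)) (\<lambda>x y. l (x \<otimes> F (twist j y)))
      = comult A (twist j b) (\<lambda>x y. l (twist j x \<otimes> F (twist j (twist j y))))"
      using b by (subst comult_twist[OF _ bil]) auto
    also have "\<dots> = comult A (twist j b) (\<lambda>x y. l (twist j x \<otimes> F y))"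
      using b by (intro comult_cong) auto
    also have "\<dots> = 0" using b by (intro 0[OF l]) auto
    finally show "comult A b (\<lambda>x y. l (x \<otimes> F (twist j y))) = 0" using b by simp
  qed
  then show ?thesis using a by simp
qed

section \<open>Centralizers\<close>

definition homogeneous_form :: "bit \<Rightarrow> ('a \<Rightarrow> 'k) \<Rightarrow> bool" where
  "homogeneous_form j \<gamma> \<longleftrightarrow> lin \<gamma> \<and> (\<forall>a\<in>part A (j + 1). \<gamma> a = 0)"

lemma homogeneous_formD:
  assumes "homogeneous_form j \<gamma>"
  shows "lin \<gamma>" "\<And>a i. \<lbrakk>a \<in> part A i; i \<noteq> j\<rbrakk> \<Longrightarrow> \<gamma> a = 0"
  using assms bit_neq_iff[of _ j] unfolding homogeneous_form_def by metis+

text \<open>\<open>displacement j \<gamma> a = \<Sum> \<sigma>\<^sup>j(a\<^sub>1) \<gamma>(a\<^sub>2) - \<gamma>(a\<^sub>1) a\<^sub>2\<close>, where \<open>\<sigma>\<close> is the parity automorphism: the value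
  at \<open>a\<close> of the commutator of the generic point with \<open>\<gamma>\<close>\<close>

definition displacement :: "bit \<Rightarrow> ('a \<Rightarrow> 'k) \<Rightarrow> 'a \<Rightarrow> 'a" where
  "displacement j \<gamma> = (SOME F. linear_map F \<and> (\<forall>l a. lin l \<longrightarrow> a \<in> carrier A \<longrightarrow>
     l (F a) = comult A a (\<lambda>x y. l (twist j x) * \<gamma> y - \<gamma> x * l y)))"

context
  fixes j :: bit and \<gamma> :: "'a \<Rightarrow> 'k"
  assumes hom: "homogeneous_form j \<gamma>"
begin

private lemmas \<gamma> = homogeneous_formD(1)[OF hom] and \<gamma>_hom = homogeneous_formD(2)[OF hom]

lemma bilinear_displacement_form:
  assumes "lin l"
  shows "bilinear_form A A (\<lambda>x y. l (twist j x) * \<gamma> y)" "bilinear_form A A (\<lambda>x y. \<gamma> x * l y)"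
  by (rule bilinear_lin_lin[OF lin_comp[OF assms linear_map_twist] \<gamma>])
    (rule bilinear_lin_lin[OF \<gamma> assms])

lemma displacement:
  shows linear_map_displacement: "linear_map (displacement j \<gamma>)"
    and lin_displacement: "\<And>l a. \<lbrakk>lin l; a \<in> carrier A\<rbrakk> \<Longrightarrow>
      l (displacement j \<gamma> a) = comult A a (\<lambda>x y. l (twist j x) * \<gamma> y - \<gamma> x * l y)"
proof -
  have "\<exists>F. linear_map F \<and> (\<forall>l a. lin l \<longrightarrow> a \<in> carrier A \<longrightarrow>
     l (F a) = comult A a (\<lambda>x y. l (twist j x) * \<gamma> y - \<gamma> x * l y))"
  proof (rule linear_map_by_forms)
    fix a assume a: "a \<in> carrier A"
    \<comment> \<open>The \<open>A\<close>-valued map behind the form in question; its Sweedler sum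
      is the value of the displacement.\<close>
    define B where "B x y = \<gamma> y \<odot> twist j x \<ominus> \<gamma> x \<odot> y" for x y
    have lB: "l (B x y) = l (twist j x) * \<gamma> y - \<gamma> x * l y"
      if "lin l" "x \<in> carrier A" "y \<in> carrier A" for l x y
      unfolding B_def using that(2,3)
      by (simp add: linD(4)[OF that(1)] linD(2)[OF that(1)] mult.commute)
    have bil: "bilinear_form A A (\<lambda>x y. l (B x y))" if l: "lin l" for l
      by (rule iffD2[OF bilinear_form_cong[OF module_A module_A lB[OF l]]
            bilinear_diff[OF bilinear_displacement_form[OF l]]])
    have "B x y \<in> carrier A" if "x \<in> carrier A" "y \<in> carrier A" for x y
      unfolding B_def using that by (intro ring.ring_simprules(4)[OF ring_A]) auto
    from tensor_element[where B = B, OF comult_tensor[OF a] this bil]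
    obtain c where c: "c \<in> carrier A" "\<And>l. lin l \<Longrightarrow> l c = comult A a (\<lambda>x y. l (B x y))"
      by metis
    show "\<exists>c\<in>carrier A. \<forall>l. lin l \<longrightarrow> l c = comult A a (\<lambda>x y. l (twist j x) * \<gamma> y - \<gamma> x * l y)"
    proof (intro bexI[OF _ c(1)] allI impI)
      fix l assume l: "lin l"
      show "l c = comult A a (\<lambda>x y. l (twist j x) * \<gamma> y - \<gamma> x * l y)"
        unfolding c(2)[OF l] by (rule comult_cong[OF a lB[OF l]])
    qed
  qed (rule lin_comult)
  from someI_ex[OF this]
  show "linear_map (displacement j \<gamma>)"
    "\<And>l a. \<lbrakk>lin l; a \<in> carrier A\<rbrakk> \<Longrightarrow>
      l (displacement j \<gamma> a) = comult A a (\<lambda>x y. l (twist j x) * \<gamma> y - \<gamma> x * l y)"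
    unfolding displacement_def by blast+
qed

lemmas displacement_closed = linear_mapD(1)[OF linear_map_displacement]

lemma displacement_homogeneous:
  assumes a: "a \<in> part A i"
  shows "displacement j \<gamma> a \<in> part A (i + j)"
proof (rule mem_submodule_by_lin[OF part_submodule displacement_closed[OF part_carrier[OF a]]])
  fix l assume l: "lin l" and l0: "\<And>x. x \<in> part A (i + j) \<Longrightarrow> l x = 0"
  have "l (displacement j \<gamma> a) = comult A a (\<lambda>x y. l (twist j x) * \<gamma> y - \<gamma> x * l y)"
    by (rule lin_displacement[OF l part_carrier[OF a]])
  \<comment> \<open>The zero form, written as a product of two linear forms so that its bilinearity
    is an instance of \<open>bilinear_lin_lin\<close>.\<close>
  also have "\<dots> = comult A a (\<lambda>x y. 0 * \<gamma> x * \<gamma> y)"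
  proof (rule comult_homogeneous_cong[OF a bilinear_diff[OF bilinear_displacement_form[OF l]]
        bilinear_lin_lin[OF lin_cmult[OF \<gamma>] \<gamma>]])
    fix k x y assume xy: "x \<in> part A k" "y \<in> part A (i + k)"
    have "l (twist j x) * \<gamma> y = 0"
    proof (cases "k = i + j")
      case True
      then have "l (twist j x) = 0"
        using xy(1) l0 part_sc by (simp add: twist_homogeneous[OF xy(1)])
      then show ?thesis by simp
    next
      case False
      then have "i + k \<noteq> j" by (cases i; cases j; cases k) auto
      then show ?thesis using \<gamma>_hom[OF xy(2)] by simp
    qed
    moreover have "\<gamma> x * l y = 0"
    proof (cases "k = j")
      case True
      then show ?thesis using xy(2) l0 by simp
    next
      case False
      then show ?thesis using \<gamma>_hom[OF xy(1)] by simp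
    qed
    ultimately show "l (twist j x) * \<gamma> y - \<gamma> x * l y = 0 * \<gamma> x * \<gamma> y"
      by (simp only: diff_self mult_zero_left)
  qed
  also have "\<dots> = 0" by (rule comult_eq_0[OF part_carrier[OF a]]) simp
  finally show "l (displacement j \<gamma> a) = 0" .
qed

lemma counit_twist: "a \<in> carrier A \<Longrightarrow> counit A (twist j a) = counit A a"
  using lin_decomp[OF counit_linear, of a] counit_odd[OF component_part[of a 1]]
  by (simp add: twist_def linD(1,2)[OF counit_linear])

text \<open>At the identity the commutator is trivial: by the counit axioms both terms collapse to
  \<open>\<gamma> a\<close>.\<close>

lemma counit_displacement:
  assumes a: "a \<in> carrier A"
  shows "counit A (displacement j \<gamma> a) = 0"
proof -
  have "counit A (displacement j \<gamma> a) = comult A a (\<lambda>x y. counit A (twist j x) * \<gamma> y)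
      - comult A a (\<lambda>x y. \<gamma> x * counit A y)"
    unfolding lin_displacement[OF counit_linear a]
    by (rule comult_minus[OF a bilinear_displacement_form[OF counit_linear]])
  also have "comult A a (\<lambda>x y. counit A (twist j x) * \<gamma> y) = comult A a (\<lambda>x y. counit A x * \<gamma> y)"
    by (rule comult_cong[OF a]) (simp add: counit_twist)
  finally show ?thesis
    by (simp add: comult_counit_left[OF a \<gamma>] comult_counit_right[OF a \<gamma>])
qed

text \<open>A telescoping argument as for the commutator of a product. In the threefold
  comultiplication, \<gamma> stands in the last position in one term of the left side and in the
  first position in the other; one adds and subtracts the term with \<gamma> in the middle.\<close>

lemma comult_displacement:
  assumes a: "a \<in> carrier A" and \<beta>: "bilinear_form A A \<beta>"
  shows "comult A (displacement j \<gamma> a) \<beta> =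
    comult A a (\<lambda>x y. \<beta> (displacement j \<gamma> x) y + \<beta> (twist j x) (displacement j \<gamma> y))"
proof -
  note \<beta>1 = bilinearD(1)[OF \<beta>] and \<beta>2 = bilinearD(2)[OF \<beta>]
  \<comment> \<open>\<open>\<tau>1\<close>, \<open>\<tau>2\<close> and \<open>\<tau>3\<close> have
    \<gamma> in the last, first and middle position. Each factor to the left of \<gamma> carries a
    twist.\<close>
  define \<tau>1 where "\<tau>1 x u v = \<beta> (twist j x) (twist j u) * \<gamma> v" for x u v
  define \<tau>2 where "\<tau>2 x u v = \<gamma> x * \<beta> u v" for x u v
  define \<tau>3 where "\<tau>3 x u v = \<gamma> u * \<beta> (twist j x) v" for x u v
  have \<tau>1: "trilinear_form A A A \<tau>1"
    unfolding \<tau>1_def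
    by (intro trilinearI lin_multc[OF lin_comp[OF \<beta>1 linear_map_twist]]
        lin_multc[OF lin_comp[OF \<beta>2 linear_map_twist]] lin_cmult[OF \<gamma>] twist_closed)
  have \<tau>2: "trilinear_form A A A \<tau>2"
    unfolding \<tau>2_def
    by (rule trilinearI; (rule lin_multc[OF \<gamma>] | rule lin_cmult[OF \<beta>1] | rule lin_cmult[OF \<beta>2]); assumption?)
  have \<tau>3: "trilinear_form A A A \<tau>3"
    unfolding \<tau>3_def
    by (rule trilinearI; (rule lin_multc[OF \<gamma>] | rule lin_cmult[OF lin_comp[OF \<beta>1 linear_map_twist]]
        | rule lin_cmult[OF \<beta>2[OF twist_closed]]); assumption?)
  define L where "L \<tau> = comult A a (\<lambda>x y. comult A x (\<lambda>u v. \<tau> u v y))" for \<tau>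
  define R where "R \<tau> = comult A a (\<lambda>x y. comult A y (\<lambda>u v. \<tau> x u v))" for \<tau>
  have LR: "L \<tau> = R \<tau>" if "trilinear_form A A A \<tau>" for \<tau>
    unfolding L_def R_def by (rule coassoc[OF a that])
  have "comult A (displacement j \<gamma> a) \<beta> =
      comult A a (\<lambda>x y. comult A (twist j x) \<beta> * \<gamma> y - \<gamma> x * comult A y \<beta>)"
    by (rule lin_displacement[OF lin_comult a])
  also have "\<dots> = comult A a (\<lambda>x y. comult A x (\<lambda>u v. \<tau>1 u v y) - comult A y (\<tau>2 x))"
  proof (rule comult_cong[OF a])
    fix x y assume xy: "x \<in> carrier A" "y \<in> carrier A"
    have "comult A x (\<lambda>u v. \<tau>1 u v y) = comult A x (\<lambda>u v. \<gamma> y * \<beta> (twist j u) (twist j v))"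
      by (rule comult_cong[OF xy(1)]) (simp add: \<tau>1_def)
    also have "\<dots> = comult A (twist j x) \<beta> * \<gamma> y"
      by (subst comult_cmult[OF xy(1) bilinear_map[OF \<beta> linear_map_twist linear_map_twist]])
        (simp add: comult_twist[OF xy(1) \<beta>])
    finally have 1: "comult A x (\<lambda>u v. \<tau>1 u v y) = comult A (twist j x) \<beta> * \<gamma> y" .
    have 2: "comult A y (\<tau>2 x) = \<gamma> x * comult A y \<beta>"
      unfolding \<tau>2_def[abs_def] by (rule comult_cmult[OF xy(2) \<beta>])
    show "comult A (twist j x) \<beta> * \<gamma> y - \<gamma> x * comult A y \<beta>
      = comult A x (\<lambda>u v. \<tau>1 u v y) - comult A y (\<tau>2 x)"
      by (simp only: 1 2)
  qed
  also have "\<dots> = L \<tau>1 - R \<tau>2"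
    unfolding L_def R_def
    by (rule comult_minus[OF a bilinear_comult_left[OF \<tau>1] bilinear_comult_right[OF \<tau>2]])
  \<comment> \<open>Coassociativity lets each term be bracketed as required: the first difference
    becomes a displacement in the left tensor factor, the second one in the right factor.\<close>
  also have "\<dots> = (R \<tau>3 - L \<tau>2) + (R \<tau>1 - R \<tau>3)"
    by (simp add: LR \<tau>1 \<tau>2)
  also have "R \<tau>3 - L \<tau>2 = comult A a (\<lambda>x y. \<beta> (displacement j \<gamma> x) y)"
  proof -
    have "comult A a (\<lambda>x y. \<beta> (displacement j \<gamma> x) y) =
        comult A a (\<lambda>x y. comult A x (\<lambda>u v. \<tau>3 u v y) - comult A x (\<lambda>u v. \<tau>2 u v y))"
    proof (rule comult_cong[OF a])
      fix x y assume xy: "x \<in> carrier A" "y \<in> carrier A"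
      have "\<beta> (displacement j \<gamma> x) y = comult A x (\<lambda>u v. \<tau>3 u v y - \<tau>2 u v y)"
        unfolding lin_displacement[OF \<beta>1[OF xy(2)] xy(1)] \<tau>2_def \<tau>3_def
        by (rule comult_cong[OF xy(1)]) (simp add: mult.commute)
      also have "\<dots> = comult A x (\<lambda>u v. \<tau>3 u v y) - comult A x (\<lambda>u v. \<tau>2 u v y)"
        by (rule comult_minus[OF xy(1) trilinearD(3)[OF \<tau>3 xy(2)] trilinearD(3)[OF \<tau>2 xy(2)]])
      finally show "\<beta> (displacement j \<gamma> x) y = \<dots>" .
    qed
    also have "\<dots> = L \<tau>3 - L \<tau>2"
      unfolding L_def
      by (rule comult_minus[OF a bilinear_comult_left[OF \<tau>3] bilinear_comult_left[OF \<tau>2]])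
    finally show ?thesis by (simp add: LR \<tau>3)
  qed
  also have "R \<tau>1 - R \<tau>3 = comult A a (\<lambda>x y. \<beta> (twist j x) (displacement j \<gamma> y))"
  proof -
    have "comult A a (\<lambda>x y. \<beta> (twist j x) (displacement j \<gamma> y)) =
        comult A a (\<lambda>x y. comult A y (\<lambda>u v. \<tau>1 x u v) - comult A y (\<lambda>u v. \<tau>3 x u v))"
    proof (rule comult_cong[OF a])
      fix x y assume xy: "x \<in> carrier A" "y \<in> carrier A"
      have "\<beta> (twist j x) (displacement j \<gamma> y) = comult A y (\<lambda>u v. \<tau>1 x u v - \<tau>3 x u v)"
        unfolding lin_displacement[OF \<beta>2[OF twist_closed[OF xy(1)]] xy(2)] \<tau>1_def \<tau>3_def ..
      also have "\<dots> = comult A y (\<lambda>u v. \<tau>1 x u v) - comult A y (\<lambda>u v. \<tau>3 x u v)"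
        by (rule comult_minus[OF xy(2) trilinearD(2)[OF \<tau>1 xy(1)] trilinearD(2)[OF \<tau>3 xy(1)]])
      finally show "\<beta> (twist j x) (displacement j \<gamma> y) = \<dots>" .
    qed
    also have "\<dots> = R \<tau>1 - R \<tau>3"
      unfolding R_def
      by (rule comult_minus[OF a bilinear_comult_right[OF \<tau>1] bilinear_comult_right[OF \<tau>3]])
    finally show ?thesis by simp
  qed
  finally show ?thesis
    unfolding comult_plus[OF a bilinear_map[OF \<beta> linear_map_displacement linear_map_id]
        bilinear_map[OF \<beta> linear_map_twist linear_map_displacement]] .
qed

end

lemmas A_mult_closed = ring.ring_simprules(5)[OF ring_A]

text \<open>Without multiplicativity of the antipode \<open>S\<close>: applying \<open>\<Sum> x\<^sub>1 S(x\<^sub>2) = \<epsilon>(x)\<close> to \<open>x = b d(a)\<close> gives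
  \<open>\<Sum> \<plusminus> b\<^sub>1 a\<^sub>1 S(b\<^sub>2 d(a\<^sub>2)) \<in> I\<close>, from which \<open>a\<^sub>1\<close> and then \<open>b\<^sub>1\<close> are removed by
  \<open>convolution_cancel\<close>.\<close>

lemma antipode_displacement:
  assumes hom: "homogeneous_form j \<gamma>" and I: "ideal I A"
    and graded: "\<And>c i. c \<in> I \<Longrightarrow> component A i c \<in> I"
    and dI: "\<And>a. a \<in> carrier A \<Longrightarrow> displacement j \<gamma> a \<in> I"
    and a: "a \<in> carrier A" and b: "b \<in> carrier A"
  shows "antipode A (b \<otimes> displacement j \<gamma> a) \<in> I"
proof -
  interpret I: ideal I A by (rule I)
  note Scl = linear_mapD(1)[OF linear_map_antipode]
  let ?d = "displacement j \<gamma>"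
  note d = linear_map_displacement[OF hom] and dcl = displacement_closed[OF hom]
  note maps = linear_map_id linear_map_mult_left linear_map_mult_right linear_map_component
    linear_map_twist d linear_map_comp[OF linear_map_antipode]
  note closed = A_mult_closed component_closed twist_closed antipode_closed dcl
  have homogeneous: "comult A b (\<lambda>p q. l (p \<otimes> antipode A (q \<otimes> ?d a))) = 0"
    if b: "b \<in> part A n" and l: "lin l" "\<And>x. x \<in> I \<Longrightarrow> l x = 0" and a: "a \<in> carrier A" for b n l a
  proof -
    note bc = part_carrier[OF b]
    have bil_S: "bilinear_form A A (\<lambda>p q. l (p \<otimes> antipode A (q \<otimes> ?d y)))"
      if "lin l" "y \<in> carrier A" for l y
      using that(2) by (intro bilinear_mult[OF that(1)] maps closed)
    \<comment> \<open>For the fixed homogeneous \<open>b\<close> of degree \<open>n\<close>, this is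
      \<open>H(y) = \<Sum> b1 S(b2 d(y))\<close>. Showing \<open>H a \<in> I\<close> removes the
      factor coming from \<open>a\<close>; the factor \<open>b1\<close> is removed at the
      end.\<close>
    have "\<exists>H. linear_map H \<and> (\<forall>l y. lin l \<longrightarrow> y \<in> carrier A \<longrightarrow>
        l (H y) = comult A b (\<lambda>p q. l (p \<otimes> antipode A (q \<otimes> ?d y))))"
    proof (rule linear_map_by_forms)
      fix y assume y: "y \<in> carrier A"
      have "p \<otimes> antipode A (q \<otimes> ?d y) \<in> carrier A" if "p \<in> carrier A" "q \<in> carrier A" for p q
        using that y by (intro closed)
      from tensor_element[where B = "\<lambda>p q. p \<otimes> antipode A (q \<otimes> ?d y)", OF comult_tensor[OF bc] this bil_S[OF _ y]]
      show "\<exists>c\<in>carrier A. \<forall>l. lin l \<longrightarrow> l c = comult A b (\<lambda>p q. l (p \<otimes> antipode A (q \<otimes> ?d y)))"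
        by metis
    next
      fix l assume l: "lin l"
      show "lin (\<lambda>y. comult A b (\<lambda>p q. l (p \<otimes> antipode A (q \<otimes> ?d y))))"
        by (rule lin_comult_form[OF bc bil_S[OF l]])
          (assumption, intro lin_comp[OF l] maps closed)
    qed
    then obtain H where H: "linear_map H"
      and lH: "\<And>l y. \<lbrakk>lin l; y \<in> carrier A\<rbrakk> \<Longrightarrow> l (H y) = comult A b (\<lambda>p q. l (p \<otimes> antipode A (q \<otimes> ?d y)))"
      by blast
    note Hcl = linear_mapD(1)[OF H]
    \<comment> \<open>The exponent \<open>n + j\<close> is forced: \<Delta>(d(a)) contributes a
      twist by \<open>j\<close>, and moving its left factors in front of \<open>b1\<close>
      contributes a twist by the degree \<open>n\<close> of \<open>b\<close>.\<close>
    have "H a \<in> I"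
    proof (rule convolution_cancel_twist[OF I H a, where j = "n + j"])
      fix l a assume l: "lin l" "\<And>x. x \<in> I \<Longrightarrow> l x = 0" and a: "a \<in> carrier A"
      \<comment> \<open>The form \<open>x \<otimes> y \<mapsto> l(x S(y))\<close> evaluated at the
        product of the tensors \<open>p \<otimes> q\<close> and \<open>r \<otimes> s\<close>. The
        double sum copies \<open>tensor_mult\<close>, so that \<open>comult_mult\<close> applies
        later.\<close>
      define M where "M p q r s = (\<Sum>i\<in>{0, 1}. \<Sum>k\<in>{0, 1}.
        koszul i k * l ((p \<otimes> component A k r) \<otimes> antipode A (component A i q \<otimes> s)))" for p q r s
      define G where "G p q x y = l (twist (n + j) x \<otimes> (p \<otimes> antipode A (q \<otimes> ?d y)))" for p q x y
      have M_bil: "bilinear_form A A (M p q)" if "p \<in> carrier A" "q \<in> carrier A" for p q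
        unfolding M_def using that by (intro bilinearI lin_sum lin_cmult lin_comp[OF l(1)] maps closed)
      have M_lin: "lin (\<lambda>p. M p q r s)" if "q \<in> carrier A" "r \<in> carrier A" "s \<in> carrier A" for q r s
        unfolding M_def using that by (intro lin_sum lin_cmult lin_comp[OF l(1)] maps closed)
      have M_lin': "lin (\<lambda>q. M p q r s)" if "p \<in> carrier A" "r \<in> carrier A" "s \<in> carrier A" for p r s
        unfolding M_def using that by (intro lin_sum lin_cmult lin_comp[OF l(1)] maps closed)
      have Md_bil: "bilinear_form A A (\<lambda>x y. M p q (twist j x) (?d y))"
        if "p \<in> carrier A" "q \<in> carrier A" for p q
        by (rule bilinear_map[OF M_bil[OF that] linear_map_twist d])
      have Md: "bilinear_form A A (\<lambda>p q. comult A a (\<lambda>x y. M p q (twist j x) (?d y)))"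
      proof (rule bilinearI)
        show "lin (\<lambda>p. comult A a (\<lambda>x y. M p q (twist j x) (?d y)))" if "q \<in> carrier A" for q
          by (rule lin_comult_form[OF a]; rule Md_bil M_lin; (assumption | rule that closed)+)
        show "lin (\<lambda>q. comult A a (\<lambda>x y. M p q (twist j x) (?d y)))" if "p \<in> carrier A" for p
          by (rule lin_comult_form[OF a]; rule Md_bil M_lin'; (assumption | rule that closed)+)
      qed
      have G_bil: "bilinear_form A A (G p q)" if "p \<in> carrier A" "q \<in> carrier A" for p q
        unfolding G_def using that by (intro bilinearI lin_comp[OF l(1)] maps closed)
      have G_lin: "lin (\<lambda>p. G p q x y)" if "q \<in> carrier A" "x \<in> carrier A" "y \<in> carrier A" for q x y
        unfolding G_def using that by (intro lin_comp[OF l(1)] maps closed)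
      have G_lin': "lin (\<lambda>q. G p q x y)" if "p \<in> carrier A" "x \<in> carrier A" "y \<in> carrier A" for p x y
        unfolding G_def using that by (intro lin_comp[OF l(1)] maps closed)
      have G_bil': "bilinear_form A A (\<lambda>p q. G p q x y)" if "x \<in> carrier A" "y \<in> carrier A" for x y
        using that by (intro bilinearI G_lin G_lin')
      have G: "bilinear_form A A (\<lambda>p q. comult A a (G p q))"
      proof (rule bilinearI)
        show "lin (\<lambda>p. comult A a (G p q))" if "q \<in> carrier A" for q
          by (rule lin_comult_form[OF a]; rule G_bil G_lin; (assumption | rule that closed)+)
        show "lin (\<lambda>q. comult A a (G p q))" if "p \<in> carrier A" for p
          by (rule lin_comult_form[OF a]; rule G_bil G_lin'; (assumption | rule that closed)+)
      qed
      have S_bil: "bilinear_form A A (\<lambda>x y. l (x \<otimes> antipode A y))"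
        by (rule bilinear_mult[OF l(1) linear_map_id linear_map_antipode])
      have "comult A a (\<lambda>x y. l (twist (n + j) x \<otimes> H y)) = comult A a (\<lambda>x y. comult A b (\<lambda>p q. G p q x y))"
        unfolding G_def
        by (intro comult_cong[OF a] lH lin_comp[OF l(1)] maps closed)
      also have "\<dots> = comult A b (\<lambda>p q. comult A a (\<lambda>x y. G p q x y))"
        by (rule comult_swap[OF a bc G_bil' G_bil])
      \<comment> \<open>The Koszul product gives a sign from the degrees of \<open>q\<close> and
        \<open>x\<close>, the exchange of \<open>p\<close> and \<open>x\<close> one from the degrees
        of \<open>p\<close> and \<open>x\<close>. Together they depend only on the degree
        \<open>n\<close> of \<open>b\<close> and that of \<open>x\<close>, that is, they form a
        twist by \<open>n\<close>. This is why \<open>b\<close> was made homogeneous.\<close>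
      also have "\<dots> = comult A b (\<lambda>p q. comult A a (\<lambda>x y. M p q (twist j x) (?d y)))"
      proof (rule comult_homogeneous_cong[OF b G Md], rule comult_cong[OF a])
        fix m p q x y
        assume p: "p \<in> part A m" and q: "q \<in> part A (n + m)" and xy: "x \<in> carrier A" "y \<in> carrier A"
        note pc = part_carrier[OF p] and qc = part_carrier[OF q]
        let ?x = "\<lambda>k. component A k (twist j x)" and ?S = "antipode A (q \<otimes> ?d y)"
        have Sc: "?S \<in> carrier A" using qc xy by (intro closed)
        have xc: "?x k \<in> carrier A" for k using xy by (intro closed)
        have summand: "koszul (n + m) k * l ((p \<otimes> ?x k) \<otimes> ?S) = koszul n k * l (?x k \<otimes> (p \<otimes> ?S))" for k
        proof -
          have "l ((p \<otimes> ?x k) \<otimes> ?S) = koszul m k * l (?x k \<otimes> (p \<otimes> ?S))"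
            unfolding koszul_commute_mult[OF p twist_closed[OF xy(1)]]
            using xc[of k] pc Sc
            by (simp add: smult_mult_left linD(2)[OF l(1)] A_m_assoc A_mult_closed)
          moreover have "koszul (n + m) k * koszul m k = (koszul n k :: 'k)"
            by (simp only: koszul_add_left mult.assoc koszul_square mult_1_right)
          ultimately show ?thesis by (simp only: mult.assoc[symmetric])
        qed
        have "M p q (twist j x) (?d y) = (\<Sum>k\<in>{0, 1}. koszul (n + m) k * l ((p \<otimes> ?x k) \<otimes> ?S))"
        proof -
          \<comment> \<open>As \<open>q\<close> is homogeneous, the summands of \<open>M\<close> for
            the other degree of \<open>q\<close> contain a factor \<zero>.\<close>
          have zero: "l ((p \<otimes> ?x k) \<otimes> antipode A (\<zero> \<otimes> ?d y)) = 0" for k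
          proof -
            have "antipode A \<zero> = \<zero>"
              using antipode_smult[of \<zero> 0] by simp
            then show ?thesis
              using xc[of k] pc dcl[OF xy(2)] linD(5)[OF l(1)]
              by (simp add: ring.ring_simprules(24,25)[OF ring_A] A_mult_closed)
          qed
          show ?thesis
            unfolding M_def component_homogeneous[OF q]
            by (cases "n + m") (simp_all add: zero)
        qed
        also have "\<dots> = l (?x 0 \<otimes> (p \<otimes> ?S)) + koszul 1 n * l (?x 1 \<otimes> (p \<otimes> ?S))"
          by (simp only: summand) (simp add: koszul_commute[of n])
        also have "\<dots> = l (twist n (twist j x) \<otimes> (p \<otimes> ?S))"
          unfolding twist_def[of n] using xc pc Sc
          by (simp add: A_l_distr smult_mult_left A_mult_closed linD(1,2)[OF l(1)])
        finally show "G p q x y = M p q (twist j x) (?d y)"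
          unfolding G_def using xy by (simp add: twist_twist)
      qed
      also have "\<dots> = comult A b (\<lambda>p q. comult A (?d a) (M p q))"
      proof (rule comult_cong[OF bc])
        fix p q assume pq: "p \<in> carrier A" "q \<in> carrier A"
        have "comult A (?d a) (M p q) = comult A a (\<lambda>x y. M p q (?d x) y + M p q (twist j x) (?d y))"
          by (rule comult_displacement[OF hom a M_bil[OF pq]])
        also have "\<dots> = comult A a (\<lambda>x y. M p q (twist j x) (?d y))"
        proof (rule comult_cong[OF a])
          fix x y assume xy: "x \<in> carrier A" "y \<in> carrier A"
          \<comment> \<open>The other half of \<open>comult_displacement\<close> lies in
            \<open>I\<close>: its left factor is a homogeneous component of a generator, and
            \<open>I\<close> is graded.\<close>
          have "l ((p \<otimes> component A k (?d x)) \<otimes> antipode A (component A i q \<otimes> y)) = 0" for i k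
            by (rule l(2)) (intro I.I_r_closed I.I_l_closed graded dI closed pq xy)
          then show "M p q (?d x) y + M p q (twist j x) (?d y) = M p q (twist j x) (?d y)"
            unfolding M_def by simp
        qed
        finally show "comult A a (\<lambda>x y. M p q (twist j x) (?d y)) = comult A (?d a) (M p q)" ..
      qed
      also have "\<dots> = comult A (b \<otimes> ?d a) (\<lambda>x y. l (x \<otimes> antipode A y))"
        unfolding comult_mult[OF bc dcl[OF a]] tensor_mult_def M_def[abs_def] using S_bil by simp
      also have "\<dots> = counit A (b \<otimes> ?d a) * l \<one>"
        by (rule comult_antipode_right[OF A_mult_closed[OF bc dcl[OF a]] l(1)])
      also have "\<dots> = 0"
        using bc dcl[OF a] by (simp add: counit_mult counit_displacement[OF hom a])
      finally show "comult A a (\<lambda>x y. l (twist (n + j) x \<otimes> H y)) = 0" .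
    qed
    then show ?thesis using lH[OF l(1) a] l(2) by simp
  qed
  show ?thesis
  proof (rule convolution_cancel[OF I _ b, where F = "\<lambda>b. antipode A (b \<otimes> ?d a)"])
    show "linear_map (\<lambda>b. antipode A (b \<otimes> ?d a))" using a by (intro maps closed)
    fix l b assume l: "lin l" "\<And>x. x \<in> I \<Longrightarrow> l x = 0" and b: "b \<in> carrier A"
    show "comult A b (\<lambda>p q. l (p \<otimes> antipode A (q \<otimes> ?d a))) = 0"
      by (rule lin_eq_0_if_homogeneous[OF lin_comult homogeneous[OF _ l a] b])
  qed
qed

section \<open>The ideal generated by displacements is a Hopf superideal\<close>

definition displacements :: "(bit \<times> ('a \<Rightarrow> 'k)) set \<Rightarrow> 'a set" where
  "displacements \<Gamma> = {displacement j \<gamma> a | j \<gamma> a. (j, \<gamma>) \<in> \<Gamma> \<and> a \<in> carrier A}"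

context
  fixes \<Gamma> :: "(bit \<times> ('a \<Rightarrow> 'k)) set"
  assumes hom: "\<And>j \<gamma>. (j, \<gamma>) \<in> \<Gamma> \<Longrightarrow> homogeneous_form j \<gamma>"
begin

definition centralizer_ideal :: "'a set" where
  "centralizer_ideal = genideal A (displacements \<Gamma>)"

lemma displacements_carrier: "displacements \<Gamma> \<subseteq> carrier A"
  unfolding displacements_def using displacement_closed[OF hom] by blast

lemma centralizer_ideal: "ideal centralizer_ideal A"
  unfolding centralizer_ideal_def by (rule ring.genideal_ideal[OF ring_A displacements_carrier])

lemma displacement_mem: "\<lbrakk>(j, \<gamma>) \<in> \<Gamma>; a \<in> carrier A\<rbrakk> \<Longrightarrow> displacement j \<gamma> a \<in> centralizer_ideal"
  using ring.genideal_self[OF ring_A displacements_carrier]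
  unfolding centralizer_ideal_def displacements_def by blast

text \<open>Serves as the induction principle below: a property holds on the whole ideal once the
  elements that have it form an ideal containing all displacements.\<close>

lemma centralizer_ideal_minimal:
  assumes "ideal P A" and "\<And>j \<gamma> a. \<lbrakk>(j, \<gamma>) \<in> \<Gamma>; a \<in> carrier A\<rbrakk> \<Longrightarrow> displacement j \<gamma> a \<in> P"
  shows "centralizer_ideal \<subseteq> P"
  unfolding centralizer_ideal_def
  by (rule ring.genideal_minimal[OF ring_A assms(1)]) (use assms(2) in \<open>auto simp: displacements_def\<close>)

interpretation I: ideal centralizer_ideal A
  by (rule centralizer_ideal)

text \<open>A displacement of an arbitrary \<open>a\<close> need not be homogeneous, but it is the
  sum of the displacements of the two components of \<open>a\<close>, which are homogeneous
  generators.\<close>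

lemma centralizer_ideal_component:
  assumes "c \<in> centralizer_ideal"
  shows "component A i c \<in> centralizer_ideal"
proof -
  let ?I = centralizer_ideal
  let ?P = "{c \<in> ?I. \<forall>i. component A i c \<in> ?I}"
  have "?I \<subseteq> ?P"
  proof (rule centralizer_ideal_minimal)
    show "ideal ?P A"
    proof (rule idealI_closed)
      have "component A i \<zero> = \<zero>" for i
        using component_homogeneous[OF part_zero] by simp
      then show "\<zero> \<in> ?P" using I.zero_closed by simp
      show "x \<oplus> y \<in> ?P" if "x \<in> ?P" "y \<in> ?P" for x y
        using that I.Icarr by (simp add: linear_mapD(2)[OF linear_map_component] I.a_closed)
      show "u \<otimes> x \<in> ?P" if "u \<in> carrier A" "x \<in> ?P" for u x
        using that I.Icarr by (simp add: component_mult I.a_closed I.I_l_closed)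
      show "x \<otimes> u \<in> ?P" if "u \<in> carrier A" "x \<in> ?P" for u x
        using that I.Icarr by (simp add: component_mult I.a_closed I.I_r_closed)
    qed (use I.Icarr in blast)
  next
    fix j \<gamma> a assume \<gamma>: "(j, \<gamma>) \<in> \<Gamma>" and a: "a \<in> carrier A"
    let ?d = "displacement j \<gamma>"
    note h = hom[OF \<gamma>]
    have part: "component A i (?d b) \<in> ?I" if b: "b \<in> part A m" for i m b
      unfolding component_homogeneous[OF displacement_homogeneous[OF h b]]
      using displacement_mem[OF \<gamma> part_carrier[OF b]] I.zero_closed by simp
    have "component A i (?d a) = component A i (?d (component A 0 a)) \<oplus> component A i (?d (component A 1 a))" for i
    proof -
      have "?d a = ?d (component A 0 a) \<oplus> ?d (component A 1 a)"
        using linear_mapD(2)[OF linear_map_displacement[OF h], of "component A 0 a" "component A 1 a"] a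
        by (simp add: component_decomp)
      then show ?thesis
        using a displacement_closed[OF h] by (simp add: linear_mapD(2)[OF linear_map_component])
    qed
    then have "component A i (?d a) \<in> ?I" for i
      using part[OF component_part[OF a]] I.a_closed by metis
    then show "?d a \<in> ?P"
      using displacement_mem[OF \<gamma> a] by blast
  qed
  then show ?thesis using assms by blast
qed

text \<open>Generators are settled by \<open>comult_displacement\<close>. The step from generators
  to the ideal uses that the ideal is graded, since the product of tensors splits the inner factors
  into components.\<close>

lemma centralizer_ideal_comult:
  assumes "c \<in> centralizer_ideal"
  shows "comult A c \<in> tensor_span A A (centralizer_ideal \<times> carrier A \<union> carrier A \<times> centralizer_ideal)"
proof -
  let ?I = centralizer_ideal
  let ?S = "?I \<times> carrier A \<union> carrier A \<times> ?I"
  let ?P = "{c \<in> ?I. comult A c \<in> tensor_span A A ?S}"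
  have Isc: "k \<odot> x \<in> ?I" if "x \<in> ?I" for k x
    using submodule.smult_closed[OF ideal_submodule[OF centralizer_ideal]] that by simp
  have S_carrier: "?S \<subseteq> carrier A \<times> carrier A" using I.Icarr by blast
  have "?I \<subseteq> ?P"
  proof (rule centralizer_ideal_minimal)
    show "ideal ?P A"
    proof (rule idealI_closed)
      have "comult A \<zero> = tensor_sum A A []"
        using comult_smult[of \<zero> 0] by (simp add: tensor_sum_def fun_eq_iff)
      then show "\<zero> \<in> ?P" using I.zero_closed by (auto simp: tensor_span_def intro!: exI[of _ "[]"])
      show "x \<oplus> y \<in> ?P" if "x \<in> ?P" "y \<in> ?P" for x y
        using that I.Icarr tensor_span_add[of "comult A x" A A ?S "comult A y"]
        by (simp add: comult_add I.a_closed)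
    next
      fix u x assume u: "u \<in> carrier A" and x: "x \<in> ?P"
      obtain ps where ps: "comult A u = tensor_sum A A ps" "set ps \<subseteq> carrier A \<times> carrier A"
        using comult_rep[OF u] .
      obtain qs where qs: "comult A x = tensor_sum A A qs" "set qs \<subseteq> ?S"
        using x tensor_span_rep by blast
      have qc: "set qs \<subseteq> carrier A \<times> carrier A" using qs(2) S_carrier by blast
      have "tensor_mult A (tensor_sum A A ps) (tensor_sum A A qs) \<in> tensor_span A A ?S"
      proof (rule tensor_mult_span[OF ps(2) qc])
        fix a b c d i j k assume "(a, b) \<in> set ps" "(c, d) \<in> set qs"
        then have "a \<in> carrier A" "b \<in> carrier A" "(c \<in> ?I \<and> d \<in> carrier A) \<or> (c \<in> carrier A \<and> d \<in> ?I)"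
          using ps(2) qs(2) by blast+
        then show "(k \<odot> (a \<otimes> component A j c), component A i b \<otimes> d) \<in> ?S"
          using centralizer_ideal_component[of c j]
          by (auto intro!: Isc I.I_l_closed A_mult_closed)
      qed
      then show "u \<otimes> x \<in> ?P"
        using x u I.Icarr by (simp add: comult_mult ps(1) qs(1) I.I_l_closed)
      have "tensor_mult A (tensor_sum A A qs) (tensor_sum A A ps) \<in> tensor_span A A ?S"
      proof (rule tensor_mult_span[OF qc ps(2)])
        fix a b c d i j k assume "(a, b) \<in> set qs" "(c, d) \<in> set ps"
        then have "c \<in> carrier A" "d \<in> carrier A" "(a \<in> ?I \<and> b \<in> carrier A) \<or> (a \<in> carrier A \<and> b \<in> ?I)"
          using ps(2) qs(2) by blast+
        then show "(k \<odot> (a \<otimes> component A j c), component A i b \<otimes> d) \<in> ?S"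
          using centralizer_ideal_component[of b i]
          by (auto intro!: Isc I.I_r_closed A_mult_closed)
      qed
      then show "x \<otimes> u \<in> ?P"
        using x u I.Icarr by (simp add: comult_mult ps(1) qs(1) I.I_r_closed)
    qed (use I.Icarr in blast)
  next
    fix j \<gamma> a assume \<gamma>: "(j, \<gamma>) \<in> \<Gamma>" and a: "a \<in> carrier A"
    let ?d = "displacement j \<gamma>"
    note h = hom[OF \<gamma>]
    obtain ps where ps: "comult A a = tensor_sum A A ps" "set ps \<subseteq> carrier A \<times> carrier A"
      using comult_rep[OF a] .
    \<comment> \<open>The formula of \<open>comult_displacement\<close> as a list: in every pair,
      one entry is a displacement.\<close>
    define qs where "qs = map (\<lambda>(x, y). (?d x, y)) ps @ map (\<lambda>(x, y). (twist j x, ?d y)) ps"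
    have "comult A (?d a) = tensor_sum A A qs"
    proof
      fix \<beta>
      show "comult A (?d a) \<beta> = tensor_sum A A qs \<beta>"
      proof (cases "bilinear_form A A \<beta>")
        case True
        have bil: "bilinear_form A A (\<lambda>x y. \<beta> (?d x) y + \<beta> (twist j x) (?d y))"
          by (intro bilinear_add bilinear_map[OF True] linear_map_displacement[OF h] linear_map_id linear_map_twist)
        show ?thesis
          unfolding comult_displacement[OF h a True] ps(1) tensor_sum_apply[OF bil] tensor_sum_apply[OF True]
          by (simp add: qs_def split_def o_def sum_list_addf)
      next
        case False
        \<comment> \<open>\<open>comult_displacement\<close> speaks only of bilinear \<beta>; for
          all others both sides take the default value 0.\<close>
        obtain rs where "comult A (?d a) = tensor_sum A A rs"
          using comult_rep[OF displacement_closed[OF h a]] by blast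
        then show ?thesis using False by (simp add: tensor_sum_def)
      qed
    qed
    moreover have "set qs \<subseteq> ?S"
      using ps(2) displacement_mem[OF \<gamma>] unfolding qs_def by auto
    ultimately show "?d a \<in> ?P"
      using displacement_mem[OF \<gamma> a] unfolding tensor_span_def by blast
  qed
  then show ?thesis using assms by blast
qed

lemma centralizer_ideal_counit:
  assumes "c \<in> centralizer_ideal"
  shows "counit A c = 0"
proof -
  have "centralizer_ideal \<subseteq> {c \<in> carrier A. counit A c = 0}"
  proof (rule centralizer_ideal_minimal)
    show "ideal {c \<in> carrier A. counit A c = 0} A"
    proof (rule idealI_closed)
      show "\<zero> \<in> {c \<in> carrier A. counit A c = 0}"
        using linD(5)[OF counit_linear] by simp
    qed (simp_all add: linD(1)[OF counit_linear] counit_mult A_mult_closed)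
    show "displacement j \<gamma> a \<in> {c \<in> carrier A. counit A c = 0}"
      if "(j, \<gamma>) \<in> \<Gamma>" "a \<in> carrier A" for j \<gamma> a
      using counit_displacement[OF hom[OF that(1)] that(2)] displacement_closed[OF hom[OF that(1)] that(2)]
      by simp
  qed
  then show ?thesis using assms by blast
qed

text \<open>Factors on both sides are built into \<open>?P\<close>, so that it is an ideal without
  any rule for the antipode of a product. For a generator, supercommutativity moves the right factor
  to the left up to sign, and \<open>antipode_displacement\<close> applies.\<close>

lemma centralizer_ideal_antipode:
  assumes "c \<in> centralizer_ideal"
  shows "antipode A c \<in> centralizer_ideal"
proof -
  let ?I = centralizer_ideal
  let ?P = "{c \<in> carrier A. \<forall>u\<in>carrier A. \<forall>v\<in>carrier A. antipode A ((u \<otimes> c) \<otimes> v) \<in> ?I}"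
  note maps = linear_map_comp[OF linear_map_antipode] linear_map_mult_left linear_map_mult_right linear_map_id
  have "?I \<subseteq> ?P"
  proof (rule centralizer_ideal_minimal)
    show "ideal ?P A"
    proof (rule idealI_closed)
      have "antipode A \<zero> = \<zero>" using antipode_smult[of \<zero> 0] by simp
      then show "\<zero> \<in> ?P"
        using I.zero_closed by (simp add: ring.ring_simprules(24,25)[OF ring_A])
      show "x \<oplus> y \<in> ?P" if "x \<in> ?P" "y \<in> ?P" for x y
        using that by (simp add: A_l_distr A_r_distr antipode_add I.a_closed A_mult_closed)
      show "w \<otimes> x \<in> ?P" if w: "w \<in> carrier A" and x: "x \<in> ?P" for w x
      proof -
        have "(u \<otimes> (w \<otimes> x)) \<otimes> v = ((u \<otimes> w) \<otimes> x) \<otimes> v" if "u \<in> carrier A" "v \<in> carrier A" for u v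
          using that w x by (simp add: A_m_assoc A_mult_closed)
        then show ?thesis using x w by (simp add: A_mult_closed)
      qed
      show "x \<otimes> w \<in> ?P" if w: "w \<in> carrier A" and x: "x \<in> ?P" for w x
      proof -
        have "(u \<otimes> (x \<otimes> w)) \<otimes> v = (u \<otimes> x) \<otimes> (w \<otimes> v)" if "u \<in> carrier A" "v \<in> carrier A" for u v
          using that w x by (simp add: A_m_assoc A_mult_closed)
        then show ?thesis using x w by (simp add: A_mult_closed)
      qed
    qed blast
  next
    fix j \<gamma> a assume \<gamma>: "(j, \<gamma>) \<in> \<Gamma>" and a: "a \<in> carrier A"
    let ?d = "displacement j \<gamma>"
    note h = hom[OF \<gamma>]
    note d = linear_map_displacement[OF h] and dcl = displacement_closed[OF h]
    have "antipode A ((u \<otimes> ?d a) \<otimes> v) \<in> ?I" if u: "u \<in> carrier A" and v: "v \<in> carrier A" for u v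
    proof (rule mem_submodule_by_lin[OF ideal_submodule[OF centralizer_ideal]])
      show "antipode A ((u \<otimes> ?d a) \<otimes> v) \<in> carrier A"
        using u v dcl[OF a] by (simp add: A_mult_closed)
      fix l assume l: "lin l" "\<And>x. x \<in> ?I \<Longrightarrow> l x = 0"
      have "l (antipode A ((u \<otimes> ?d x) \<otimes> y)) = 0" if x: "x \<in> part A i" and y: "y \<in> part A m" for x y i m
      proof -
        note xc = part_carrier[OF x] and yc = part_carrier[OF y]
        have "(u \<otimes> ?d x) \<otimes> y = u \<otimes> (koszul (i + j) m \<odot> (y \<otimes> ?d x))"
          using supercommutative[OF displacement_homogeneous[OF h x] y] u yc dcl[OF xc]
          by (simp add: A_m_assoc)
        also have "\<dots> = koszul (i + j) m \<odot> ((u \<otimes> y) \<otimes> ?d x)"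
          using u yc dcl[OF xc] by (simp add: A_m_assoc smult_mult_right A_mult_closed)
        finally have eq: "(u \<otimes> ?d x) \<otimes> y = \<dots>" .
        have "antipode A ((u \<otimes> y) \<otimes> ?d x) \<in> ?I"
          using u yc by (intro antipode_displacement[OF h centralizer_ideal centralizer_ideal_component
              displacement_mem[OF \<gamma>] xc] A_mult_closed)
        then show ?thesis
          using u yc dcl[OF xc] l(2)
          by (simp add: eq antipode_smult A_mult_closed linD(2)[OF l(1)])
      qed
      note homogeneous = this
      have "l (antipode A ((u \<otimes> ?d x) \<otimes> v)) = 0" if x: "x \<in> part A i" for x i
      proof (rule lin_eq_0_if_homogeneous[of "\<lambda>v. l (antipode A ((u \<otimes> ?d x) \<otimes> v))", OF _ homogeneous[OF x] v])
        show "lin (\<lambda>v. l (antipode A ((u \<otimes> ?d x) \<otimes> v)))"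
          using u dcl[OF part_carrier[OF x]] by (intro lin_comp[OF l(1)] maps A_mult_closed)
      qed
      note homogeneous = this
      show "l (antipode A ((u \<otimes> ?d a) \<otimes> v)) = 0"
      proof (rule lin_eq_0_if_homogeneous[of "\<lambda>a. l (antipode A ((u \<otimes> ?d a) \<otimes> v))", OF _ homogeneous a])
        show "lin (\<lambda>a. l (antipode A ((u \<otimes> ?d a) \<otimes> v)))"
          using u v by (intro lin_comp[OF l(1)] maps d)
      qed
    qed
    then show "?d a \<in> ?P" using dcl[OF a] by blast
  qed
  then have "antipode A ((\<one> \<otimes> c) \<otimes> \<one>) \<in> ?I"
    using assms part_carrier[OF one_even] by blast
  then show ?thesis
    using I.Icarr[OF assms] part_carrier[OF one_even]
    by (simp add: ring.ring_simprules(12)[OF ring_A] monoid.r_one[OF ring.is_monoid[OF ring_A]])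
qed

theorem hopf_superideal_centralizer: "hopf_superideal A centralizer_ideal"
  unfolding hopf_superideal_def
  using centralizer_ideal centralizer_ideal_component centralizer_ideal_comult
    centralizer_ideal_counit centralizer_ideal_antipode by blast

end

section \<open>Lie superalgebras\<close>

abbreviation aug :: "'a set" where "aug \<equiv> augmentation_ideal A"

lemma aug_iff: "a \<in> aug \<longleftrightarrow> a \<in> carrier A \<and> counit A a = 0"
  by (simp add: augmentation_ideal_def)

lemma aug_ideal: "ideal aug A"
proof (rule idealI_closed)
  show "\<zero> \<in> aug" using linD(5)[OF counit_linear] by (simp add: aug_iff)
qed (auto simp: aug_iff linD(1)[OF counit_linear] counit_mult A_mult_closed)

interpretation aug: ideal aug A
  by (rule aug_ideal)

lemma aug_sc: "a \<in> aug \<Longrightarrow> k \<odot> a \<in> aug"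
  by (simp add: aug_iff linD(2)[OF counit_linear])

lemma component_aug: "a \<in> aug \<Longrightarrow> component A i a \<in> aug"
  using counit_odd[OF component_part[of a 1]] lin_decomp[OF counit_linear, of a]
  by (cases i) (auto simp: aug_iff)

lemma Lie_iff:
  "f \<in> Lie A \<longleftrightarrow> (\<forall>u\<in>aug. \<forall>v\<in>aug. f (u \<oplus> v) = f u + f v) \<and> (\<forall>k. \<forall>v\<in>aug. f (k \<odot> v) = k * f v) \<and>
     (\<forall>a. a \<notin> aug \<longrightarrow> f a = 0) \<and> (\<forall>a \<in> aug \<cdot> aug. f a = 0)"
  by (simp add: Lie_def linear_form_def)

lemma LieD:
  assumes "f \<in> Lie A"
  shows "\<lbrakk>u \<in> aug; v \<in> aug\<rbrakk> \<Longrightarrow> f (u \<oplus> v) = f u + f v"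
    "v \<in> aug \<Longrightarrow> f (k \<odot> v) = k * f v"
    "a \<notin> aug \<Longrightarrow> f a = 0"
    "a \<in> aug \<cdot> aug \<Longrightarrow> f a = 0"
    "f \<zero> = 0"
proof -
  show smult: "v \<in> aug \<Longrightarrow> f (k \<odot> v) = k * f v" for v k
    using assms unfolding Lie_iff by blast
  show "f \<zero> = 0" using smult[of \<zero> 0] aug.zero_closed by simp
qed (use assms in \<open>simp_all add: Lie_iff\<close>)

lemma reduce_aug: "a \<in> carrier A \<Longrightarrow> a \<ominus> counit A a \<odot> \<one> \<in> aug"
  by (simp add: aug_iff linD(2,4)[OF counit_linear] counit_one ring.ring_simprules(4)[OF ring_A])

lemma reduce_id: "a \<in> aug \<Longrightarrow> a \<ominus> counit A a \<odot> \<one> = a"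
  by (rule eq_by_lin) (auto simp: aug_iff linD(4,5) ring.ring_simprules(4)[OF ring_A])

lemma distribution_aug: "a \<in> aug \<Longrightarrow> distribution A f a = f a"
  by (simp add: distribution_def reduce_id)

lemma lin_distribution:
  assumes f: "f \<in> Lie A"
  shows "lin (distribution A f)"
proof (rule linI)
  note mc = ring.ring_simprules(4)[OF ring_A]
  fix a b assume ab: "a \<in> carrier A" "b \<in> carrier A"
  have "(a \<oplus> b) \<ominus> counit A (a \<oplus> b) \<odot> \<one> = (a \<ominus> counit A a \<odot> \<one>) \<oplus> (b \<ominus> counit A b \<odot> \<one>)"
  proof (rule eq_by_lin)
    fix l assume l: "lin l"
    show "l ((a \<oplus> b) \<ominus> counit A (a \<oplus> b) \<odot> \<one>) = l ((a \<ominus> counit A a \<odot> \<one>) \<oplus> (b \<ominus> counit A b \<odot> \<one>))"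
      using ab mc by (simp add: linD(1,2,4)[OF l] linD(1)[OF counit_linear] algebra_simps)
  qed (use ab mc in simp_all)
  then show "distribution A f (a \<oplus> b) = distribution A f a + distribution A f b"
    unfolding distribution_def using LieD(1)[OF f reduce_aug[OF ab(1)] reduce_aug[OF ab(2)]] by simp
next
  note mc = ring.ring_simprules(4)[OF ring_A]
  fix k a assume a: "a \<in> carrier A"
  have "k \<odot> a \<ominus> counit A (k \<odot> a) \<odot> \<one> = k \<odot> (a \<ominus> counit A a \<odot> \<one>)"
  proof (rule eq_by_lin)
    fix l assume l: "lin l"
    show "l (k \<odot> a \<ominus> counit A (k \<odot> a) \<odot> \<one>) = l (k \<odot> (a \<ominus> counit A a \<odot> \<one>))"
      using a mc by (simp add: linD(1,2,4)[OF l] linD(2)[OF counit_linear] algebra_simps)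
  qed (use a mc in simp_all)
  then show "distribution A f (k \<odot> a) = k * distribution A f a"
    unfolding distribution_def using LieD(2)[OF f reduce_aug[OF a]] by simp
qed

lemma distribution_one: "f \<in> Lie A \<Longrightarrow> distribution A f \<one> = 0"
proof -
  assume f: "f \<in> Lie A"
  have "\<one> \<ominus> \<one> = \<zero>" using A_right_minus_eq[of \<one> \<one>] by simp
  then show ?thesis
    unfolding distribution_def counit_one sc_one[OF A_one_closed] by (simp only: LieD(5)[OF f])
qed

text \<open>Modulo the square of the augmentation ideal, multiplying an element of the augmentation
  ideal by \<open>u\<close> is scaling it by \<open>counit A u\<close>, so \<open>f\<close> keeps
  vanishing.\<close>

lemma Lie_ideal:
  assumes f: "f \<in> Lie A" and J: "ideal J A"
  shows "ideal {c \<in> J \<inter> aug. f c = 0} A"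
proof -
  interpret J: ideal J A by (rule J)
  have mult: "f (u \<otimes> x) = 0" "f (x \<otimes> u) = 0" if u: "u \<in> carrier A" and x: "x \<in> aug" "f x = 0" for u x
  proof -
    let ?u = "u \<ominus> counit A u \<odot> \<one>"
    note xc = aug.Icarr[OF x(1)] and one = A_one_closed
    have u': "?u \<in> aug" by (rule reduce_aug[OF u])
    note uc = aug.Icarr[OF u']
    have u_eq: "u = ?u \<oplus> counit A u \<odot> \<one>"
      by (rule eq_by_lin) (use u uc in \<open>auto simp: linD(1,2,4)\<close>)
    have "u \<otimes> x = (?u \<otimes> x) \<oplus> counit A u \<odot> x"
      by (subst (1) u_eq) (use xc uc in \<open>simp add: A_l_distr smult_mult_left ring.ring_simprules(12)[OF ring_A]\<close>)
    moreover have "x \<otimes> u = (x \<otimes> ?u) \<oplus> counit A u \<odot> x"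
      by (subst (1) u_eq)
        (use xc uc in \<open>simp add: A_r_distr smult_mult_right monoid.r_one[OF ring.is_monoid[OF ring_A]]\<close>)
    moreover have "f (?u \<otimes> x) = 0" "f (x \<otimes> ?u) = 0"
      using LieD(4)[OF f] ideal_prod.prod[OF u' x(1)] ideal_prod.prod[OF x(1) u'] by blast+
    moreover have "f (counit A u \<odot> x) = 0" using LieD(2)[OF f x(1)] x(2) by simp
    moreover note aug.I_l_closed[OF x(1) uc] aug.I_r_closed[OF x(1) uc] aug_sc[OF x(1)]
    ultimately show "f (u \<otimes> x) = 0" "f (x \<otimes> u) = 0"
      by (simp_all add: LieD(1)[OF f])
  qed
  show ?thesis
  proof (rule idealI_closed)
    show "\<zero> \<in> {c \<in> J \<inter> aug. f c = 0}" using LieD(5)[OF f] by simp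
    show "x \<oplus> y \<in> {c \<in> J \<inter> aug. f c = 0}"
      if "x \<in> {c \<in> J \<inter> aug. f c = 0}" "y \<in> {c \<in> J \<inter> aug. f c = 0}" for x y
      using that LieD(1)[OF f, of x y] J.a_closed aug.a_closed by simp
    show "u \<otimes> x \<in> {c \<in> J \<inter> aug. f c = 0}"
      if "u \<in> carrier A" "x \<in> {c \<in> J \<inter> aug. f c = 0}" for u x
      using that mult(1) J.I_l_closed aug.I_l_closed by simp
    show "x \<otimes> u \<in> {c \<in> J \<inter> aug. f c = 0}"
      if "u \<in> carrier A" "x \<in> {c \<in> J \<inter> aug. f c = 0}" for u x
      using that mult(2) J.I_r_closed aug.I_r_closed by simp
  qed (use J.Icarr in blast)
qed

lemma component_aug_prod: "a \<in> aug \<cdot> aug \<Longrightarrow> component A i a \<in> aug \<cdot> aug"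
proof (induction a rule: ideal_prod.induct)
  case (prod x y)
  then show ?case
    using component_aug aug.Icarr by (simp add: component_mult ideal_prod.intros)
next
  case (sum x y)
  then show ?case
    using ring.ideal_prod_in_carrier[OF ring_A aug_ideal aug_ideal]
    by (simp add: linear_mapD(2)[OF linear_map_component] ideal_prod.sum subsetD)
qed

lemma Lie_component_Lie:
  assumes f: "f \<in> Lie A"
  shows "Lie_component A i f \<in> Lie A"
  unfolding Lie_iff
proof (intro conjI ballI allI impI)
  fix u v assume "u \<in> aug" "v \<in> aug"
  then show "Lie_component A i f (u \<oplus> v) = Lie_component A i f u + Lie_component A i f v"
    using aug.Icarr aug.a_closed component_aug LieD(1)[OF f]
    by (simp add: Lie_component_def linear_mapD(2)[OF linear_map_component])
next
  fix k v assume "v \<in> aug"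
  then show "Lie_component A i f (k \<odot> v) = k * Lie_component A i f v"
    using aug.Icarr aug_sc component_aug LieD(2)[OF f]
    by (simp add: Lie_component_def linear_mapD(3)[OF linear_map_component])
next
  fix a assume "a \<in> aug \<cdot> aug"
  then show "Lie_component A i f a = 0"
    using LieD(4)[OF f component_aug_prod] by (simp add: Lie_component_def)
qed (simp add: Lie_component_def)

lemma homogeneous_distribution:
  assumes f: "f \<in> Lie A"
  shows "homogeneous_form i (distribution A (Lie_component A i f))"
  unfolding homogeneous_form_def
proof (intro conjI ballI)
  show "lin (distribution A (Lie_component A i f))"
    by (rule lin_distribution[OF Lie_component_Lie[OF f]])
  fix a assume a: "a \<in> part A (i + 1)"
  note ac = part_carrier[OF a]
  \<comment> \<open>Removing the constant term changes only the even part, and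
    \<open>counit A a\<close> vanishes for odd \<open>a\<close>. So \<open>a\<close> stays of degree
    \<open>i + 1\<close>.\<close>
  have "component A i (a \<ominus> counit A a \<odot> \<one>) = \<zero>"
  proof (cases "i = 0")
    case True
    then have "counit A a = 0" using a counit_odd by simp
    then have "a \<ominus> counit A a \<odot> \<one> = a" using ac reduce_id by (simp add: aug_iff)
    then show ?thesis
      using True component_homogeneous[OF a, of i] by simp
  next
    case False
    then have i: "i = 1" by simp
    then have "a \<in> part A 0" using a by simp
    then have "a \<ominus> counit A a \<odot> \<one> \<in> part A 0"
      by (intro part_diff part_sc one_even)
    from component_homogeneous[OF this, of i] show ?thesis using i by simp
  qed
  then show "distribution A (Lie_component A i f) a = 0"
    using LieD(5)[OF f] by (simp add: distribution_def Lie_component_def)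
qed

lemma distribution_components:
  assumes f: "f \<in> Lie A" and a: "a \<in> carrier A"
  shows "distribution A f a =
    distribution A (Lie_component A 0 f) a + distribution A (Lie_component A 1 f) a"
proof -
  let ?a = "a \<ominus> counit A a \<odot> \<one>"
  have m: "?a \<in> aug" by (rule reduce_aug[OF a])
  have "f (component A 0 ?a \<oplus> component A 1 ?a) = f (component A 0 ?a) + f (component A 1 ?a)"
    by (rule LieD(1)[OF f component_aug[OF m] component_aug[OF m]])
  then show ?thesis
    using m component_decomp[OF aug.Icarr[OF m]] by (simp add: distribution_def Lie_component_def)
qed

text \<open>Only one of the four terms in the definition survives, so the sign is constant and
  leaves the sum.\<close>

lemma convolution_homogeneous:
  assumes \<phi>: "homogeneous_form i \<phi>" and \<psi>: "homogeneous_form j \<psi>" and a: "a \<in> carrier A"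
  shows "convolution A \<phi> \<psi> a = koszul i j * comult A a (\<lambda>x y. \<phi> x * \<psi> y)"
proof -
  have comp: "\<phi> (component A k x) = (if k = i then \<phi> x else 0)"
    if \<phi>: "homogeneous_form i \<phi>" and x: "x \<in> carrier A" for k i x and \<phi> :: "'a \<Rightarrow> 'k"
  proof -
    have 0: "\<phi> (component A k x) = 0" if "k \<noteq> i" for k
      by (rule homogeneous_formD(2)[OF \<phi> component_part[OF x] that])
    have "\<phi> (component A 0 x) + \<phi> (component A 1 x) = \<phi> x"
      by (rule lin_decomp[OF homogeneous_formD(1)[OF \<phi>] x])
    then show ?thesis using 0[of k] 0[of 0] 0[of 1] by (cases k; cases i) auto
  qed
  have "convolution A \<phi> \<psi> a = comult A a (\<lambda>x y. koszul i j * (\<phi> x * \<psi> y))"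
    unfolding convolution_def
    by (rule comult_cong[OF a]) (cases i; cases j; simp add: comp[OF \<phi>] comp[OF \<psi>])
  also have "\<dots> = koszul i j * comult A a (\<lambda>x y. \<phi> x * \<psi> y)"
    by (rule comult_cmult[OF a bilinear_lin_lin[OF homogeneous_formD(1)[OF \<phi>] homogeneous_formD(1)[OF \<psi>]]])
  finally show ?thesis .
qed

text \<open>In the product with \<open>z\<close> on the left, the sign of the convolution is the
  effect of the twist on the components of \<open>z\<close>. In the opposite product, the sign of
  the supercommutator cancels the sign of the convolution. Hence the components of \<open>z\<close>
  recombine, whereas those of \<open>g\<close> remain separated by their different twists.\<close>

lemma Lie_bracket_displacement:
  assumes z: "z \<in> Lie A" and g: "g \<in> Lie A" and a: "a \<in> aug"
  shows "Lie_bracket A z g a =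
    (\<Sum>j\<in>{0, 1}. distribution A z (displacement j (distribution A (Lie_component A j g)) a))"
proof -
  define \<phi> where "\<phi> i = distribution A (Lie_component A i z)" for i
  define \<psi> where "\<psi> j = distribution A (Lie_component A j g)" for j
  note ac = aug.Icarr[OF a]
  have h\<phi>: "homogeneous_form i (\<phi> i)" for i unfolding \<phi>_def by (rule homogeneous_distribution[OF z])
  have h\<psi>: "homogeneous_form j (\<psi> j)" for j unfolding \<psi>_def by (rule homogeneous_distribution[OF g])
  note l\<phi> = homogeneous_formD(1)[OF h\<phi>] and l\<psi> = homogeneous_formD(1)[OF h\<psi>]
  note Z = lin_distribution[OF z]
  define P where "P i j = comult A a (\<lambda>x y. \<phi> i x * \<psi> j y)" for i j
  define Q where "Q i j = comult A a (\<lambda>x y. \<psi> j x * \<phi> i y)" for i j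
  have conv: "convolution A (\<phi> i) (\<psi> j) a - koszul i j * convolution A (\<psi> j) (\<phi> i) a
      = koszul i j * P i j - Q i j" for i j
  proof -
    have "koszul i j * (koszul j i * c) = c" for c :: 'k
      by (simp only: koszul_commute[of j i] mult.assoc[symmetric] koszul_square mult_1_left)
    then show ?thesis
      unfolding convolution_homogeneous[OF h\<phi> h\<psi> ac] convolution_homogeneous[OF h\<psi> h\<phi> ac] P_def Q_def
      by simp
  qed
  have disp: "distribution A z (displacement j (\<psi> j) a) = (\<Sum>i\<in>{0, 1}. koszul i j * P i j - Q i j)" for j
  proof -
    \<comment> \<open>On the degree \<open>i\<close> component of \<open>z\<close>, precomposing
      with the twist is multiplication by \<open>koszul i j\<close>.\<close>
    have tw: "distribution A z (twist j x) = \<phi> 0 x + koszul 1 j * \<phi> 1 x" if x: "x \<in> carrier A" for x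
    proof -
      have z01: "\<phi> i (twist j x) = koszul i j * \<phi> i x" for i
      proof -
        have "lin (\<lambda>x. \<phi> i (twist j x) - koszul i j * \<phi> i x)"
          by (rule lin_diff[OF lin_comp[OF l\<phi> linear_map_twist] lin_cmult[OF l\<phi>]])
        then have "\<phi> i (twist j x) - koszul i j * \<phi> i x = 0"
        proof (rule lin_eq_0_if_homogeneous[OF _ _ x])
          fix k y assume y: "y \<in> part A k"
          show "\<phi> i (twist j y) - koszul i j * \<phi> i y = 0"
            unfolding twist_homogeneous[OF y] linD(2)[OF l\<phi> part_carrier[OF y]]
            using homogeneous_formD(2)[OF h\<phi> y, of i] by (cases "k = i") simp_all
        qed
        then show ?thesis by simp
      qed
      show ?thesis
        unfolding distribution_components[OF z twist_closed[OF x]] \<phi>_def[symmetric]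
        by (simp add: z01)
    qed
    note b = bilinear_lin_lin[OF l\<phi> l\<psi>] bilinear_lin_lin[OF l\<psi> l\<phi>]
    have "distribution A z (displacement j (\<psi> j) a) =
        comult A a (\<lambda>x y. distribution A z (twist j x) * \<psi> j y - \<psi> j x * distribution A z y)"
      by (rule lin_displacement[OF h\<psi> Z ac])
    also have "\<dots> = comult A a (\<lambda>x y. (\<phi> 0 x * \<psi> j y + koszul 1 j * (\<phi> 1 x * \<psi> j y))
        - (\<psi> j x * \<phi> 0 y + \<psi> j x * \<phi> 1 y))"
    proof (rule comult_cong[OF ac])
      fix x y assume x: "x \<in> carrier A" and y: "y \<in> carrier A"
      show "distribution A z (twist j x) * \<psi> j y - \<psi> j x * distribution A z y =
        (\<phi> 0 x * \<psi> j y + koszul 1 j * (\<phi> 1 x * \<psi> j y)) - (\<psi> j x * \<phi> 0 y + \<psi> j x * \<phi> 1 y)"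
        unfolding tw[OF x] distribution_components[OF z y] \<phi>_def[symmetric] by (simp add: algebra_simps)
    qed
    also have "\<dots> = comult A a (\<lambda>x y. \<phi> 0 x * \<psi> j y + koszul 1 j * (\<phi> 1 x * \<psi> j y))
        - comult A a (\<lambda>x y. \<psi> j x * \<phi> 0 y + \<psi> j x * \<phi> 1 y)"
      by (rule comult_minus[OF ac bilinear_add[OF b(1) bilinear_cmult[OF b(1)]] bilinear_add[OF b(2) b(2)]])
    also have "\<dots> = (P 0 j + koszul 1 j * P 1 j) - (Q 0 j + Q 1 j)"
      unfolding comult_plus[OF ac b(1) bilinear_cmult[OF b(1)]] comult_plus[OF ac b(2) b(2)]
        comult_cmult[OF ac b(1)] P_def Q_def ..
    finally show ?thesis by simp
  qed
  have "Lie_bracket A z g a = (\<Sum>i\<in>{0, 1}. \<Sum>j\<in>{0, 1}. koszul i j * P i j - Q i j)"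
    unfolding Lie_bracket_def using a by (simp add: Let_def \<phi>_def[symmetric] \<psi>_def[symmetric] conv)
  also have "\<dots> = (\<Sum>j\<in>{0, 1}. \<Sum>i\<in>{0, 1}. koszul i j * P i j - Q i j)"
    by (rule sum.swap)
  finally show ?thesis
    unfolding disp[symmetric] \<psi>_def .
qed

text \<open>The generating forms are split by degree because a displacement involves the degree of
  its form through the twist.\<close>

definition Lie_centralizer_ideal :: "'a set" where
  "Lie_centralizer_ideal =
     centralizer_ideal {(j, distribution A (Lie_component A j g)) | j g. g \<in> Lie A}"

context
begin

private abbreviation (input) "I \<equiv> Lie_centralizer_ideal"

private lemma hom:
  "(j, \<gamma>) \<in> {(j, distribution A (Lie_component A j g)) | j g. g \<in> Lie A} \<Longrightarrow> homogeneous_form j \<gamma>"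
  using homogeneous_distribution by blast

lemma hopf_superideal_Lie_centralizer: "hopf_superideal A I"
  unfolding Lie_centralizer_ideal_def by (rule hopf_superideal_centralizer[OF hom])

lemma Lie_displacement_mem:
  "\<lbrakk>g \<in> Lie A; a \<in> carrier A\<rbrakk> \<Longrightarrow> displacement j (distribution A (Lie_component A j g)) a \<in> I"
  unfolding Lie_centralizer_ideal_def by (rule displacement_mem[OF hom]) auto

lemma Lie_displacement_aug:
  "\<lbrakk>g \<in> Lie A; a \<in> carrier A\<rbrakk> \<Longrightarrow> displacement j (distribution A (Lie_component A j g)) a \<in> aug"
  using displacement_closed[OF homogeneous_distribution] counit_displacement[OF homogeneous_distribution]
  by (simp add: aug_iff)

text \<open>The constant \<open>g \<zero>\<close> is 0 by linearity. It is the form in which the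
  value appears when \<open>g\<close> is applied to a vanishing component.\<close>

lemma Lie_component_component:
  "Lie_component A k (Lie_component A j g) = (if k = j then Lie_component A j g else (\<lambda>_. g \<zero>))"
  if "g \<in> Lie A"
proof
  fix a
  show "Lie_component A k (Lie_component A j g) a = (if k = j then Lie_component A j g else (\<lambda>_. g \<zero>)) a"
  proof (cases "a \<in> aug")
    case True
    then have "component A j (component A k a) = (if j = k then component A j a else \<zero>)"
      using component_homogeneous[OF component_part, of a j k] by (auto simp: aug_iff)
    then show ?thesis using True component_aug[OF True] by (auto simp: Lie_component_def)
  next
    case False
    then show ?thesis using LieD(5)[OF that] by (simp add: Lie_component_def)
  qed
qed

text \<open>A bracket is a sum of values of \<open>z\<close> on generators, which gives one
  direction. For the other, bracketing with a single component of \<open>g\<close> isolates each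
  summand, and \<open>Lie_ideal\<close> extends the vanishing from the generators to the
  ideal.\<close>

lemma Lie_center_iff_vanishing:
  assumes z: "z \<in> Lie A"
  shows "z \<in> Lie_center A \<longleftrightarrow> (\<forall>c\<in>I. z c = 0)"
proof
  assume 0: "\<forall>c\<in>I. z c = 0"
  have "Lie_bracket A z g = (\<lambda>_. 0)" if g: "g \<in> Lie A" for g
  proof
    fix a
    show "Lie_bracket A z g a = 0"
    proof (cases "a \<in> aug")
      case True
      then have a: "a \<in> carrier A" by (simp add: aug_iff)
      show ?thesis
        unfolding Lie_bracket_displacement[OF z g True]
        using 0 Lie_displacement_mem[OF g a] distribution_aug[OF Lie_displacement_aug[OF g a]] by simp
    qed (simp add: Lie_bracket_def)
  qed
  then show "z \<in> Lie_center A" using z by (simp add: Lie_center_def)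
next
  assume "z \<in> Lie_center A"
  then have center: "Lie_bracket A z g = (\<lambda>_. 0)" if "g \<in> Lie A" for g
    using that by (simp add: Lie_center_def)
  let ?P = "{c \<in> carrier A \<inter> aug. z c = 0}"
  have "I \<subseteq> ?P"
    unfolding Lie_centralizer_ideal_def
  proof (rule centralizer_ideal_minimal[OF hom])
    show "ideal ?P A" by (rule Lie_ideal[OF z ring.oneideal[OF ring_A]])
    fix j \<gamma> a
    assume "(j, \<gamma>) \<in> {(j, distribution A (Lie_component A j g)) | j g. g \<in> Lie A}" and a: "a \<in> carrier A"
    then obtain g where g: "g \<in> Lie A" and \<gamma>: "\<gamma> = distribution A (Lie_component A j g)" by blast
    have h: "homogeneous_form j \<gamma>" unfolding \<gamma> by (rule homogeneous_distribution[OF g])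
    note d = linear_map_displacement[OF h]
    have Z: "lin (\<lambda>a. distribution A z (displacement j \<gamma> a))"
      by (rule lin_comp[OF lin_distribution[OF z] d])
    have on_aug: "distribution A z (displacement j \<gamma> b) = 0" if b: "b \<in> aug" for b
    proof -
      note bc = aug.Icarr[OF b]
      let ?g = "Lie_component A j g"
      \<comment> \<open>The component of \<open>?g\<close> in the other degree is the zero form,
        whose displacement contributes nothing.\<close>
      have zero: "distribution A z (displacement k (distribution A (\<lambda>_. 0)) b) = 0" for k
      proof -
        have "homogeneous_form k (distribution A (\<lambda>_. 0))"
          by (simp add: homogeneous_form_def distribution_def lin_zero)
        from lin_displacement[OF this lin_distribution[OF z] bc]
        show ?thesis by (simp add: distribution_def comult_eq_0[OF bc])
      qed
      have "0 = Lie_bracket A z ?g b" using center[OF Lie_component_Lie[OF g]] by simp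
      also have "\<dots> = (\<Sum>k\<in>{0, 1}. distribution A z (displacement k (distribution A (Lie_component A k ?g)) b))"
        by (rule Lie_bracket_displacement[OF z Lie_component_Lie[OF g] b])
      also have "\<dots> = (\<Sum>k\<in>{0, 1}. if k = j then distribution A z (displacement j \<gamma> b) else 0)"
        by (rule sum.cong[OF refl]) (auto simp: Lie_component_component[OF g] LieD(5)[OF g] zero \<gamma>)
      also have "\<dots> = distribution A z (displacement j \<gamma> b)" by (cases j) simp_all
      finally show ?thesis by simp
    qed
    \<comment> \<open>The bracket is recorded only on the augmentation ideal, so constants are
      treated separately: distributions of tangent forms vanish at \<one>.\<close>
    have one: "distribution A z (displacement j \<gamma> \<one>) = 0"
    proof -
      have bil: "bilinear_form A A (\<lambda>x y. distribution A z (twist j x) * \<gamma> y - \<gamma> x * distribution A z y)"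
        by (rule bilinear_diff[OF bilinear_displacement_form[OF h lin_distribution[OF z]]])
      have "\<gamma> \<one> = 0" unfolding \<gamma> by (rule distribution_one[OF Lie_component_Lie[OF g]])
      then show ?thesis
        unfolding lin_displacement[OF h lin_distribution[OF z] A_one_closed] comult_one tensor_sum_apply[OF bil]
        by simp
    qed
    let ?a = "a \<ominus> counit A a \<odot> \<one>"
    have "a = ?a \<oplus> counit A a \<odot> \<one>"
      by (rule eq_by_lin) (use a aug.Icarr[OF reduce_aug[OF a]] in \<open>auto simp: linD(1,2,4)\<close>)
    then have "distribution A z (displacement j \<gamma> a) =
        distribution A z (displacement j \<gamma> (?a \<oplus> counit A a \<odot> \<one>))" by simp
    also have "\<dots> = 0"
      using linD(1)[OF Z aug.Icarr[OF reduce_aug[OF a]] sc_closed[OF A_one_closed]]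
        linD(2)[OF Z A_one_closed] on_aug[OF reduce_aug[OF a]] one by simp
    finally have "distribution A z (displacement j \<gamma> a) = 0" .
    moreover have "displacement j \<gamma> a \<in> aug" unfolding \<gamma> by (rule Lie_displacement_aug[OF g a])
    ultimately show "displacement j \<gamma> a \<in> ?P"
      using distribution_aug[of "displacement j \<gamma> a" z] aug.Icarr by simp
  qed
  then show "\<forall>c\<in>I. z c = 0" by blast
qed

end

subsection \<open>The Lie superalgebra of a supersubgroup\<close>

context
  fixes I
  assumes hopf_I: "hopf_superideal A I"
begin

interpretation I: ideal I A
  using hopf_I by (simp add: hopf_superideal_def)

private abbreviation (input) Q where "Q \<equiv> quotient_hopf A I"

private lemma I_aug: "c \<in> I \<Longrightarrow> c \<in> aug"
  using hopf_I I.Icarr by (simp add: hopf_superideal_def aug_iff)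

private lemma Q_simps:
  "carrier Q = a_rcosets I" "mult Q = rcoset_mult A I" "zero Q = I" "add Q = set_add A"
  "smult Q = (\<lambda>k X. \<Union>x\<in>X. I +> (k \<odot> x))" "counit Q X = counit A (SOME a. a \<in> X)"
  by (simp_all add: quotient_hopf_def quotient_superalgebra_def Let_def FactRing_def)

private lemma Q_add: "\<lbrakk>a \<in> carrier A; b \<in> carrier A\<rbrakk> \<Longrightarrow> (I +> a) \<oplus>\<^bsub>Q\<^esub> (I +> b) = I +> (a \<oplus> b)"
  by (simp add: Q_simps I.a_rcos_sum)

private lemma Q_mult: "\<lbrakk>a \<in> carrier A; b \<in> carrier A\<rbrakk> \<Longrightarrow> (I +> a) \<otimes>\<^bsub>Q\<^esub> (I +> b) = I +> (a \<otimes> b)"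
  by (simp add: Q_simps I.rcoset_mult_add)

private lemma coset_mem: "\<lbrakk>a \<in> carrier A; b \<in> I +> a\<rbrakk> \<Longrightarrow> \<exists>h\<in>I. b = h \<oplus> a"
  by (auto simp: a_r_coset_def')

private lemma coset_eq: "\<lbrakk>a \<in> carrier A; b \<in> I +> a\<rbrakk> \<Longrightarrow> I +> b = I +> a"
  using I.a_repr_independence' by simp

text \<open>Scalar multiplication on the quotient is defined as a union over all representatives;
  they all give the same coset because \<open>I\<close> is closed under scalars.\<close>

private lemma Q_smult: "a \<in> carrier A \<Longrightarrow> k \<odot>\<^bsub>Q\<^esub> (I +> a) = I +> (k \<odot> a)"
proof -
  assume a: "a \<in> carrier A"
  have "I +> (k \<odot> b) = I +> (k \<odot> a)" if b: "b \<in> I +> a" for b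
  proof -
    obtain h where h: "h \<in> I" "b = h \<oplus> a" using coset_mem[OF a b] by blast
    have "k \<odot> b = k \<odot> h \<oplus> k \<odot> a" using h a I.Icarr by (simp add: sc_add_right)
    moreover have "k \<odot> h \<in> I"
      using submodule.smult_closed[OF ideal_submodule[OF I.ideal_axioms]] h by simp
    ultimately have "k \<odot> b \<in> I +> (k \<odot> a)" by (auto simp: a_r_coset_def')
    then show ?thesis by (rule coset_eq[OF sc_closed[OF a]])
  qed
  then show ?thesis unfolding Q_simps using I.a_rcos_self[OF a] by blast
qed

private lemma some_mem: "a \<in> carrier A \<Longrightarrow> (SOME b. b \<in> I +> a) \<in> I +> a"
  by (rule someI, rule I.a_rcos_self)

text \<open>The chosen representative differs from \<open>a\<close> by an element of
  \<open>I\<close>, on which the counit vanishes.\<close>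

private lemma Q_counit: "a \<in> carrier A \<Longrightarrow> counit Q (I +> a) = counit A a"
proof -
  assume a: "a \<in> carrier A"
  obtain h where "h \<in> I" "(SOME b. b \<in> I +> a) = h \<oplus> a"
    using coset_mem[OF a some_mem[OF a]] by blast
  then show ?thesis
    using a I_aug[of h] by (simp add: Q_simps(6) linD(1)[OF counit_linear] aug_iff)
qed

private lemma Q_aug: "augmentation_ideal Q = (\<lambda>a. I +> a) ` aug"
proof -
  have "carrier Q = (\<lambda>a. I +> a) ` carrier A"
    unfolding Q_simps A_RCOSETS_def' by (rule UNION_singleton_eq_range)
  then have carr: "X \<in> carrier Q \<longleftrightarrow> (\<exists>a\<in>carrier A. X = I +> a)" for X
    by (simp only: image_iff)
  have "X \<in> augmentation_ideal Q \<longleftrightarrow> (\<exists>a\<in>aug. X = I +> a)" for X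
  proof
    assume "X \<in> augmentation_ideal Q"
    then have "X \<in> carrier Q" "counit Q X = 0" 
      unfolding augmentation_ideal_def[of Q] mem_Collect_eq by (elim conjunct1, elim conjunct2)
    then obtain a where a: "a \<in> carrier A" "X = I +> a" unfolding carr by (elim bexE)
    then have "a \<in> aug" using \<open>counit Q X = 0\<close> unfolding aug_iff a(2) Q_counit[OF a(1)] by (intro conjI)
    then show "\<exists>a\<in>aug. X = I +> a" using a(2) by (rule bexI[rotated])
  next
    assume "\<exists>a\<in>aug. X = I +> a"
    then obtain a where "a \<in> aug" and X: "X = I +> a" by (elim bexE)
    then have a: "a \<in> carrier A" "counit A a = 0" by (simp_all only: aug_iff)
    have "X \<in> carrier Q" unfolding carr using X a(1) by (rule bexI)
    moreover have "counit Q X = 0" unfolding X Q_counit[OF a(1)] by (rule a(2))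
    ultimately show "X \<in> augmentation_ideal Q" unfolding augmentation_ideal_def[of Q] by (intro CollectI conjI)
  qed
  then show ?thesis unfolding image_def by (intro Set.set_eqI) (simp only: mem_Collect_eq)
qed

private lemma Q_aug_prod:
  "augmentation_ideal Q \<cdot>\<^bsub>Q\<^esub> augmentation_ideal Q = (\<lambda>a. I +> a) ` (aug \<cdot> aug)"
proof (intro equalityI subsetI)
  note carr = ring.ideal_prod_in_carrier[OF ring_A aug_ideal aug_ideal, THEN subsetD]
  show "X \<in> (\<lambda>a. I +> a) ` (aug \<cdot> aug)" if "X \<in> augmentation_ideal Q \<cdot>\<^bsub>Q\<^esub> augmentation_ideal Q" for X
    using that
  proof (induction X rule: ideal_prod.induct)
    case (prod X Y)
    then obtain x y where "x \<in> aug" "y \<in> aug" "X = I +> x" "Y = I +> y" unfolding Q_aug by blast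
    then show ?case
      using ideal_prod.prod[of x aug y aug A] by (auto simp: Q_mult aug_iff)
  next
    case (sum X Y)
    then obtain x y where "x \<in> aug \<cdot> aug" "y \<in> aug \<cdot> aug" "X = I +> x" "Y = I +> y" by blast
    then show ?case
      using ideal_prod.sum[of x A aug aug y] carr by (auto simp: Q_add)
  qed
  have "I +> x \<in> augmentation_ideal Q \<cdot>\<^bsub>Q\<^esub> augmentation_ideal Q" if "x \<in> aug \<cdot> aug" for x
    using that
  proof (induction x rule: ideal_prod.induct)
    case (prod x y)
    then have "(I +> x) \<otimes>\<^bsub>Q\<^esub> (I +> y) \<in> augmentation_ideal Q \<cdot>\<^bsub>Q\<^esub> augmentation_ideal Q"
      by (intro ideal_prod.prod) (auto simp: Q_aug)
    then show ?case using prod by (simp add: Q_mult aug_iff)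
  next
    case (sum x y)
    from ideal_prod.sum[OF sum.IH] show ?case using sum.hyps carr by (simp add: Q_add)
  qed
  then show "X \<in> augmentation_ideal Q \<cdot>\<^bsub>Q\<^esub> augmentation_ideal Q" if "X \<in> (\<lambda>a. I +> a) ` (aug \<cdot> aug)" for X
    using that by blast
qed

private lemma Lie_Q_iff:
  "F \<in> Lie Q \<longleftrightarrow> (\<forall>u\<in>aug. \<forall>v\<in>aug. F (I +> (u \<oplus> v)) = F (I +> u) + F (I +> v)) \<and>
     (\<forall>k. \<forall>v\<in>aug. F (I +> (k \<odot> v)) = k * F (I +> v)) \<and>
     (\<forall>X. X \<notin> (\<lambda>a. I +> a) ` aug \<longrightarrow> F X = 0) \<and> (\<forall>a \<in> aug \<cdot> aug. F (I +> a) = 0)"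
proof -
  have carr: "a \<in> carrier A" if "a \<in> aug" for a using that by (simp add: aug_iff)
  show ?thesis
    by (simp only: Lie_def linear_form_def Q_aug_prod mem_Collect_eq) (simp add: Q_aug Q_add Q_smult carr)
qed

text \<open>The augmentation ideal of the quotient is the image of \<open>aug\<close>, and likewise
  for its square. A tangent form of the subgroup is therefore a tangent form of the group that
  factors through the cosets of \<open>I\<close>.\<close>

lemma Lie_of_subgroup_eq: "Lie_of_subgroup A I = {f \<in> Lie A. \<forall>c\<in>I. f c = 0}"
proof (intro equalityI subsetI)
  fix f assume "f \<in> Lie_of_subgroup A I"
  then obtain F where F: "F \<in> Lie Q" and f: "f = (\<lambda>a. if a \<in> aug then F (I +> a) else 0)"
    unfolding Lie_of_subgroup_def by blast
  have prod_aug: "a \<in> aug" if "a \<in> aug \<cdot> aug" for a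
    using ring.ideal_prod_inter[OF ring_A aug_ideal aug_ideal] that by blast
  have "f \<in> Lie A"
    using F unfolding Lie_iff Lie_Q_iff f
    by (simp add: aug.a_closed aug_sc prod_aug)
  moreover have "f c = 0" if c: "c \<in> I" for c
  proof -
    have join: "I +> x = I" if "x \<in> I" for x
      by (rule abelian_group.a_coset_join2[OF ring.is_abelian_group[OF ring_A] I.Icarr[OF that] I.a_subgroup that])
    \<comment> \<open>The coset of \<open>c\<close> is the zero coset; written as a multiple by 0,
      it is seen to be killed by the linearity of \<open>F\<close>.\<close>
    have "I +> c = I +> (0 \<odot> c)"
      using join[OF c] join[OF I.zero_closed] I.Icarr[OF c] by simp
    also have "F (I +> (0 \<odot> c)) = 0 * F (I +> c)" using F I_aug[OF c] unfolding Lie_Q_iff by blast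
    finally show ?thesis unfolding f by simp
  qed
  ultimately show "f \<in> {f \<in> Lie A. \<forall>c\<in>I. f c = 0}" by blast
next
  fix f assume "f \<in> {f \<in> Lie A. \<forall>c\<in>I. f c = 0}"
  then have f: "f \<in> Lie A" and f0: "\<And>c. c \<in> I \<Longrightarrow> f c = 0" by auto
  \<comment> \<open>A representative is chosen in each coset; \<open>Ff\<close> shows that the
    choice is immaterial as \<open>f\<close> vanishes on \<open>I\<close>. The value 0 elsewhere is
    the normalisation required in \<open>Lie\<close>.\<close>
  define F where "F X = (if X \<in> (\<lambda>a. I +> a) ` aug then f (SOME b. b \<in> X) else 0)" for X
  have Ff: "F (I +> a) = f a" if a: "a \<in> aug" for a
  proof -
    note ac = aug.Icarr[OF a]
    obtain h where h: "h \<in> I" "(SOME b. b \<in> I +> a) = h \<oplus> a"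
      using coset_mem[OF ac some_mem[OF ac]] by blast
    then show ?thesis using a f0[OF h(1)] LieD(1)[OF f I_aug[OF h(1)] a] by (simp add: F_def)
  qed
  have prod_aug: "a \<in> aug" if "a \<in> aug \<cdot> aug" for a
    using ring.ideal_prod_inter[OF ring_A aug_ideal aug_ideal] that by blast
  have "F \<in> Lie Q"
    unfolding Lie_Q_iff
  proof (intro conjI ballI allI impI)
    show "F X = 0" if "X \<notin> (\<lambda>a. I +> a) ` aug" for X using that by (simp add: F_def)
  qed (simp_all add: Ff aug.a_closed aug_sc prod_aug LieD(1,2,4)[OF f])
  moreover have "f = (\<lambda>a. if a \<in> aug then F (I +> a) else 0)"
    using LieD(3)[OF f] by (auto simp: Ff)
  ultimately show "f \<in> Lie_of_subgroup A I" unfolding Lie_of_subgroup_def by blast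
qed

end

theorem Lie_of_subgroup_Lie_centralizer: "Lie_of_subgroup A Lie_centralizer_ideal = Lie_center A"
proof -
  have "Lie_center A \<subseteq> Lie A" by (simp add: Lie_center_def)
  then show ?thesis
    unfolding Lie_of_subgroup_eq[OF hopf_superideal_Lie_centralizer]
    using Lie_center_iff_vanishing by blast
qed

end

theorem lemma11p12:
  fixes H :: "('k::{alg_closed_field, field_char_0}, 'a) hopf_superalgebra"
  assumes "algebraic_supergroup H"
    and "connected_supergroup H"
    and "quasireductive H"
  shows "\<exists>I. hopf_superideal H I \<and> Lie_of_subgroup H I = Lie_center H"
proof -
  interpret H: hopf_superalgebra H
    using assms(1) by (simp add: algebraic_supergroup_def)
  show ?thesis
    by (rule exI[of _ H.Lie_centralizer_ideal], rule conjI[OF H.hopf_superideal_Lie_centralizer])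
      (rule H.Lie_of_subgroup_Lie_centralizer)
qed

end
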